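(* Let $p$ be an odd prime. Let $I$ be the proportion of monic degree-$4$ polynomials in $\mathbb{Z}_p[x]$ that are irreducible. Then $$I=\frac{p^{12}+p^{11}+2p^{10}+4p^9-2p^8+p^7+3p^6-6p^5+6p^4-4p^3-2p^2-4}{4(p+1)(p^2+1)(p^9-1)}.$$
   Context: Monic quartics $x^4+c_3x^3+c_2x^2+c_1x+c_0$ are identified with points of $\mathbb{Z}_p^4$, which carries normalized Haar measure. The proportion of irreducibles is the Haar measure of the set of irreducible monic quartics. Irreducible means not a product of two nonconstant polynomials in $\mathbb{Z}_p[x]$. *)

theory Defs
  imports "HOL-Probability.Probability" "HOL-Algebra.Polynomials"
begin

text \<open>The ring Z_p of p-adic integers, realised as the inverse limit of the rings
  Z/p^n Z: an element is a compatible sequence (a n) with 0 <= a n < p^n and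
  a (n+1) mod p^n = a n; ring operations are componentwise mod p^n.\<close>

definition padic_ring :: "nat \<Rightarrow> (nat \<Rightarrow> int) ring" where
  "padic_ring p =
     \<lparr> carrier = {a. \<forall>n. 0 \<le> a n \<and> a n < int p ^ n \<and> a (Suc n) mod (int p ^ n) = a n},
       mult = (\<lambda>a b n. (a n * b n) mod (int p ^ n)),
       one = (\<lambda>n. 1 mod (int p ^ n)),
       zero = (\<lambda>n. 0),
       add = (\<lambda>a b n. (a n + b n) mod (int p ^ n)) \<rparr>"

definition padic_of_digits :: "nat \<Rightarrow> (nat \<Rightarrow> nat) \<Rightarrow> (nat \<Rightarrow> int)" where
  "padic_of_digits p d = (\<lambda>n. int (\<Sum>k<n. d k * p ^ k))"

text \<open>Normalized Haar measure on Z_p^4, realised via base-p digits: the digits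
  (indexed by (coefficient index i, digit position k)) are independent and uniform
  on {0..<p}.  Only the indices i < 4 are used.\<close>

definition digit_space :: "nat \<Rightarrow> (nat \<times> nat \<Rightarrow> nat) measure" where
  "digit_space p = PiM UNIV (\<lambda>_. measure_pmf (pmf_of_set {0..<p}))"

text \<open>The monic quartic x^4 + c3 x^3 + c2 x^2 + c1 x + c0 over Z_p whose coefficient
  c_i has digit sequence (\<lambda>k. d (i,k)); HOL-Algebra polynomials are coefficient
  lists with the leading coefficient first.\<close>

definition monic_quartic_of_digits :: "nat \<Rightarrow> (nat \<times> nat \<Rightarrow> nat) \<Rightarrow> (nat \<Rightarrow> int) list" where
  "monic_quartic_of_digits p d =
     [\<one>\<^bsub>padic_ring p\<^esub>,
      padic_of_digits p (\<lambda>k. d (3,k)), padic_of_digits p (\<lambda>k. d (2,k)),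
      padic_of_digits p (\<lambda>k. d (1,k)), padic_of_digits p (\<lambda>k. d (0,k))]"

definition padic_poly_irreducible :: "nat \<Rightarrow> (nat \<Rightarrow> int) list \<Rightarrow> bool" where
  "padic_poly_irreducible p f \<longleftrightarrow>
     \<not> (\<exists>g \<in> carrier (univ_poly (padic_ring p) (carrier (padic_ring p))).
         \<exists>h \<in> carrier (univ_poly (padic_ring p) (carrier (padic_ring p))).
           Polynomials.degree g \<ge> 1 \<and> Polynomials.degree h \<ge> 1 \<and>
           f = g \<otimes>\<^bsub>univ_poly (padic_ring p) (carrier (padic_ring p))\<^esub> h)"

end

theory Submission
  imports Defs "HOL-Number_Theory.Cong"
begin

text \<open>
  Compactness turns reducibility over \<open>Z_p\<close> into reducibility modulo every power of \<open>p\<close>, so the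
  measure is the limit of the proportions of quartics that are irreducible modulo \<open>p\<^sup>n\<close>. As \<open>p\<close> is
  odd, a translation reduces to depressed quartics \<open>f = x\<^sup>4 + ax\<^sup>2 + bx + c\<close>. By Hensel's lemma \<open>f\<close>
  splits unless, modulo \<open>p\<close>, it is irreducible, the square of an irreducible quadratic, or \<open>x\<^sup>4\<close>. In
  the second case write \<open>f = (x\<^sup>2 + e)\<^sup>2 - r\<^sub>1x - r\<^sub>0\<close>: then \<open>f\<close> splits iff \<open>r\<close> is, up to a
  perturbation that Hensel's lemma absorbs, a square in the unramified quadratic extension. In the last
  case the Newton polygon decides, except that slope \<open>1/2\<close> requires the same analysis in a ramified
  extension, and that \<open>p\<^sup>2 | a\<close>, \<open>p\<^sup>3 | b\<close>, \<open>p\<^sup>4 | c\<close> gives back, after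
  \<open>x \<mapsto> px\<close>, an arbitrary depressed quartic. This self-similarity of density \<open>p\<^sup>-\<^sup>9\<close> is the source of the factor
  \<open>p\<^sup>9 - 1\<close> and yields a linear equation for the density.
\<close>

text \<open>Up to the ring-theoretic end everything is divisibility of integers by
  \<open>p ^ n\<close>, and measure is an average over residues. Rescaling a quartic loses digits,
  so the self-similar equation holds at finite level only as a sandwich between the densities at
  levels \<open>n\<close> and \<open>n + 4\<close>. That the densities converge is not drawn from
  this recursion but from the measure: the events "reducible modulo \<open>p ^ n\<close>" decrease.
  The equation is solved in the limit. The condition "r is a square" is perturbed by a quartic term
  whose coefficient changes under scaling; hence squares are studied in families
  (\<open>qsol\<close>, \<open>hsol\<close>) with free coefficients that scaling preserves. In the
  integers of a local field with q residue classes, q odd, non-square units have density (q-1)/(2q),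
  elements of valuation 1 have density 1/q - 1/q^2 and are no squares, and the rest is a copy of
  weight q^-2. So non-squares have density (q+2)/(2(q+1)). The unramified extension has q = p^2
  (\<open>gam\<close>), a ramified one q = p (\<open>eta\<close>); this is where the factors p^2 + 1
  and p + 1 of the denominator come from.\<close>

lemma dvd_cong: "(m::int) dvd a - b \<Longrightarrow> m dvd a \<longleftrightarrow> m dvd b"
  by (metis dvd_add_right_iff diff_add_cancel)

lemmas ring_expand = algebra_simps power2_eq_square power3_eq_cube power4_eq_xxxx

lemma sum_Pow_card:
  assumes "finite A"
  shows "(\<Sum>S\<in>Pow A. h (card S)) = (\<Sum>k\<le>card A. of_nat (card A choose k) * (h k :: real))"
proof -
  have "(\<Sum>S\<in>Pow A. h (card S)) = (\<Sum>k\<in>{..card A}. \<Sum>S\<in>{S \<in> Pow A. card S = k}. h (card S))"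
    using assms by (intro sum.group[symmetric]) (auto simp: card_mono)
  also have "\<dots> = (\<Sum>k\<le>card A. of_nat (card A choose k) * h k)"
    using n_subsets[OF assms] by (intro sum.cong) auto
  finally show ?thesis .
qed

lemma card_two_to_one:
  assumes "finite S" "\<And>x. x \<in> S \<Longrightarrow> card {y \<in> S. f y = f x} = 2"
  shows "card S = 2 * card (f ` S)"
proof -
  have "card S = (\<Sum>z\<in>f ` S. \<Sum>y\<in>{y \<in> S. f y = z}. 1)"
    using sum.image_gen[OF assms(1), of "\<lambda>_. 1 :: nat" f] by simp
  also have "\<dots> = (\<Sum>z\<in>f ` S. 2)" using assms(2) by (intro sum.cong) auto
  finally show ?thesis by simp
qed

section \<open>Compactness for inverse limits of finite sets\<close>

lemma decreasing_finite_inter: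
  assumes fin: "finite F" and S: "\<And>k::nat. S k \<subseteq> F" "\<And>k. S (Suc k) \<subseteq> S k" "\<And>k. S k \<noteq> {}"
  shows "\<exists>x\<in>F. \<forall>k. x \<in> S k"
proof (rule ccontr)
  assume "\<not> ?thesis"
  then obtain k where k: "\<And>x. x \<in> F \<Longrightarrow> x \<notin> S (k x)" by metis
  define K where "K = Max (insert 0 (k ` F))"
  obtain x where x: "x \<in> S K" using S(3) by blast
  then have "x \<in> F" using S(1) by blast
  then have "k x \<le> K" using fin unfolding K_def by (intro Max_ge) auto
  then have "S K \<subseteq> S (k x)" by (rule lift_Suc_antimono_le[where f = S, OF S(2)])
  then show False using k x S(1) by blast
qed

text \<open>Koenig's lemma: a compatible choice can be continued forever if it stays among the
  elements that lift to every level, and these never run out because decreasing nonempty subsets of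
  a finite set have a common point.\<close>

lemma inverse_limit_nonempty:
  fixes T :: "nat \<Rightarrow> 'a set"
  assumes fin: "\<And>n. finite (T n)" and ne: "\<And>n. T n \<noteq> {}" and r: "\<And>n x. x \<in> T (Suc n) \<Longrightarrow> r n x \<in> T n"
  shows "\<exists>y. \<forall>n. y n \<in> T n \<and> r n (y (Suc n)) = y n"
proof -
  \<comment> \<open>\<open>D n k\<close> is the composite projection from \<open>T (n + k)\<close>
    to \<open>T n\<close>. The recursion peels off the topmost map; \<open>DS'\<close> peels off the
    lowest one.\<close>
  define D where "D = (\<lambda>n k. rec_nat (\<lambda>z. z) (\<lambda>k' f z. f (r (n + k') z)) k)"
  have D0: "D n 0 z = z" and DS: "D n (Suc k) z = D n k (r (n + k) z)" for n k z
    by (simp_all add: D_def)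
  have DS': "D n (Suc k) z = r n (D (Suc n) k z)" for n k z
    by (induction k arbitrary: z) (simp_all add: D0 DS)
  have DT: "z \<in> T (n + k) \<Longrightarrow> D n k z \<in> T n" for n k z
    by (induction k arbitrary: z) (simp_all add: D0 DS r)
  define Ext where "Ext n x \<longleftrightarrow> x \<in> T n \<and> (\<forall>k. x \<in> D n k ` T (n + k))" for n x
  have "\<exists>x\<in>T 0. \<forall>k. x \<in> D 0 k ` T k"
  proof (rule decreasing_finite_inter[OF fin])
    show "D 0 k ` T k \<subseteq> T 0" for k using DT[of _ 0 k] by auto
    show "D 0 (Suc k) ` T (Suc k) \<subseteq> D 0 k ` T k" for k using r by (auto simp: DS)
  qed (use ne in auto)
  then have base: "\<exists>x. Ext 0 x" by (auto simp: Ext_def)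
  have step: "\<exists>x'. Ext (Suc n) x' \<and> r n x' = x" if x: "Ext n x" for n x
  proof -
    let ?F = "{x' \<in> T (Suc n). r n x' = x}"
    let ?S = "\<lambda>k. ?F \<inter> D (Suc n) k ` T (Suc n + k)"
    have "\<exists>x'\<in>?F. \<forall>k. x' \<in> ?S k"
    proof (rule decreasing_finite_inter)
      show "finite ?F" using fin by simp
      show "?S (Suc k) \<subseteq> ?S k" for k using r[of _ "Suc n + k"] by (auto simp: DS)
      show "?S k \<noteq> {}" for k
      proof -
        obtain z where z: "z \<in> T (n + Suc k)" "x = D n (Suc k) z" using x unfolding Ext_def by blast
        then have "D (Suc n) k z \<in> T (Suc n)" "r n (D (Suc n) k z) = x" using DT[of z "Suc n" k] by (simp_all add: DS')
        then show ?thesis using z(1) by auto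
      qed
    qed auto
    then show ?thesis unfolding Ext_def by blast
  qed
  from dependent_nat_choice[of Ext "\<lambda>n x x'. r n x' = x"] base step
  obtain y where "\<And>n. Ext n (y n)" "\<And>n. r n (y (Suc n)) = y n" by metis
  then show ?thesis by (intro exI[of _ y]) (auto simp: Ext_def)
qed

section \<open>Divisibility by powers of an odd prime\<close>

locale odd_prime =
  fixes p :: int
  assumes prime_p: "Factorial_Ring.prime p" and odd_p: "odd p"
begin

lemma p_gt2: "p > 2"
  using prime_p odd_p prime_ge_2_int[of p] by (cases "p = 2") auto

lemma p_pos [simp]: "p > 0" "p \<noteq> 0" "p ^ n > 0" "p ^ n \<noteq> 0"
  using p_gt2 by auto

lemma real_p_gt2: "real_of_int p > 2"
  using p_gt2 by simp

lemma pdvd_mult [simp]: "p dvd a * b \<longleftrightarrow> p dvd a \<or> p dvd b"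
  using prime_p by (simp add: prime_dvd_mult_iff)

lemma pdvd_pow [simp]: "n > 0 \<Longrightarrow> p dvd a ^ n \<longleftrightarrow> p dvd a"
  using prime_p by (simp add: prime_dvd_power_iff)

lemma not_pdvd_2 [simp]: "\<not> p dvd 2" "\<not> p dvd 4" "\<not> p dvd 8" "\<not> p dvd 1"
proof -
  show 2: "\<not> p dvd 2" using zdvd_imp_le[of p 2] p_gt2 by auto
  show "\<not> p dvd 4" using 2 pdvd_pow[of 2 2] by (simp del: pdvd_pow)
  show "\<not> p dvd 8" using 2 pdvd_pow[of 3 2] by (simp del: pdvd_pow)
  show "\<not> p dvd 1" using 2 dvd_trans[of p 1 2] by auto
qed

lemma abs_p_ne_1 [simp]: "\<bar>p\<bar> \<noteq> 1"
  using p_gt2 by simp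

lemma inverse_mod_prime_power:
  assumes "\<not> p dvd u"
  obtains v where "p ^ n dvd u * v - 1"
proof -
  have "coprime u (p ^ n)"
    using assms prime_p by (simp add: coprime_commute prime_imp_coprime)
  then obtain v where "[u * v = 1] (mod p ^ n)" using cong_solve_coprime_int by blast
  then show ?thesis using that by (simp add: cong_iff_dvd_diff)
qed

lemma dvd_unit_cancel: "\<not> p dvd u \<Longrightarrow> p ^ n dvd u * x \<longleftrightarrow> p ^ n dvd x"
  using prime_p by (intro coprime_dvd_mult_right_iff) (simp add: prime_imp_coprime)

subsection \<open>Averages over residues modulo prime powers\<close>

text \<open>Finite averages stand in for Haar measure: for a function periodic modulo
  \<open>p ^ N\<close> this is its Haar integral, and by \<open>mean_level\<close> any higher level
  gives the same value.\<close>

definition mean :: "nat \<Rightarrow> (int \<Rightarrow> real) \<Rightarrow> real" where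
  "mean N f = (\<Sum>x\<in>{0..<p ^ N}. f x) / real_of_int (p ^ N)"

lemma mean_0 [simp]: "mean 0 f = f 0"
proof -
  have "{0..<1::int} = {0}" by auto
  then show ?thesis by (simp add: mean_def)
qed

lemma mean_const [simp]: "mean N (\<lambda>_. c) = c"
proof -
  have "real (nat (p ^ N)) = real_of_int p ^ N"
    using p_pos(3)[of N] by (metis of_int_power of_nat_nat of_int_of_nat_eq less_imp_le)
  then show ?thesis by (simp add: mean_def)
qed

lemma mean_add: "mean N (\<lambda>x. f x + g x) = mean N f + mean N g"
  by (simp add: mean_def sum.distrib add_divide_distrib)

lemma mean_diff: "mean N (\<lambda>x. f x - g x) = mean N f - mean N g"
  by (simp add: mean_def sum_subtractf diff_divide_distrib)

lemma mean_cmult: "mean N (\<lambda>x. c * f x) = c * mean N f"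
  by (simp add: mean_def sum_distrib_left)

lemma mean_multc: "mean N (\<lambda>x. f x * c) = mean N f * c"
  by (simp add: mean_def sum_distrib_right)

lemma mean_divc: "mean N (\<lambda>x. f x / c) = mean N f / c"
  using mean_multc[of N f "inverse c"] by (simp add: field_simps)

lemma mean_sum: "mean N (\<lambda>x. \<Sum>i\<in>I. f i x) = (\<Sum>i\<in>I. mean N (f i))"
  unfolding mean_def by (subst sum.swap) (simp add: sum_divide_distrib)

lemma mean_mono: "(\<And>x. f x \<le> g x) \<Longrightarrow> mean N f \<le> mean N g"
  by (auto simp: mean_def less_imp_le intro!: divide_right_mono sum_mono)

lemma mean_cong: "(\<And>x. f x = g x) \<Longrightarrow> mean N f = mean N g"
  by (simp add: mean_def)

lemma mean_split:
  "mean (Suc N) f = (\<Sum>r\<in>{0..<p}. mean N (\<lambda>x. f (r + p * x))) / p"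
proof -
  have "(\<Sum>y\<in>{0..<p ^ Suc N}. f y) = (\<Sum>(r,x)\<in>{0..<p} \<times> {0..<p ^ N}. f (r + p * x))"
  proof (rule sum.reindex_bij_witness[of _ "\<lambda>(r,x). r + p * x" "\<lambda>y. (y mod p, y div p)"], goal_cases)
    case (2 y)
    have "y div p < p ^ N"
    proof (rule ccontr)
      assume "\<not> y div p < p ^ N"
      then have "p * p ^ N \<le> p * (y div p)" by (intro mult_left_mono) (auto simp: less_imp_le)
      moreover have "p * (y div p) + y mod p = y" "0 \<le> y mod p" by auto
      ultimately have "p * p ^ N \<le> y" by linarith
      then show False using 2 by simp
    qed
    then show ?case using 2 by (auto simp: pos_imp_zdiv_nonneg_iff)
  next
    case (4 b)
    obtain r x where b: "b = (r, x)" by force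
    with 4 have "r < p" "0 \<le> r" "0 \<le> x" "x + 1 \<le> p ^ N" by auto
    then have "p * (x + 1) \<le> p * p ^ N" by (intro mult_left_mono) auto
    with \<open>r < p\<close> have "r + p * x < p * p ^ N" by (simp add: algebra_simps)
    then show ?case using b \<open>0 \<le> r\<close> \<open>0 \<le> x\<close> by (auto simp: less_imp_le)
  qed auto
  also have "\<dots> = (\<Sum>r\<in>{0..<p}. \<Sum>x\<in>{0..<p ^ N}. f (r + p * x))"
    by (simp add: sum.cartesian_product)
  finally show ?thesis
    by (simp add: mean_def sum_divide_distrib[symmetric] mult.commute)
qed

lemma mean_level_Suc:
  assumes "\<And>x y. p ^ N dvd x - y \<Longrightarrow> f x = f y"
  shows "mean (Suc N) f = mean N f"
  using assms
proof (induction N arbitrary: f)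
  case 0
  then have "f = (\<lambda>_. f 0)" by auto
  then show ?case by (metis mean_const)
next
  case (Suc N)
  have "mean (Suc N) (\<lambda>x. f (r + p * x)) = mean N (\<lambda>x. f (r + p * x))" for r
  proof (rule Suc.IH)
    fix x y assume "p ^ N dvd x - y"
    then have "p ^ Suc N dvd p * (x - y)" by simp
    then show "f (r + p * x) = f (r + p * y)"
      by (intro Suc.prems) (simp add: algebra_simps)
  qed
  then show ?case
    by (subst mean_split, subst (2) mean_split) simp
qed

lemma mean_level:
  assumes "\<And>x y. p ^ N dvd x - y \<Longrightarrow> f x = f y" and "N \<le> M"
  shows "mean M f = mean N f"
  using assms(2)
proof (induction rule: dec_induct)
  case (step k)
  have "p ^ N dvd x - y" if "p ^ k dvd x - y" for x y
    using that step.hyps(1) by (meson dvd_trans le_imp_power_dvd)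
  then show ?case using mean_level_Suc[of k f] assms(1) step by metis
qed simp

lemma mean_affine:
  assumes per: "\<And>x y. p ^ N dvd x - y \<Longrightarrow> f x = f y" and u: "\<not> p dvd u"
  shows "mean N (\<lambda>x. f (u * x + v)) = mean N f"
proof -
  let ?g = "\<lambda>x. (u * x + v) mod p ^ N"
  have inj: "inj_on ?g {0..<p ^ N}"
  proof (rule inj_onI)
    fix x y assume xy: "x \<in> {0..<p ^ N}" "y \<in> {0..<p ^ N}" "?g x = ?g y"
    then have "p ^ N dvd u * (x - y)" by (simp add: mod_eq_dvd_iff algebra_simps)
    then have "p ^ N dvd x - y" using dvd_unit_cancel[OF u] by blast
    then have "x mod p ^ N = y mod p ^ N" by (simp add: mod_eq_dvd_iff)
    then show "x = y" using xy(1,2) by simp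
  qed
  then have "bij_betw ?g {0..<p ^ N} {0..<p ^ N}"
    by (intro bij_betw_imageI endo_inj_surj) auto
  then have "(\<Sum>x\<in>{0..<p ^ N}. f (?g x)) = (\<Sum>x\<in>{0..<p ^ N}. f x)"
    by (rule sum.reindex_bij_betw)
  moreover have "f (?g x) = f (u * x + v)" for x
    by (rule per) (simp add: mod_eq_dvd_iff[symmetric])
  ultimately show ?thesis by (simp add: mean_def)
qed

lemma mean_dvd_Suc:
  "mean (Suc N) (\<lambda>x. if p dvd x then f x else 0) = mean N (\<lambda>x. f (p * x)) / p"
proof -
  have "mean N (\<lambda>x. if p dvd r + p * x then f (r + p * x) else 0) =
        (if r = 0 then mean N (\<lambda>x. f (p * x)) else 0)" if "r \<in> {0..<p}" for r
  proof (cases "r = 0")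
    case False
    then have "\<not> p dvd r" using that zdvd_not_zless[of r p] by auto
    then have "\<not> p dvd r + p * x" for x using dvd_add_left_iff[of p "p * x" r] by simp
    then show ?thesis using False by simp
  qed simp
  then show ?thesis by (simp add: mean_split)
qed

text \<open>The multiples of \<open>p ^ j\<close> are a copy of all residues with weight p^-j, at
  the price of \<open>j\<close> digits of precision. Every self-similarity below rests on
  this.\<close>

lemma mean_dvd:
  "mean (N + j) (\<lambda>x. if p ^ j dvd x then f x else 0) = mean N (\<lambda>x. f (p ^ j * x)) / p ^ j"
proof (induction j arbitrary: f)
  case (Suc j)
  have "(\<lambda>x. if p ^ Suc j dvd x then f x else 0) =
        (\<lambda>x. if p dvd x then if p ^ Suc j dvd x then f x else 0 else 0)"
    by (auto simp: fun_eq_iff dest: dvd_mult_left)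
  then have "mean (N + Suc j) (\<lambda>x. if p ^ Suc j dvd x then f x else 0) =
      mean (N + j) (\<lambda>x. if p ^ j dvd x then f (p * x) else 0) / p"
    using mean_dvd_Suc[of "N + j" "\<lambda>x. if p ^ Suc j dvd x then f x else 0"] by simp
  then show ?case using Suc.IH[of "\<lambda>x. f (p * x)"] by (simp add: mult.assoc mult.left_commute)
qed simp

lemma mean_dvd_le:
  assumes "j \<le> N"
  shows "mean N (\<lambda>x. if p ^ j dvd x then f x else 0) = mean (N - j) (\<lambda>x. f (p ^ j * x)) / p ^ j"
  using mean_dvd[of "N - j" j f] assms by simp

lemma mean_indicator_dvd:
  "j \<le> N \<Longrightarrow> mean N (\<lambda>x. of_bool (p ^ j dvd x)) = 1 / p ^ j"
  using mean_dvd_le[of j N "\<lambda>_. 1"] by (simp add: of_bool_def)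

subsection \<open>Hensel lifting\<close>

text \<open>The leading coefficient is free because the lemma is also applied to rescaled quartics,
  where \<open>p\<close> divides it.\<close>

lemma hensel_root:
  assumes "p dvd A * x0 ^ 4 + B * x0 ^ 2 + C * x0 + D"
      and "\<not> p dvd 4 * A * x0 ^ 3 + 2 * B * x0 + C"
  shows "\<exists>x. p ^ n dvd A * x ^ 4 + B * x ^ 2 + C * x + D"
proof -
  let ?f = "\<lambda>x. A * x ^ 4 + B * x ^ 2 + C * x + D"
  let ?f' = "\<lambda>x. 4 * A * x ^ 3 + 2 * B * x + C"
  have "\<exists>x. p dvd x - x0 \<and> p ^ Suc n dvd ?f x"
  proof (induction n)
    case 0
    then show ?case using assms by (intro exI[of _ x0]) auto
  next
    case (Suc n)
    then obtain x k where x: "p dvd x - x0" and k: "?f x = p ^ Suc n * k" by (metis dvdE)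
    have "?f' x - ?f' x0 = (x - x0) * (4 * A * (x\<^sup>2 + x * x0 + x0\<^sup>2) + 2 * B)"
      by (simp add: ring_expand)
    then have "p dvd ?f' x - ?f' x0" using x by simp
    then have "\<not> p dvd ?f' x" using assms(2) by (metis dvd_cong)
    then obtain i where i: "p ^ 1 dvd ?f' x * i - 1" using inverse_mod_prime_power by blast
    define h where "h = p ^ Suc n"
    \<comment> \<open>Newton step: as \<open>i\<close> inverts the derivative modulo
      \<open>p\<close>, the terms of order \<open>h\<close> cancel up to a multiple of
      \<open>h * p\<close>, and the second order term contains h^2, again a multiple of
      \<open>h * p\<close>.\<close>
    define y where "y = x - h * (i * k)"
    obtain l where l: "?f' x * i - 1 = p * l" using i by (auto elim: dvdE)
    define G where "G = A * (6 * x\<^sup>2 - 4 * x * (h * (i * k)) + (h * (i * k))\<^sup>2) + B"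
    have "?f (x - z) = ?f x - z * ?f' x + z\<^sup>2 * (A * (6 * x\<^sup>2 - 4 * x * z + z\<^sup>2) + B)" for z
      by (simp add: ring_expand)
    from this[of "h * (i * k)"] have "?f y = ?f x - h * (i * k) * ?f' x + h\<^sup>2 * ((i * k)\<^sup>2 * G)"
      unfolding y_def G_def by (simp only: power_mult_distrib mult.assoc)
    also have "h * (i * k) * ?f' x = h * k * (?f' x * i)" by simp
    also have "?f' x * i = 1 + p * l" using l by simp
    also have "?f x - h * k * (1 + p * l) + h\<^sup>2 * ((i * k)\<^sup>2 * G) = - (h * p * (k * l)) + h\<^sup>2 * ((i * k)\<^sup>2 * G)"
      using k by (simp add: h_def algebra_simps)
    also have "h\<^sup>2 = h * p * p ^ n" by (simp add: h_def power2_eq_square)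
    also have "- (h * p * (k * l)) + h * p * p ^ n * ((i * k)\<^sup>2 * G) = h * p * (p ^ n * ((i * k)\<^sup>2 * G) - k * l)"
      by (simp add: right_diff_distrib mult.assoc)
    finally have "h * p dvd ?f y" by simp
    moreover have "y - x0 = (x - x0) - p * (p ^ n * (i * k))" by (simp add: y_def h_def)
    then have "p dvd y - x0" using x by (metis dvd_diff dvd_triv_left)
    ultimately show ?case by (intro exI[of _ y]) (simp add: h_def mult.commute)
  qed
  then show ?thesis by (metis dvd_trans le_imp_power_dvd lessI less_imp_le)
qed

text \<open>Newton iteration for the map (x, y) -> (4xy, F(x, y)), the common shape of
  \<open>qsol\<close> and \<open>hsol\<close>. Its Jacobian determinant is 8 times the quantity in
  hypothesis \<open>D\<close>.\<close>

lemma hensel_pair: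
  assumes "p dvd r1 - 4 * x0 * y0"
      and "p dvd r0 - (\<alpha> * x0 ^ 2 + \<beta> * y0 ^ 2 + \<gamma> * x0 ^ 4 + \<delta> * y0 ^ 4)"
      and D: "\<not> p dvd \<beta> * y0 ^ 2 + 2 * \<delta> * y0 ^ 4 - \<alpha> * x0 ^ 2 - 2 * \<gamma> * x0 ^ 4"
  shows "\<exists>x y. p ^ n dvd r1 - 4 * x * y \<and>
           p ^ n dvd r0 - (\<alpha> * x ^ 2 + \<beta> * y ^ 2 + \<gamma> * x ^ 4 + \<delta> * y ^ 4)"
proof -
  let ?F = "\<lambda>x y. \<alpha> * x ^ 2 + \<beta> * y ^ 2 + \<gamma> * x ^ 4 + \<delta> * y ^ 4"
  let ?D = "\<lambda>x y. \<beta> * y ^ 2 + 2 * \<delta> * y ^ 4 - \<alpha> * x ^ 2 - 2 * \<gamma> * x ^ 4"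
  have "\<exists>x y. p dvd x - x0 \<and> p dvd y - y0 \<and> p ^ Suc n dvd r1 - 4 * x * y \<and> p ^ Suc n dvd r0 - ?F x y"
  proof (induction n)
    case 0
    then show ?case using assms by (intro exI[of _ x0] exI[of _ y0]) auto
  next
    case (Suc n)
    define h where "h = p ^ Suc n"
    obtain x y A B where x: "p dvd x - x0" and y: "p dvd y - y0"
      and A: "r1 - 4 * x * y = h * A" and B: "r0 - ?F x y = h * B"
      using Suc unfolding h_def by (metis dvdE)
    have "?D x y - ?D x0 y0 = (y - y0) * (\<beta> * (y + y0) + 2 * \<delta> * (y + y0) * (y\<^sup>2 + y0\<^sup>2))
        - (x - x0) * (\<alpha> * (x + x0) + 2 * \<gamma> * (x + x0) * (x\<^sup>2 + x0\<^sup>2))"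
      by (simp add: ring_expand)
    then have "p dvd ?D x y - ?D x0 y0" using x y by (simp add: dvd_diff)
    then have "\<not> p dvd ?D x y" using D by (metis dvd_cong)
    then have "\<not> p dvd 8 * ?D x y" unfolding pdvd_mult by simp
    then obtain i where "p ^ 1 dvd 8 * ?D x y * i - 1" using inverse_mod_prime_power by blast
    then obtain l where l: "8 * ?D x y * i - 1 = p * l" by (auto elim: dvdE)
    define Fx Fy where "Fx = 2 * \<alpha> * x + 4 * \<gamma> * x ^ 3" and "Fy = 2 * \<beta> * y + 4 * \<delta> * y ^ 3"
    \<comment> \<open>Cramer's rule for the linearised system, with \<open>i\<close> inverting the
      Jacobian modulo \<open>p\<close>.\<close>
    define s t where "s = i * (A * Fy - 4 * x * B)" and "t = i * (4 * y * B - A * Fx)"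
    have s: "4 * y * s + 4 * x * t = A + p * (l * A)"
    proof -
      have "4 * y * s + 4 * x * t = (8 * ?D x y * i) * A"
        unfolding s_def t_def Fx_def Fy_def by (simp add: ring_expand)
      also have "8 * ?D x y * i = 1 + p * l" using l by simp
      finally show ?thesis by (simp add: algebra_simps)
    qed
    have t: "Fx * s + Fy * t = B + p * (l * B)"
    proof -
      have "Fx * s + Fy * t = (8 * ?D x y * i) * B"
        unfolding s_def t_def Fx_def Fy_def by (simp add: ring_expand)
      also have "8 * ?D x y * i = 1 + p * l" using l by simp
      finally show ?thesis by (simp add: algebra_simps)
    qed
    have h2: "h * h = h * p * p ^ n" by (simp add: h_def)
    have "r1 - 4 * (x + h * s) * (y + h * t) = (r1 - 4 * x * y) - h * (4 * y * s + 4 * x * t) - h * h * (4 * s * t)"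
      by (simp add: ring_expand)
    also have "\<dots> = h * p * (- (l * A) - p ^ n * (4 * s * t))"
      unfolding A s h2 by (simp add: algebra_simps)
    finally have 1: "h * p dvd r1 - 4 * (x + h * s) * (y + h * t)" by simp
    define G where "G = \<alpha> * s\<^sup>2 + \<beta> * t\<^sup>2 + \<gamma> * (6 * x\<^sup>2 * s\<^sup>2 + 4 * x * s ^ 3 * h + s ^ 4 * h\<^sup>2)
        + \<delta> * (6 * y\<^sup>2 * t\<^sup>2 + 4 * y * t ^ 3 * h + t ^ 4 * h\<^sup>2)"
    have "r0 - ?F (x + h * s) (y + h * t) = (r0 - ?F x y) - h * (Fx * s + Fy * t) - h * h * G"
      unfolding Fx_def Fy_def G_def by (simp add: ring_expand)
    also have "\<dots> = h * p * (- (l * B) - p ^ n * G)"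
      unfolding B t h2 by (simp add: algebra_simps)
    finally have 2: "h * p dvd r0 - ?F (x + h * s) (y + h * t)" by simp
    have "p dvd (x + h * s) - x0" "p dvd (y + h * t) - y0"
      using x y dvd_add[of p "x - x0" "h * s"] dvd_add[of p "y - y0" "h * t"]
      by (simp_all add: h_def algebra_simps)
    then show ?case using 1 2 unfolding h_def by (metis power_Suc2)
  qed
  then show ?thesis by (meson dvd_trans le_imp_power_dvd lessI less_imp_le)
qed

section \<open>Splitting of depressed quartics modulo prime powers\<close>

abbreviation depressed :: "int \<Rightarrow> int \<Rightarrow> int \<Rightarrow> int \<Rightarrow> int" where
  "depressed a b c x \<equiv> x ^ 4 + a * x ^ 2 + b * x + c"

definition has_root :: "nat \<Rightarrow> int \<Rightarrow> int \<Rightarrow> int \<Rightarrow> bool" where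
  "has_root n a b c \<longleftrightarrow> (\<exists>x. p ^ n dvd depressed a b c x)"

text \<open>The factorisation \<open>(x\<^sup>2 + sx + t) (x\<^sup>2 - sx + u)\<close> of \<open>x\<^sup>4 + ax\<^sup>2 + bx + c\<close>.\<close>

definition has_quad :: "nat \<Rightarrow> int \<Rightarrow> int \<Rightarrow> int \<Rightarrow> bool" where
  "has_quad n a b c \<longleftrightarrow>
     (\<exists>s t u. p ^ n dvd t + u - s ^ 2 - a \<and> p ^ n dvd s * (u - t) - b \<and> p ^ n dvd t * u - c)"

text \<open>A split quartic has a monic factor of degree 1 or 2, and without cubic term two
  quadratic factors have opposite linear coefficients.\<close>

definition red :: "nat \<Rightarrow> int \<Rightarrow> int \<Rightarrow> int \<Rightarrow> bool" where
  "red n a b c \<longleftrightarrow> has_root n a b c \<or> has_quad n a b c"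

definition nonsq :: "int \<Rightarrow> bool" where
  "nonsq z \<longleftrightarrow> (\<forall>x. \<not> p dvd x ^ 2 - z)"

lemma nonsq_cong: "p dvd y - z \<Longrightarrow> nonsq y \<longleftrightarrow> nonsq z"
proof -
  assume *: "p dvd y - z"
  have "p dvd (x\<^sup>2 - z) - (x\<^sup>2 - y)" for x using * by simp
  then show ?thesis unfolding nonsq_def using dvd_cong by metis
qed

lemma nonsq_unit: "nonsq z \<Longrightarrow> \<not> p dvd z"
  using nonsq_def[of z] by (metis diff_0 dvd_minus_iff power_zero_numeral)

lemma nonsq_mult_square:
  assumes "\<not> p dvd u" shows "nonsq (u ^ 2 * z) \<longleftrightarrow> nonsq z"
proof -
  obtain v where "p ^ 1 dvd u * v - 1" using inverse_mod_prime_power[OF assms] .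
  then have v: "p dvd u * v - 1" by simp
  have "p dvd x\<^sup>2 - z \<Longrightarrow> p dvd (u * x)\<^sup>2 - u\<^sup>2 * z" for x
    by (metis dvd_mult power_mult_distrib right_diff_distrib)
  moreover have "p dvd (v * x)\<^sup>2 - z" if "p dvd x\<^sup>2 - u\<^sup>2 * z" for x
  proof -
    have "(v * x)\<^sup>2 - z = v\<^sup>2 * (x\<^sup>2 - u\<^sup>2 * z) + (u * v - 1) * ((u * v + 1) * z)"
      by (simp add: ring_expand)
    then show ?thesis using that v by (metis dvd_add dvd_mult dvd_mult2)
  qed
  ultimately show ?thesis unfolding nonsq_def by blast
qed

lemma power_dvd_mono: "m \<le> n \<Longrightarrow> p ^ n dvd x \<Longrightarrow> p ^ m dvd x"
  by (meson dvd_trans le_imp_power_dvd)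

lemma has_root_mono: "m \<le> n \<Longrightarrow> has_root n a b c \<Longrightarrow> has_root m a b c"
  unfolding has_root_def using power_dvd_mono by blast

lemma has_quad_mono: "m \<le> n \<Longrightarrow> has_quad n a b c \<Longrightarrow> has_quad m a b c"
  unfolding has_quad_def using power_dvd_mono by blast

lemma red_mono: "m \<le> n \<Longrightarrow> red n a b c \<Longrightarrow> red m a b c"
  unfolding red_def using has_root_mono has_quad_mono by blast

lemma has_root_cong:
  assumes "p ^ n dvd a - a'" "p ^ n dvd b - b'" "p ^ n dvd c - c'"
  shows "has_root n a b c \<longleftrightarrow> has_root n a' b' c'"
proof -
  have "p ^ n dvd depressed a b c x \<longleftrightarrow> p ^ n dvd depressed a' b' c' x" for x
  proof (rule dvd_cong)
    have "depressed a b c x - depressed a' b' c' x =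
      (a - a') * x\<^sup>2 + (b - b') * x + (c - c')" by (simp add: ring_expand)
    then show "p ^ n dvd depressed a b c x - depressed a' b' c' x"
      using assms by (metis dvd_add dvd_mult2)
  qed
  then show ?thesis by (simp add: has_root_def)
qed

lemma has_quad_cong:
  assumes "p ^ n dvd a - a'" "p ^ n dvd b - b'" "p ^ n dvd c - c'"
  shows "has_quad n a b c \<longleftrightarrow> has_quad n a' b' c'"
proof -
  have "p ^ n dvd z - d \<longleftrightarrow> p ^ n dvd z - d'" if "p ^ n dvd d - d'" for z d d'
    using that by (intro dvd_cong) (simp add: dvd_diff_commute)
  from this[OF assms(1)] this[OF assms(2)] this[OF assms(3)] show ?thesis
    by (simp add: has_quad_def)
qed

lemma red_cong:
  assumes "p ^ n dvd a - a'" "p ^ n dvd b - b'" "p ^ n dvd c - c'"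
  shows "red n a b c \<longleftrightarrow> red n a' b' c'"
  using has_root_cong[OF assms] has_quad_cong[OF assms] by (simp add: red_def)

lemma half_mod: obtains e where "p ^ n dvd a - 2 * e"
proof -
  obtain v where "p ^ n dvd 2 * v - 1" using inverse_mod_prime_power[of 2 n] by auto
  then have "p ^ n dvd (2 * v - 1) * (- a)" by (rule dvd_mult2)
  then have "p ^ n dvd a - 2 * (v * a)" by (simp add: algebra_simps)
  then show ?thesis using that by blast
qed

abbreviation qform :: "int \<Rightarrow> int \<Rightarrow> int \<Rightarrow> int \<Rightarrow> int" where
  "qform k e x y \<equiv> y ^ 2 - 4 * e * x ^ 2 - 4 * k * x ^ 4"

text \<open>For \<open>k = 1\<close>, a solution \<open>(x, y)\<close> encodes the factorisation \<open>(X\<^sup>2 + e + 2x\<^sup>2)\<^sup>2 - (2xX + y)\<^sup>2\<close>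
  of \<open>(X\<^sup>2 + e)\<^sup>2 - r\<^sub>1X - r\<^sub>0\<close>; the coefficient \<open>k\<close> makes the family closed under scaling.\<close>

definition qsol :: "nat \<Rightarrow> int \<Rightarrow> int \<Rightarrow> int \<Rightarrow> int \<Rightarrow> bool" where
  "qsol n k e r1 r0 \<longleftrightarrow>
     (\<exists>x y. p ^ n dvd r1 - 4 * x * y \<and> p ^ n dvd r0 - qform k e x y)"

text \<open>The dictionary is s = 2x and t - u = 2y; halving is possible because \<open>p\<close> is
  odd. The coordinates (e, r1, r0) with a = 2e, b = -r1, c = e^2 - r0 are those of (X^2 + e)^2 - r1
  X - r0.\<close>

lemma has_quad_qsol: "has_quad n (2 * e) (- r1) (e ^ 2 - r0) \<longleftrightarrow> qsol n 1 e r1 r0"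
proof
  assume "has_quad n (2 * e) (- r1) (e ^ 2 - r0)"
  then obtain s t u where 1: "p ^ n dvd t + u - s\<^sup>2 - 2 * e" and 2: "p ^ n dvd s * (u - t) + r1"
    and 3: "p ^ n dvd t * u - (e\<^sup>2 - r0)" by (auto simp: has_quad_def)
  obtain x where x: "p ^ n dvd s - 2 * x" using half_mod .
  obtain y where y: "p ^ n dvd (t - u) - 2 * y" using half_mod .
  have "r1 - 4 * x * y = (s * (u - t) + r1) + (s - 2 * x) * (t - u) + 2 * x * (t - u - 2 * y)"
    by (simp add: ring_expand)
  then have A: "p ^ n dvd r1 - 4 * x * y"
    using 2 x y by (metis dvd_add dvd_mult dvd_mult2)
  have "4 * (r0 - qform 1 e x y) =
     4 * (t * u - (e\<^sup>2 - r0)) + (t - u - 2 * y) * (t - u + 2 * y)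
     - (t + u - s\<^sup>2 - 2 * e) * (t + u + s\<^sup>2 + 2 * e)
     - (s - 2 * x) * ((s + 2 * x) * (s\<^sup>2 + 4 * x\<^sup>2 + 4 * e))"
    by (simp add: ring_expand)
  then have "p ^ n dvd 4 * (r0 - qform 1 e x y)"
    using 1 3 x y by (metis dvd_add dvd_diff dvd_mult dvd_mult2)
  then have "p ^ n dvd r0 - qform 1 e x y"
    by (subst (asm) dvd_unit_cancel) auto
  with A show "qsol n 1 e r1 r0" unfolding qsol_def by blast
next
  assume "qsol n 1 e r1 r0"
  then obtain x y where 1: "p ^ n dvd r1 - 4 * x * y"
    and 2: "p ^ n dvd r0 - qform 1 e x y" unfolding qsol_def by blast
  define t u where "t = e + 2 * x\<^sup>2 + y" and "u = e + 2 * x\<^sup>2 - y"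
  have "t + u - (2 * x)\<^sup>2 - 2 * e = 0" "2 * x * (u - t) - (- r1) = r1 - 4 * x * y"
    "t * u - (e\<^sup>2 - r0) = r0 - qform 1 e x y"
    by (simp_all add: t_def u_def ring_expand)
  with 1 2 have "p ^ n dvd t + u - (2 * x)\<^sup>2 - 2 * e" "p ^ n dvd 2 * x * (u - t) - (- r1)"
    "p ^ n dvd t * u - (e\<^sup>2 - r0)" by (simp_all only: dvd_0_right)
  then show "has_quad n (2 * e) (- r1) (e\<^sup>2 - r0)" unfolding has_quad_def by blast
qed

text \<open>For k = 1 the quantity required to be a unit is a quarter of the resultant of the two
  quadratic factors, so the hypothesis says that they are coprime modulo \<open>p\<close>.\<close>

lemma qsol_hensel:
  assumes "p dvd r1 - 4 * x * y" "p dvd r0 - qform k e x y"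
    and "\<not> p dvd y ^ 2 + 4 * e * x ^ 2 + 8 * k * x ^ 4"
  shows "qsol n k e r1 r0"
  using hensel_pair[of r1 x y r0 "- 4 * e" 1 "- 4 * k" 0 n] assms
  unfolding qsol_def by (simp add: algebra_simps)

lemma has_root_hensel:
  assumes "p dvd depressed a b c x" "\<not> p dvd 4 * x ^ 3 + 2 * a * x + b"
  shows "has_root n a b c"
  using hensel_root[of 1 x a b c n] assms unfolding has_root_def by simp

lemma root_of_linear_mod:
  assumes "p dvd A" "p dvd B" "\<not> p dvd C"
  shows "\<exists>x. p ^ n dvd A * x ^ 4 + B * x ^ 2 + C * x + D"
proof -
  obtain v where "p ^ 1 dvd C * v - 1" using inverse_mod_prime_power[OF assms(3)] .
  then have "p dvd - D * (C * v - 1)" by simp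
  then have v: "p dvd C * (- D * v) + D" by (simp add: algebra_simps)
  show ?thesis
  proof (rule hensel_root)
    show "p dvd A * (- D * v) ^ 4 + B * (- D * v) ^ 2 + C * (- D * v) + D"
      using v assms(1,2) by (metis (no_types, lifting) add.assoc dvd_add dvd_mult2)
    have "p dvd 4 * A * (- D * v) ^ 3 + 2 * B * (- D * v)" using assms(1,2) by simp
    then show "\<not> p dvd 4 * A * (- D * v) ^ 3 + 2 * B * (- D * v) + C"
      using assms(3) by (subst dvd_add_right_iff)
  qed
qed

text \<open>Once \<open>f\<close> has a factorisation modulo \<open>p\<close>, it has one with coprime factors, which lifts by
  Hensel's lemma, unless \<open>f\<close> is modulo \<open>p\<close> the square of an irreducible quadratic or \<open>x\<^sup>4\<close>.\<close>

lemma red_lift_coords: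
  assumes r: "red 1 (2 * e) (- r1) (e ^ 2 - r0)"
    and n0: "\<not> (p dvd e \<and> p dvd r1 \<and> p dvd r0)"
    and nB: "\<not> (p dvd r1 \<and> p dvd r0 \<and> nonsq (- e))"
  shows "red n (2 * e) (- r1) (e ^ 2 - r0)"
proof (cases "has_root 1 (2 * e) (- r1) (e ^ 2 - r0)")
  case True
  let ?f = "\<lambda>x. depressed (2 * e) (- r1) (e ^ 2 - r0) x"
  let ?f' = "\<lambda>x. 4 * x ^ 3 + 2 * (2 * e) * x + (- r1)"
  obtain x where x: "p dvd ?f x" using True by (auto simp: has_root_def)
  show ?thesis
  proof (cases "p dvd ?f' x")
    case False
    then show ?thesis using has_root_hensel x unfolding red_def by blast
  next
    case f': True
    show ?thesis
    proof (cases "p dvd e + 3 * x\<^sup>2")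
      case False
      \<comment> \<open>The root is double but not triple: modulo \<open>p\<close> the quartic is (X
        - x)^2 (X^2 + 2xX + 2e + 3x^2), and the witnesses are the coordinates of this factorization.
        Its factors are coprime because \<open>e + 3 * x\<^sup>2\<close> is a unit.\<close>
      have "qsol n 1 e r1 r0"
      proof (rule qsol_hensel)
        have "r1 - 4 * (- x) * (- e - x\<^sup>2) = - ?f' x" by (simp add: ring_expand)
        then show "p dvd r1 - 4 * (- x) * (- e - x\<^sup>2)" using f' by (metis dvd_minus_iff)
        have "r0 - ((- e - x\<^sup>2)\<^sup>2 - 4 * e * (- x)\<^sup>2 - 4 * 1 * (- x) ^ 4) = x * ?f' x - ?f x"
          by (simp add: ring_expand)
        then show "p dvd r0 - ((- e - x\<^sup>2)\<^sup>2 - 4 * e * (- x)\<^sup>2 - 4 * 1 * (- x) ^ 4)"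
          using f' x by (metis dvd_diff dvd_mult)
        have "(- e - x\<^sup>2)\<^sup>2 + 4 * e * (- x)\<^sup>2 + 8 * 1 * (- x) ^ 4 = (e + 3 * x\<^sup>2)\<^sup>2"
          by (simp add: ring_expand)
        then show "\<not> p dvd (- e - x\<^sup>2)\<^sup>2 + 4 * e * (- x)\<^sup>2 + 8 * 1 * (- x) ^ 4"
          using False by simp
      qed
      then show ?thesis by (simp add: red_def has_quad_qsol)
    next
      case e: True
      have nx: "\<not> p dvd x"
      proof
        assume px: "p dvd x"
        have 1: "p dvd e" using e px by (metis dvd_add_left_iff dvd_mult pdvd_pow zero_less_numeral)
        have "p dvd 4 * x ^ 3 + 2 * (2 * e) * x" using px by simp
        then have 2: "p dvd r1" using f' by (metis dvd_add_right_iff dvd_minus_iff)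
        have "?f x + r0 = x * (x ^ 3 + (2 * e) * x + (- r1)) + e * e" by (simp add: ring_expand)
        then have "p dvd ?f x + r0" using px 1 by simp
        then have "p dvd r0" using x by (metis dvd_add_right_iff)
        then show False using 1 2 n0 by simp
      qed
      \<comment> \<open>The four roots sum to zero, so a triple root x leaves -3x as the fourth. The
        two differ by the unit 4x, hence -3x is simple; this includes p = 3.\<close>
      have "p dvd ?f (- 3 * x)"
      proof -
        have "?f (- 3 * x) = ?f x - 4 * x * ?f' x + (e + 3 * x\<^sup>2) * (32 * x\<^sup>2)"
          by (simp add: ring_expand)
        then show ?thesis using e f' x by (metis dvd_add dvd_diff dvd_mult dvd_mult2)
      qed
      moreover have "\<not> p dvd ?f' (- 3 * x)"
      proof -
        have "?f' (- 3 * x) - (- 8 * (8 * x ^ 3)) = ?f' x - 16 * x * (e + 3 * x\<^sup>2)"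
          by (simp add: ring_expand)
        then have "p dvd ?f' (- 3 * x) - (- 8 * (8 * x ^ 3))"
          using e f' by (metis dvd_diff dvd_mult)
        moreover have "\<not> p dvd - 8 * (8 * x ^ 3)" using nx unfolding pdvd_mult by simp
        ultimately show ?thesis using dvd_cong by blast
      qed
      ultimately show ?thesis using has_root_hensel unfolding red_def by blast
    qed
  qed
next
  case noroot: False
  then have "qsol 1 1 e r1 r0" using r by (simp add: red_def has_quad_qsol)
  then obtain x y where 1: "p dvd r1 - 4 * x * y"
    and 2: "p dvd r0 - qform 1 e x y" by (auto simp: qsol_def)
  let ?D = "y ^ 2 + 4 * e * x ^ 2 + 8 * 1 * x ^ 4"
  show ?thesis
  proof (cases "p dvd ?D")
    case False
    then show ?thesis using qsol_hensel[OF 1 2] by (simp add: red_def has_quad_qsol)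
  next
    case D: True
    have px: "p dvd x"
    proof (rule ccontr)
      assume "\<not> p dvd x"
      then have "\<not> p dvd 2 * x" by simp
      then obtain v where "p ^ 1 dvd (2 * x) * v - 1" using inverse_mod_prime_power by blast
      then have v: "p dvd (2 * x) * v - 1" by simp
      \<comment> \<open>The value -y/(2x) is the common root of the two factors when their resultant
        vanishes.\<close>
      let ?z = "- y * v"
      let ?g = "?z\<^sup>2 + 2 * x * ?z + (e + 2 * x\<^sup>2 + y)"
      let ?h = "?z\<^sup>2 - 2 * x * ?z + (e + 2 * x\<^sup>2 - y)"
      have "4 * x\<^sup>2 * ?g = ?D + (2 * x * v - 1) * (y\<^sup>2 * (2 * x * v + 1) - 4 * x\<^sup>2 * y)"
        by (simp add: ring_expand)
      then have "p dvd 4 * x\<^sup>2 * ?g" using D v by (metis dvd_add dvd_mult2)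
      then have g: "p dvd ?g" using \<open>\<not> p dvd x\<close> unfolding pdvd_mult by simp
      have "depressed (2 * e) (- r1) (e ^ 2 - r0) ?z =
        ?g * ?h - (r1 - 4 * x * y) * ?z - (r0 - qform 1 e x y)"
        by (simp add: ring_expand)
      then have "p dvd depressed (2 * e) (- r1) (e ^ 2 - r0) ?z"
        using g 1 2 by (metis dvd_diff dvd_mult2)
      then show False using noroot unfolding has_root_def power_one_right by blast
    qed
    have "p dvd 4 * e * x ^ 2 + 8 * 1 * x ^ 4" using px by simp
    then have "p dvd y ^ 2" using D by (metis add.assoc dvd_add_left_iff)
    then have py: "p dvd y" by simp
    have "p dvd 4 * x * y" using px by simp
    then have r1: "p dvd r1" using 1 by (metis dvd_cong)
    have "p dvd qform 1 e x y" using px py by (simp add: dvd_diff)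
    then have r0: "p dvd r0" using 2 by (metis dvd_cong)
    obtain z where z: "p dvd z\<^sup>2 - (- e)" using r1 r0 nB unfolding nonsq_def by blast
    have "depressed (2 * e) (- r1) (e ^ 2 - r0) z =
      (z\<^sup>2 - (- e)) * (z\<^sup>2 + e) - r1 * z - r0" by (simp add: ring_expand)
    then have "p dvd depressed (2 * e) (- r1) (e ^ 2 - r0) z"
      using z r1 r0 by (metis dvd_diff dvd_mult2)
    then show ?thesis using noroot unfolding has_root_def by auto
  qed
qed

section \<open>Newton polygons of quartics congruent to x^4 modulo p\<close>

lemma dvd_sum_prod:
  assumes "p dvd x + y" "p dvd x * y"
  shows "p dvd x \<and> p dvd y"
  using assms dvd_add_left_iff[of p y x] dvd_add_right_iff[of p x y] by auto

lemma quad_factors_x4: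
  assumes "p dvd t + u - s ^ 2" "p dvd s * (u - t)" "p dvd t * u"
  shows "p dvd s \<and> p dvd t \<and> p dvd u"
proof -
  have "p dvd s"
  proof (rule ccontr)
    assume s: "\<not> p dvd s"
    then have "p dvd u - t" using assms by simp
    from dvd_cong[OF this] have "p dvd t \<and> p dvd u" using assms(3) by auto
    then have "p dvd t + u" by simp
    then have "p dvd s ^ 2" using assms(1) by (metis dvd_diff_commute dvd_cong)
    then show False using s by simp
  qed
  then have "p dvd t + u" using assms(1) by (metis dvd_cong pdvd_pow zero_less_numeral)
  then show ?thesis using \<open>p dvd s\<close> assms(3) dvd_sum_prod by blast
qed

lemma root_mod_p_x4:
  assumes "p dvd a" "p dvd b" "p dvd c" "0 < n" "p ^ n dvd depressed a b c x"
  obtains y where "x = p * y"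
proof -
  have "p dvd depressed a b c x" using assms power_dvd_mono[of 1 n] by simp
  moreover have "p dvd a * x ^ 2 + b * x + c" using assms by simp
  ultimately have "p dvd x ^ 4" by (metis add.assoc dvd_add_left_iff)
  then show ?thesis using that by (auto elim: dvdE)
qed

lemma quad_mod_p_x4:
  assumes "p dvd a" "p dvd b" "p dvd c" "0 < n"
    and "p ^ n dvd t + u - s ^ 2 - a" "p ^ n dvd s * (u - t) - b" "p ^ n dvd t * u - c"
  obtains s' t' u' where "s = p * s'" "t = p * t'" "u = p * u'"
proof -
  have "p dvd t + u - s ^ 2 - a" "p dvd s * (u - t) - b" "p dvd t * u - c"
    using assms power_dvd_mono[of 1 n] by simp_all
  then have "p dvd s \<and> p dvd t \<and> p dvd u"
    using assms(1-3) by (intro quad_factors_x4) (metis dvd_cong)+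
  then show ?thesis using that by (metis dvdE)
qed

text \<open>Eisenstein's criterion, whose argument already works modulo
  \<open>p ^ 2\<close>.\<close>

lemma not_red_eisenstein:
  assumes pd: "p dvd a" "p dvd b" "p dvd c" and c: "\<not> p ^ 2 dvd c" and n: "2 \<le> n"
  shows "\<not> red n a b c"
proof
  assume "red n a b c"
  then have "red 2 a b c" using n red_mono by blast
  then consider x where "p ^ 2 dvd depressed a b c x"
    | s t u where "p ^ 2 dvd t + u - s ^ 2 - a" "p ^ 2 dvd s * (u - t) - b" "p ^ 2 dvd t * u - c"
    unfolding red_def has_root_def has_quad_def by blast
  then show False
  proof cases
    case 1
    then obtain y where y: "x = p * y" using root_mod_p_x4[OF pd, of 2] by auto
    obtain a' b' where ab: "a = p * a'" "b = p * b'" using pd by (metis dvdE)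
    have "x ^ 4 + a * x ^ 2 + b * x = p ^ 2 * (p ^ 2 * y ^ 4 + p * a' * y ^ 2 + b' * y)"
      unfolding y ab by (simp add: ring_expand)
    then show False using 1 c by (metis dvd_add_right_iff dvd_triv_left)
  next
    case 2
    from quad_mod_p_x4[OF pd _ 2] obtain s' t' u' where "s = p * s'" "t = p * t'" "u = p * u'" by auto
    then have "p ^ 2 dvd t * u" by (simp add: power2_eq_square)
    then show False using 2(3) c by (metis dvd_cong)
  qed
qed

text \<open>The Newton polygon has an edge of horizontal length 1, which yields a root: f(px)/p^2 is
  linear modulo \<open>p\<close> with unit slope.\<close>

lemma red_linear_slope_1:
  assumes "p dvd a" "p dvd b" "\<not> p ^ 2 dvd b" "p ^ 2 dvd c"
  shows "red n a b c"
proof -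
  obtain b' c' where b: "b = p * b'" and c: "c = p ^ 2 * c'" using assms by (metis dvdE)
  then have "\<not> p dvd b'" using assms(3) by (simp add: power2_eq_square)
  then obtain x where x: "p ^ n dvd p ^ 2 * x ^ 4 + a * x ^ 2 + b' * x + c'"
    using root_of_linear_mod[of "p ^ 2" a b' n c'] assms by auto
  have "depressed a b c (p * x) = p ^ 2 * (p ^ 2 * x ^ 4 + a * x ^ 2 + b' * x + c')"
    unfolding b c by (simp add: ring_expand)
  then show ?thesis using x unfolding red_def has_root_def by (metis dvd_mult)
qed

text \<open>Again an edge of horizontal length 1, now because f(px)/p^3 is linear modulo
  \<open>p\<close>.\<close>

lemma red_linear_slope_2:
  assumes "p ^ 2 dvd a" "p ^ 2 dvd b" "\<not> p ^ 3 dvd b" "p ^ 3 dvd c"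
  shows "red n a b c"
proof -
  obtain a' b' c' where a: "a = p ^ 2 * a'" and b: "b = p ^ 2 * b'" and c: "c = p ^ 3 * c'"
    using assms by (metis dvdE)
  then have "\<not> p dvd b'" using assms(3) by (simp add: power2_eq_square power3_eq_cube)
  then obtain x where x: "p ^ n dvd p * x ^ 4 + (p * a') * x ^ 2 + b' * x + c'"
    using root_of_linear_mod[of p "p * a'" b' n c'] by auto
  have "depressed a b c (p * x) = p ^ 3 * (p * x ^ 4 + (p * a') * x ^ 2 + b' * x + c')"
    unfolding a b c by (simp add: ring_expand)
  then show ?thesis using x unfolding red_def has_root_def by (metis dvd_mult)
qed

text \<open>The Newton polygon is one edge of slope 3/4 without interior lattice points, so no
  proper factor exists; four digits suffice to see this.\<close>

lemma not_red_slope_3: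
  assumes "p ^ 2 dvd a" "p ^ 3 dvd b" "p ^ 3 dvd c" "\<not> p ^ 4 dvd c" "4 \<le> n"
  shows "\<not> red n a b c"
proof
  assume "red n a b c"
  then have r: "red 4 a b c" using assms(5) red_mono by blast
  have pd: "p dvd a" "p dvd b" "p dvd c"
    using assms power_dvd_mono[of 1 2] power_dvd_mono[of 1 3] by auto
  obtain a' b' c' where a: "a = p ^ 2 * a'" and b: "b = p ^ 3 * b'" and c: "c = p ^ 3 * c'"
    using assms by (metis dvdE)
  have c': "\<not> p dvd c'" using assms(4) unfolding c
    by (simp add: power3_eq_cube power4_eq_xxxx)
  from r consider x where "p ^ 4 dvd depressed a b c x"
    | s t u where "p ^ 4 dvd t + u - s ^ 2 - a" "p ^ 4 dvd s * (u - t) - b" "p ^ 4 dvd t * u - c"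
    unfolding red_def has_root_def has_quad_def by blast
  then show False
  proof cases
    case 1
    then obtain y where y: "x = p * y" using root_mod_p_x4[OF pd, of 4] by auto
    have "x ^ 4 + a * x ^ 2 + b * x = p ^ 4 * (y ^ 4 + a' * y ^ 2 + b' * y)"
      unfolding y a b by (simp add: ring_expand)
    then show False using 1 assms(4) by (metis dvd_add_right_iff dvd_triv_left)
  next
    case 2
    from quad_mod_p_x4[OF pd _ 2] obtain s' t' u' where stu: "s = p * s'" "t = p * t'" "u = p * u'" by auto
    have "p ^ 2 dvd t + u - s ^ 2 - a" using power_dvd_mono[of 2 4] 2 by simp
    moreover have "t + u - s ^ 2 - a = p * (t' + u') - p ^ 2 * (s' ^ 2 + a')"
      unfolding stu a by (simp add: ring_expand)
    ultimately have "p ^ 2 dvd p * (t' + u')" by (metis dvd_cong dvd_triv_left)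
    then have A: "p dvd t' + u'" by (simp add: power2_eq_square)
    have "t * u - c = p ^ 2 * (t' * u' - p * c')" unfolding stu c by (simp add: ring_expand)
    then have B: "p ^ 2 dvd t' * u' - p * c'" using 2(3) by (simp add: power2_eq_square power4_eq_xxxx)
    then have "p dvd t' * u' - p * c'" using power_dvd_mono[of 1 2] by simp
    then have "p dvd t' * u'" by (metis dvd_cong dvd_triv_left)
    then have "p dvd t'" "p dvd u'" using A dvd_sum_prod by blast+
    then have "p ^ 2 dvd t' * u'" by (simp add: power2_eq_square mult_dvd_mono)
    then have "p ^ 2 dvd p * c'" using B by (metis dvd_diff_commute dvd_cong)
    then show False using c' by (simp add: power2_eq_square)
  qed
qed

lemma red_scale: "red n a b c \<Longrightarrow> red n (p ^ 2 * a) (p ^ 3 * b) (p ^ 4 * c)"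
proof -
  assume "red n a b c"
  then consider x where "p ^ n dvd depressed a b c x"
    | s t u where "p ^ n dvd t + u - s ^ 2 - a" "p ^ n dvd s * (u - t) - b" "p ^ n dvd t * u - c"
    unfolding red_def has_root_def has_quad_def by blast
  then show ?thesis
  proof cases
    case 1
    have "depressed (p ^ 2 * a) (p ^ 3 * b) (p ^ 4 * c) (p * x)
      = p ^ 4 * depressed a b c x" by (simp add: ring_expand)
    then show ?thesis using 1 unfolding red_def has_root_def by (metis dvd_mult)
  next
    case 2
    have "p ^ 2 * t + p ^ 2 * u - (p * s) ^ 2 - p ^ 2 * a = p ^ 2 * (t + u - s ^ 2 - a)"
      "(p * s) * (p ^ 2 * u - p ^ 2 * t) - p ^ 3 * b = p ^ 3 * (s * (u - t) - b)"
      "(p ^ 2 * t) * (p ^ 2 * u) - p ^ 4 * c = p ^ 4 * (t * u - c)"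
      by (simp_all add: ring_expand)
    then show ?thesis using 2 unfolding red_def has_quad_def by (metis dvd_mult)
  qed
qed

text \<open>Every factorization of the scaled quartic is itself scaled, but cancelling factors up to
  \<open>p ^ 4\<close> costs four digits, whereas \<open>red_scale\<close> costs none. This
  asymmetry turns the recursion into a sandwich.\<close>

lemma red_unscale:
  assumes "red (n + 4) (p ^ 2 * a) (p ^ 3 * b) (p ^ 4 * c)"
  shows "red n a b c"
proof -
  have *: "p ^ n dvd z" if "p ^ (n + 4) dvd p ^ k * z" "k \<le> 4" for z k
  proof -
    have "p ^ (n + 4) = p ^ k * p ^ (n + 4 - k)" using that(2) by (simp flip: power_add)
    then have "p ^ (n + 4 - k) dvd z" using that(1) by simp
    then show ?thesis using that(2) power_dvd_mono[of n "n + 4 - k" z] by simp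
  qed
  from assms consider x where "p ^ (n + 4) dvd depressed (p ^ 2 * a) (p ^ 3 * b) (p ^ 4 * c) x"
    | s t u where "p ^ (n + 4) dvd t + u - s ^ 2 - p ^ 2 * a" "p ^ (n + 4) dvd s * (u - t) - p ^ 3 * b"
       "p ^ (n + 4) dvd t * u - p ^ 4 * c"
    unfolding red_def has_root_def has_quad_def by blast
  then show ?thesis
  proof cases
    case 1
    then obtain y where y: "x = p * y" using root_mod_p_x4[of "p ^ 2 * a" "p ^ 3 * b" "p ^ 4 * c" "n + 4"] by auto
    have "depressed (p ^ 2 * a) (p ^ 3 * b) (p ^ 4 * c) x = p ^ 4 * depressed a b c y"
      unfolding y by (simp add: ring_expand)
    then have "p ^ n dvd depressed a b c y" using 1 *[of 4] by simp
    then show ?thesis unfolding red_def has_root_def by blast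
  next
    case 2
    from quad_mod_p_x4[OF _ _ _ _ 2] obtain s' t' u' where stu: "s = p * s'" "t = p * t'" "u = p * u'" by auto
    \<comment> \<open>The constant terms must carry a second factor \<open>p\<close>: t' and u' turn
      out to have sum and product divisible by \<open>p\<close>.\<close>
    have "p ^ 2 dvd t + u - s ^ 2 - p ^ 2 * a" using 2(1) power_dvd_mono[of 2 "n + 4"] by simp
    moreover have "t + u - s ^ 2 - p ^ 2 * a = p * (t' + u') - p ^ 2 * (s' ^ 2 + a)"
      unfolding stu by (simp add: ring_expand)
    ultimately have "p ^ 2 dvd p * (t' + u')" by (metis dvd_cong dvd_triv_left)
    then have A: "p dvd t' + u'" by (simp add: power2_eq_square)
    have "p ^ 3 dvd t * u - p ^ 4 * c" using 2(3) power_dvd_mono[of 3 "n + 4"] by simp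
    moreover have "t * u - p ^ 4 * c = p ^ 2 * (t' * u') - p ^ 3 * (p * c)"
      unfolding stu by (simp add: ring_expand)
    ultimately have "p ^ 3 dvd p ^ 2 * (t' * u')" by (metis dvd_cong dvd_triv_left)
    then have "p dvd t' * u'" by (simp add: power2_eq_square power3_eq_cube)
    then have "p dvd t'" "p dvd u'" using A dvd_sum_prod by blast+
    then obtain t2 u2 where tu: "t' = p * t2" "u' = p * u2" by (metis dvdE)
    have e: "t + u - s ^ 2 - p ^ 2 * a = p ^ 2 * (t2 + u2 - s' ^ 2 - a)"
      "s * (u - t) - p ^ 3 * b = p ^ 3 * (s' * (u2 - t2) - b)"
      "t * u - p ^ 4 * c = p ^ 4 * (t2 * u2 - c)"
      unfolding stu tu by (simp_all add: ring_expand)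
    have "p ^ n dvd t2 + u2 - s' ^ 2 - a" using 2(1) unfolding e(1) by (rule *) simp
    moreover have "p ^ n dvd s' * (u2 - t2) - b" using 2(2) unfolding e(2) by (rule *) simp
    moreover have "p ^ n dvd t2 * u2 - c" using 2(3) unfolding e(3) by (rule *) simp
    ultimately have "has_quad n a b c" unfolding has_quad_def by blast
    then show ?thesis by (simp add: red_def)
  qed
qed

subsection \<open>Quartics congruent to the square of an irreducible quadratic\<close>

lemma no_root_square_case:
  assumes "nonsq (- e)" "p dvd r1" "p dvd r0" "1 \<le> n"
  shows "red n (2 * e) (- r1) (e ^ 2 - r0) \<longleftrightarrow> qsol n 1 e r1 r0"
proof -
  have "\<not> has_root 1 (2 * e) (- r1) (e ^ 2 - r0)"
  proof
    assume "has_root 1 (2 * e) (- r1) (e ^ 2 - r0)"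
    then obtain x where x: "p dvd depressed (2 * e) (- r1) (e ^ 2 - r0) x"
      unfolding has_root_def by auto
    have "depressed (2 * e) (- r1) (e ^ 2 - r0) x = (x\<^sup>2 - (- e)) ^ 2 - (r1 * x + r0)"
      by (simp add: ring_expand)
    moreover have "p dvd r1 * x + r0" using assms by simp
    ultimately have "p dvd (x\<^sup>2 - (- e)) ^ 2" using x by (metis dvd_cong)
    then show False using assms(1) by (simp add: nonsq_def)
  qed
  then show ?thesis using assms(4) has_root_mono by (auto simp: red_def has_quad_qsol)
qed

text \<open>The form is the norm of y + 2x sqrt(-e) from the field with p^2 elements, and a norm
  vanishes only at 0.\<close>

lemma anisotropic:
  assumes "nonsq (- e)" "p dvd y ^ 2 + 4 * e * x ^ 2"
  shows "p dvd x \<and> p dvd y"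
proof -
  have "p dvd x"
  proof (rule ccontr)
    assume "\<not> p dvd x"
    then have "\<not> p dvd 2 * x" by simp
    then have "nonsq ((2 * x) ^ 2 * (- e))" using assms(1) nonsq_mult_square by blast
    moreover have "y ^ 2 - (2 * x) ^ 2 * (- e) = y ^ 2 + 4 * e * x ^ 2" by (simp add: ring_expand)
    ultimately show False using assms(2) by (metis nonsq_def)
  qed
  then have "p dvd 4 * e * x ^ 2" by simp
  then have "p dvd y ^ 2" using assms(2) by (metis dvd_add_left_iff)
  then show ?thesis using \<open>p dvd x\<close> by simp
qed

text \<open>The quartic coefficient is taken to be a square for the case p | y: there the form
  becomes -4x^2((lx)^2 + e), which is a unit for a unit x because -e is not a square. Scaling keeps
  the coefficient a square.\<close>

lemma qsol_dvd_aux: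
  assumes e: "nonsq (- e)" and "p dvd r1" "p dvd r0"
    and "p dvd r1 - 4 * x * y" "p dvd r0 - qform (l ^ 2) e x y"
  shows "p dvd x \<and> p dvd y"
proof -
  have xy: "p dvd 4 * x * y" using assms by (metis dvd_cong)
  have f: "p dvd qform (l ^ 2) e x y" using assms by (metis dvd_cong)
  have px: "p dvd x"
  proof (rule ccontr)
    assume nx: "\<not> p dvd x"
    then have "p dvd y" using xy by simp
    then have "p dvd y ^ 2" by simp
    moreover have "y ^ 2 - qform (l ^ 2) e x y = 4 * x ^ 2 * ((l * x) ^ 2 - (- e))"
      by (simp add: ring_expand)
    ultimately have "p dvd 4 * x ^ 2 * ((l * x) ^ 2 - (- e))" using f by (metis dvd_diff)
    then have "p dvd (l * x) ^ 2 - (- e)" using nx unfolding pdvd_mult by simp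
    then show False using e by (simp add: nonsq_def)
  qed
  have "p dvd 4 * e * x ^ 2 + 4 * l ^ 2 * x ^ 4" using px by simp
  then have "p dvd y ^ 2" using f by (metis diff_diff_eq dvd_cong)
  then show ?thesis using px by simp
qed

lemma qsol_mono: "m \<le> n \<Longrightarrow> qsol n k e r1 r0 \<Longrightarrow> qsol m k e r1 r0"
  unfolding qsol_def using power_dvd_mono by blast

text \<open>For r not divisible by \<open>p\<close> the quartic term is invisible modulo
  \<open>p\<close>, and anisotropy of the norm form supplies the Hensel condition. What remains is
  whether r is a square in the field with p^2 elements.\<close>

lemma qsol_unit:
  assumes "nonsq (- e)" "p dvd l" "\<not> (p dvd r1 \<and> p dvd r0)"
  shows "qsol (Suc n) (l ^ 2) e r1 r0 \<longleftrightarrow> qsol 1 0 e r1 r0"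
proof
  assume "qsol (Suc n) (l ^ 2) e r1 r0"
  then have "qsol 1 (l ^ 2) e r1 r0" using qsol_mono[of 1 "Suc n"] by simp
  then obtain x y where 1: "p dvd r1 - 4 * x * y" "p dvd r0 - qform (l ^ 2) e x y"
    by (auto simp: qsol_def)
  have "p dvd 4 * l ^ 2 * x ^ 4" using assms(2) by simp
  from dvd_diff[OF 1(2) this]
  have "p dvd (r0 - qform (l ^ 2) e x y) - 4 * l ^ 2 * x ^ 4" .
  then show "qsol 1 0 e r1 r0" unfolding qsol_def using 1(1)
    by (intro exI[where x = x] exI[where x = y]) (simp add: algebra_simps)
next
  assume "qsol 1 0 e r1 r0"
  then obtain x y where 1: "p dvd r1 - 4 * x * y" "p dvd r0 - (y ^ 2 - 4 * e * x ^ 2)"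
    by (auto simp: qsol_def)
  have n0: "\<not> (p dvd x \<and> p dvd y)"
  proof
    assume a: "p dvd x \<and> p dvd y"
    then have "p dvd 4 * x * y" "p dvd y ^ 2 - 4 * e * x ^ 2" by (simp_all add: dvd_diff)
    then show False using 1 assms(3) by (metis dvd_cong)
  qed
  show "qsol (Suc n) (l ^ 2) e r1 r0"
  proof (rule qsol_hensel[OF 1(1)])
    have "p dvd (r0 - (y ^ 2 - 4 * e * x ^ 2)) + 4 * l ^ 2 * x ^ 4"
      using 1(2) assms(2) by (intro dvd_add) auto
    then show "p dvd r0 - qform (l ^ 2) e x y" by (simp add: algebra_simps)
    have "p dvd 8 * l ^ 2 * x ^ 4" using assms(2) by simp
    moreover have "\<not> p dvd y ^ 2 + 4 * e * x ^ 2" using anisotropic assms(1) n0 by blast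
    ultimately show "\<not> p dvd y ^ 2 + 4 * e * x ^ 2 + 8 * l ^ 2 * x ^ 4" by (metis dvd_add_left_iff)
  qed
qed

text \<open>In an unramified extension \<open>p\<close> is a uniformizer, so squares have even
  \<open>p\<close>-valuation.\<close>

lemma qsol_dvd_p:
  assumes "nonsq (- e)" "p dvd r1" "p dvd r0" "qsol (Suc (Suc n)) (l ^ 2) e r1 r0"
  shows "p ^ 2 dvd r1 \<and> p ^ 2 dvd r0"
proof -
  have "qsol 2 (l ^ 2) e r1 r0" by (rule qsol_mono[OF _ assms(4)]) simp
  then obtain x y where 1: "p ^ 2 dvd r1 - 4 * x * y" "p ^ 2 dvd r0 - qform (l ^ 2) e x y"
    by (auto simp: qsol_def)
  then have "p dvd r1 - 4 * x * y" "p dvd r0 - qform (l ^ 2) e x y"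
    using power_dvd_mono[of 1 2] by simp_all
  then have "p dvd x \<and> p dvd y" using qsol_dvd_aux assms by blast
  then obtain x' y' where xy: "x = p * x'" "y = p * y'" by (metis dvdE)
  have "4 * x * y = p ^ 2 * (4 * x' * y')"
    "qform (l ^ 2) e x y = p ^ 2 * (y' ^ 2 - 4 * e * x' ^ 2 - 4 * l ^ 2 * p ^ 2 * x' ^ 4)"
    unfolding xy by (simp_all add: ring_expand)
  then show ?thesis using 1 by (metis dvd_cong dvd_triv_left)
qed

text \<open>Dividing by \<open>p ^ 2\<close> pushes a factor \<open>p ^ 2\<close> into the quartic
  coefficient, so from then on the hypothesis \<open>p dvd l\<close> of \<open>qsol_unit\<close> is
  available.\<close>

lemma qsol_scale:
  assumes "nonsq (- e)"
  shows "qsol (Suc (Suc n)) (l ^ 2) e (p ^ 2 * r1) (p ^ 2 * r0) \<longleftrightarrow> qsol n ((p * l) ^ 2) e r1 r0"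
proof -
  have id: "p ^ 2 * r1 - 4 * (p * x) * (p * y) = p ^ 2 * (r1 - 4 * x * y)"
    "p ^ 2 * r0 - qform (l ^ 2) e (p * x) (p * y) =
      p ^ 2 * (r0 - qform ((p * l) ^ 2) e x y)" for x y
    by (simp_all add: ring_expand)
  have c: "p ^ Suc (Suc n) dvd p ^ 2 * z \<longleftrightarrow> p ^ n dvd z" for z
    by (simp add: power2_eq_square mult.assoc)
  show ?thesis
  proof
    assume "qsol (Suc (Suc n)) (l ^ 2) e (p ^ 2 * r1) (p ^ 2 * r0)"
    then obtain x y where 1: "p ^ Suc (Suc n) dvd p ^ 2 * r1 - 4 * x * y"
      "p ^ Suc (Suc n) dvd p ^ 2 * r0 - qform (l ^ 2) e x y"
      unfolding qsol_def by blast
    then have "p dvd p ^ 2 * r1 - 4 * x * y" "p dvd p ^ 2 * r0 - qform (l ^ 2) e x y"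
      using power_dvd_mono[of 1 "Suc (Suc n)"] by simp_all
    then have "p dvd x \<and> p dvd y" by (intro qsol_dvd_aux[OF assms]) simp_all
    then obtain x' y' where xy: "x = p * x'" "y = p * y'" by (metis dvdE)
    show "qsol n ((p * l) ^ 2) e r1 r0" using 1 unfolding xy id c qsol_def by blast
  next
    assume "qsol n ((p * l) ^ 2) e r1 r0"
    then show "qsol (Suc (Suc n)) (l ^ 2) e (p ^ 2 * r1) (p ^ 2 * r0)"
      unfolding qsol_def using id c by metis
  qed
qed

subsection \<open>Quartics with Newton slope one half\<close>

text \<open>The form that \<open>qsol\<close> takes for \<open>e\<close> divisible by \<open>p\<close>; scaling exchanges \<open>x\<close> and \<open>y\<close>.\<close>

abbreviation hform :: "int \<Rightarrow> int \<Rightarrow> int \<Rightarrow> int \<Rightarrow> int \<Rightarrow> int \<Rightarrow> int" where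
  "hform u v k l x y \<equiv> u * x ^ 2 + p * v * y ^ 2 + p * k * x ^ 4 + p ^ 2 * l * y ^ 4"

definition hsol :: "nat \<Rightarrow> int \<Rightarrow> int \<Rightarrow> int \<Rightarrow> int \<Rightarrow> int \<Rightarrow> int \<Rightarrow> bool" where
  "hsol n u v k l r1 r0 \<longleftrightarrow> (\<exists>x y. p ^ n dvd r1 - 4 * x * y \<and>
     p ^ n dvd r0 - hform u v k l x y)"

lemma hsol_0 [simp]: "hsol 0 u v k l r1 r0"
  by (simp add: hsol_def)

lemma hsol_mod_p:
  assumes "hsol (Suc n) u v k l r1 r0"
  obtains x y where "p dvd r1 - 4 * x * y" "p dvd r0 - u * x ^ 2"
    "p ^ Suc n dvd r1 - 4 * x * y"
    "p ^ Suc n dvd r0 - hform u v k l x y"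
proof -
  obtain x y where 1: "p ^ Suc n dvd r1 - 4 * x * y"
    "p ^ Suc n dvd r0 - hform u v k l x y"
    using assms unfolding hsol_def by blast
  then have 2: "p dvd r1 - 4 * x * y"
    "p dvd r0 - hform u v k l x y"
    using power_dvd_mono[of 1 "Suc n"] by simp_all
  have "r0 - hform u v k l x y =
    (r0 - u * x ^ 2) - p * (v * y ^ 2 + k * x ^ 4 + p * l * y ^ 4)" by (simp add: ring_expand)
  then have "p dvd r0 - u * x ^ 2" using 2(2) by (metis dvd_cong dvd_triv_left)
  then show ?thesis using that 1 2 by blast
qed

text \<open>A ramified extension has the residue field of \<open>p\<close> elements, so only r0 = u
  x^2 modulo \<open>p\<close> matters; r1 is then matched by solving 4xy = r1 for y, since x is a
  unit.\<close>

lemma hsol_unit: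
  assumes u: "\<not> p dvd u" and r0: "\<not> p dvd r0"
  shows "hsol (Suc n) u v k l r1 r0 \<longleftrightarrow> \<not> nonsq (u * r0)"
proof
  assume "hsol (Suc n) u v k l r1 r0"
  then obtain x where "p dvd r0 - u * x ^ 2" by (rule hsol_mod_p)
  then have "p dvd (- u) * (r0 - u * x ^ 2)" by simp
  moreover have "(- u) * (r0 - u * x ^ 2) = (u * x) ^ 2 - u * r0" by (simp add: ring_expand)
  ultimately show "\<not> nonsq (u * r0)" by (metis nonsq_def)
next
  assume "\<not> nonsq (u * r0)"
  then obtain z where z: "p dvd z ^ 2 - u * r0" by (auto simp: nonsq_def)
  obtain w where "p ^ 1 dvd u * w - 1" using inverse_mod_prime_power[OF u] .
  then have w: "p dvd u * w - 1" by simp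
  \<comment> \<open>This is z/u, which turns z^2 = u r0 into u x^2 = r0 modulo
    \<open>p\<close>.\<close>
  define x where "x = z * w"
  have "r0 - u * x ^ 2 = - (u * w - 1) * (u * w * r0 + r0) - (u * w ^ 2) * (z ^ 2 - u * r0)
      + 0" by (simp add: x_def ring_expand)
  then have x: "p dvd r0 - u * x ^ 2"
    using z w by (metis add_0_right dvd_diff dvd_minus_iff dvd_mult dvd_mult2)
  have px: "\<not> p dvd x"
  proof
    assume "p dvd x"
    then have "p dvd u * x ^ 2" by simp
    then show False using x r0 by (metis dvd_cong)
  qed
  then have "\<not> p dvd 4 * x" by simp
  then obtain i where "p ^ 1 dvd 4 * x * i - 1" using inverse_mod_prime_power by blast
  then have "p dvd (- r1) * (4 * x * i - 1)" by simp
  then have y: "p dvd r1 - 4 * x * (i * r1)" by (simp add: algebra_simps)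
  have "\<exists>x' y'. p ^ Suc n dvd r1 - 4 * x' * y' \<and>
     p ^ Suc n dvd r0 - hform u v k l x' y'"
  proof (rule hensel_pair[OF y])
    have "p dvd (r0 - u * x ^ 2) - p * (v * (i * r1) ^ 2 + k * x ^ 4 + p * l * (i * r1) ^ 4)"
      by (rule dvd_diff[OF x dvd_triv_left])
    then show "p dvd r0 - hform u v k l x (i * r1)"
      by (simp add: ring_expand)
    have "p dvd p * (v * (i * r1) ^ 2 + 2 * p * l * (i * r1) ^ 4 - 2 * k * x ^ 4)" by simp
    moreover have "\<not> p dvd u * x ^ 2" using u px by simp
    ultimately have "\<not> p dvd p * (v * (i * r1) ^ 2 + 2 * p * l * (i * r1) ^ 4 - 2 * k * x ^ 4) - u * x ^ 2"
      by (metis dvd_diff_commute dvd_cong)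
    then show "\<not> p dvd p * v * (i * r1) ^ 2 + 2 * (p ^ 2 * l) * (i * r1) ^ 4 - u * x ^ 2 - 2 * (p * k) * x ^ 4"
      by (simp add: ring_expand)
  qed
  then show "hsol (Suc n) u v k l r1 r0" unfolding hsol_def .
qed

lemma hsol_dvd_x:
  assumes u: "\<not> p dvd u" and "p dvd r0" and "p dvd r0 - u * x ^ 2"
  shows "p dvd x"
proof -
  have "p dvd u * x ^ 2" using assms by (metis dvd_cong)
  then show ?thesis using u by simp
qed

text \<open>From p | r0 follows p | x and hence p | 4xy. This mirrors the fact that elements of odd
  valuation in a ramified extension are not squares.\<close>

lemma hsol_dvd:
  assumes u: "\<not> p dvd u" and "p dvd r0" and h: "hsol (Suc n) u v k l r1 r0"
  shows "p dvd r1"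
proof -
  obtain x y where 1: "p dvd r1 - 4 * x * y" "p dvd r0 - u * x ^ 2" using h by (rule hsol_mod_p)
  have "p dvd 4 * x * y" using hsol_dvd_x[OF u assms(2) 1(2)] by simp
  then show ?thesis using 1(1) by (metis dvd_cong)
qed

text \<open>Only x is forced to be divisible by \<open>p\<close>, so a single \<open>p\<close> can
  be divided out, and afterwards the term in y^2 is the leading one. This is why \<open>u\<close>,
  \<open>v\<close> and \<open>k\<close>, \<open>l\<close> change places.\<close>

lemma hsol_scale:
  assumes u: "\<not> p dvd u"
  shows "hsol (Suc n) u v k l (p * r1) (p * r0) \<longleftrightarrow> hsol n v u l (p ^ 2 * k) r1 r0"
proof -
  have id: "p * r1 - 4 * (p * x) * y = p * (r1 - 4 * y * x)"
    "p * r0 - hform u v k l (p * x) y =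
      p * (r0 - hform v u l (p ^ 2 * k) y x)" for x y
    by (simp_all add: ring_expand)
  have c: "p ^ Suc n dvd p * z \<longleftrightarrow> p ^ n dvd z" for z by simp
  show ?thesis
  proof
    assume "hsol (Suc n) u v k l (p * r1) (p * r0)"
    then obtain x y where 1: "p dvd p * r0 - u * x ^ 2" "p ^ Suc n dvd p * r1 - 4 * x * y"
    "p ^ Suc n dvd p * r0 - hform u v k l x y"
      by (rule hsol_mod_p)
    have "p dvd x" using hsol_dvd_x[OF u _ 1(1)] by simp
    then obtain x' where x: "x = p * x'" by (metis dvdE)
    show "hsol n v u l (p ^ 2 * k) r1 r0" using 1(2,3) unfolding x id c hsol_def by blast
  next
    assume "hsol n v u l (p ^ 2 * k) r1 r0"
    then show "hsol (Suc n) u v k l (p * r1) (p * r0)"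
      unfolding hsol_def using id c by metis
  qed
qed

lemma qsol_hsol:
  "qsol (Suc (Suc n)) 1 (p * e) (p ^ 2 * r1) (p ^ 2 * r0) \<longleftrightarrow> hsol n 1 (- 4 * e) 0 (- 4) r1 r0"
proof -
  have id: "p ^ 2 * r1 - 4 * (p * x) * (p * y) = p ^ 2 * (r1 - 4 * y * x)"
    "p ^ 2 * r0 - qform 1 (p * e) (p * x) (p * y) =
      p ^ 2 * (r0 - hform 1 (- 4 * e) 0 (- 4) y x)" for x y
    by (simp_all add: ring_expand)
  have c: "p ^ Suc (Suc n) dvd p ^ 2 * z \<longleftrightarrow> p ^ n dvd z" for z
    by (simp add: power2_eq_square mult.assoc)
  show ?thesis
  proof
    assume "qsol (Suc (Suc n)) 1 (p * e) (p ^ 2 * r1) (p ^ 2 * r0)"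
    then obtain x y where 1: "p ^ Suc (Suc n) dvd p ^ 2 * r1 - 4 * x * y"
      "p ^ Suc (Suc n) dvd p ^ 2 * r0 - qform 1 (p * e) x y"
      unfolding qsol_def by blast
    then have 2: "p dvd p ^ 2 * r1 - 4 * x * y" "p dvd p ^ 2 * r0 - qform 1 (p * e) x y"
      using power_dvd_mono[of 1 "Suc (Suc n)"] by simp_all
    have "p dvd p ^ 2 * r1" by simp
    then have xy: "p dvd 4 * x * y" using 2(1) by (metis dvd_cong)
    have "p dvd p * (p * r0 + 4 * e * x ^ 2)" by simp
    moreover have "p * (p * r0 + 4 * e * x ^ 2) - (p ^ 2 * r0 - qform 1 (p * e) x y)
      = y ^ 2 - 4 * x ^ 4" by (simp add: ring_expand)
    ultimately have "p dvd y ^ 2 - 4 * x ^ 4" using 2(2) by (metis dvd_diff)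
    then have "p dvd y ^ 2 \<longleftrightarrow> p dvd 4 * x ^ 4" by (rule dvd_cong)
    then have "p dvd x \<and> p dvd y" using xy by auto
    then obtain x' y' where xy: "x = p * x'" "y = p * y'" by (metis dvdE)
    show "hsol n 1 (- 4 * e) 0 (- 4) r1 r0" using 1 unfolding xy id c hsol_def by blast
  next
    assume "hsol n 1 (- 4 * e) 0 (- 4) r1 r0"
    then show "qsol (Suc (Suc n)) 1 (p * e) (p ^ 2 * r1) (p ^ 2 * r0)"
      unfolding hsol_def qsol_def using id c by metis
  qed
qed

text \<open>Linear factors need no separate count: a root forces e^2 - r0 to be divisible by
  \<open>p\<close>, so r0 is a unit square modulo \<open>p\<close> and \<open>hsol\<close> holds
  anyway.\<close>

lemma red_slope_half:
  assumes "\<not> (p dvd e \<and> p dvd r0)"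
  shows "red (Suc (Suc (Suc n))) (2 * (p * e)) (- (p ^ 2 * r1)) ((p * e) ^ 2 - p ^ 2 * r0) \<longleftrightarrow>
         hsol (Suc n) 1 (- 4 * e) 0 (- 4) r1 r0"
proof -
  have "hsol (Suc n) 1 (- 4 * e) 0 (- 4) r1 r0"
    if "has_root (Suc (Suc (Suc n))) (2 * (p * e)) (- (p ^ 2 * r1)) ((p * e) ^ 2 - p ^ 2 * r0)"
  proof -
    have "has_root 3 (2 * (p * e)) (- (p ^ 2 * r1)) ((p * e) ^ 2 - p ^ 2 * r0)"
      using that by (rule has_root_mono[rotated]) simp
    then obtain x where x: "p ^ 3 dvd depressed (2 * (p * e)) (- (p ^ 2 * r1)) ((p * e) ^ 2 - p ^ 2 * r0) x"
      unfolding has_root_def by blast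
    then have "p dvd depressed (2 * (p * e)) (- (p ^ 2 * r1)) ((p * e) ^ 2 - p ^ 2 * r0) x"
      using power_dvd_mono[of 1 3] by simp
    moreover have "depressed (2 * (p * e)) (- (p ^ 2 * r1)) ((p * e) ^ 2 - p ^ 2 * r0) x =
      x ^ 4 + p * (2 * e * x ^ 2 - p * r1 * x + p * e ^ 2 - p * r0)" by (simp add: ring_expand)
    ultimately have "p dvd x ^ 4" by (metis dvd_add_left_iff dvd_triv_left)
    then obtain y where y: "x = p * y" by (auto elim: dvdE)
    have "depressed (2 * (p * e)) (- (p ^ 2 * r1)) ((p * e) ^ 2 - p ^ 2 * r0) x =
      p ^ 3 * (p * y ^ 4 + 2 * e * y ^ 2 - r1 * y) + p ^ 2 * (e ^ 2 - r0)"
      unfolding y by (simp add: ring_expand)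
    then have "p ^ 3 dvd p ^ 2 * (e ^ 2 - r0)" using x by (metis dvd_add_right_iff dvd_triv_left)
    then have d: "p dvd e ^ 2 - 1 * r0" by (simp add: power2_eq_square power3_eq_cube)
    then have "p dvd e ^ 2 \<longleftrightarrow> p dvd 1 * r0" by (rule dvd_cong)
    then have "\<not> p dvd r0" using assms by auto
    moreover have "\<not> nonsq (1 * r0)" using d unfolding nonsq_def by blast
    ultimately show ?thesis using hsol_unit[OF not_pdvd_2(4)] by blast
  qed
  then show ?thesis unfolding red_def has_quad_qsol qsol_hsol by blast
qed

section \<open>Averages in two and three variables\<close>

definition mean2 :: "nat \<Rightarrow> nat \<Rightarrow> (int \<Rightarrow> int \<Rightarrow> real) \<Rightarrow> real" where
  "mean2 A B f = mean A (\<lambda>x. mean B (f x))"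

definition mean3 :: "nat \<Rightarrow> nat \<Rightarrow> nat \<Rightarrow> (int \<Rightarrow> int \<Rightarrow> int \<Rightarrow> real) \<Rightarrow> real" where
  "mean3 A B C f = mean A (\<lambda>x. mean2 B C (f x))"

lemma mean2_const [simp]: "mean2 A B (\<lambda>_ _. c) = c"
  by (simp add: mean2_def)

lemma mean2_add: "mean2 A B (\<lambda>x y. f x y + g x y) = mean2 A B f + mean2 A B g"
  by (simp add: mean2_def mean_add)

lemma mean2_diff: "mean2 A B (\<lambda>x y. f x y - g x y) = mean2 A B f - mean2 A B g"
  by (simp add: mean2_def mean_diff)

lemma mean2_mono: "(\<And>x y. f x y \<le> g x y) \<Longrightarrow> mean2 A B f \<le> mean2 A B g"
  by (simp add: mean2_def mean_mono)

lemma mean2_cong: "(\<And>x y. f x y = g x y) \<Longrightarrow> mean2 A B f = mean2 A B g"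
proof -
  assume "\<And>x y. f x y = g x y"
  then have "f = g" by (intro ext)
  then show ?thesis by simp
qed

lemma mean3_const [simp]: "mean3 A B C (\<lambda>_ _ _. c) = c"
  by (simp add: mean3_def)

lemma mean3_add: "mean3 A B C (\<lambda>x y z. f x y z + g x y z) = mean3 A B C f + mean3 A B C g"
  by (simp add: mean3_def mean2_add mean_add)

lemma mean3_mono: "(\<And>x y z. f x y z \<le> g x y z) \<Longrightarrow> mean3 A B C f \<le> mean3 A B C g"
  by (simp add: mean3_def mean_mono mean2_mono)

lemma mean2_dvd:
  assumes "i \<le> A" "j \<le> B"
  shows "mean2 A B (\<lambda>x y. if p ^ i dvd x \<and> p ^ j dvd y then f x y else 0) =
         mean2 (A - i) (B - j) (\<lambda>x y. f (p ^ i * x) (p ^ j * y)) / p ^ (i + j)"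
proof -
  have "mean B (\<lambda>y. if p ^ i dvd x \<and> p ^ j dvd y then f x y else 0) =
    (if p ^ i dvd x then mean (B - j) (\<lambda>y. f x (p ^ j * y)) / p ^ j else 0)" for x
    using mean_dvd_le[OF assms(2), of "f x"] by (cases "p ^ i dvd x") simp_all
  then show ?thesis
    using mean_dvd_le[OF assms(1), of "\<lambda>x. mean (B - j) (\<lambda>y. f x (p ^ j * y)) / p ^ j"]
    by (simp add: mean2_def mean_divc power_add mult.commute)
qed

lemma mean3_dvd:
  assumes "i \<le> A" "j \<le> B" "k \<le> C"
  shows "mean3 A B C (\<lambda>x y z. if p ^ i dvd x \<and> p ^ j dvd y \<and> p ^ k dvd z then f x y z else 0) =
         mean3 (A - i) (B - j) (C - k) (\<lambda>x y z. f (p ^ i * x) (p ^ j * y) (p ^ k * z)) / p ^ (i + j + k)"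
proof -
  have "mean2 B C (\<lambda>y z. if p ^ i dvd x \<and> p ^ j dvd y \<and> p ^ k dvd z then f x y z else 0) =
    (if p ^ i dvd x then mean2 (B - j) (C - k) (\<lambda>y z. f x (p ^ j * y) (p ^ k * z)) / p ^ (j + k) else 0)" for x
    using mean2_dvd[OF assms(2,3), of "f x"] by (cases "p ^ i dvd x") simp_all
  then show ?thesis
    using mean_dvd_le[OF assms(1), of "\<lambda>x. mean2 (B - j) (C - k) (\<lambda>y z. f x (p ^ j * y) (p ^ k * z)) / p ^ (j + k)"]
    by (simp add: mean3_def mean_divc power_add mult_ac)
qed

definition periodic3 :: "nat \<Rightarrow> (int \<Rightarrow> int \<Rightarrow> int \<Rightarrow> real) \<Rightarrow> bool" where
  "periodic3 n f \<longleftrightarrow> (\<forall>a a' b b' c c'. p ^ n dvd a - a' \<longrightarrow> p ^ n dvd b - b' \<longrightarrow> p ^ n dvd c - c' \<longrightarrow>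
     f a b c = f a' b' c')"

text \<open>A triangular change of variables, resolved from the innermost average outwards. It
  covers changes of level, the coordinates (e, r1, r0) and the removal of the cubic term.\<close>

lemma mean3_substitute:
  assumes per: "periodic3 n f"
    and x: "\<And>g :: int \<Rightarrow> real. (\<And>x y. p ^ n dvd x - y \<Longrightarrow> g x = g y) \<Longrightarrow> mean A (\<lambda>x. g (\<alpha> x)) = mean n g"
    and y: "\<And>x (g :: int \<Rightarrow> real). (\<And>x y. p ^ n dvd x - y \<Longrightarrow> g x = g y) \<Longrightarrow> mean B (\<lambda>y. g (\<beta> x y)) = mean n g"
    and z: "\<And>x y (g :: int \<Rightarrow> real). (\<And>x y. p ^ n dvd x - y \<Longrightarrow> g x = g y) \<Longrightarrow> mean C (\<lambda>z. g (\<gamma> x y z)) = mean n g"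
  shows "mean3 A B C (\<lambda>x y z. f (\<alpha> x) (\<beta> x y) (\<gamma> x y z)) = mean3 n n n f"
proof -
  have 1: "mean C (\<lambda>z. f a b (\<gamma> x y z)) = mean n (f a b)" for a b x y
    using per unfolding periodic3_def by (intro z) auto
  have 2: "mean B (\<lambda>y. mean n (f a (\<beta> x y))) = mean n (\<lambda>b. mean n (f a b))" for a x
  proof (rule y)
    fix u v assume "p ^ n dvd u - v"
    then have "f a u = f a v" using per by (auto simp: periodic3_def fun_eq_iff)
    then show "mean n (f a u) = mean n (f a v)" by simp
  qed
  have 3: "mean A (\<lambda>x. mean n (\<lambda>b. mean n (f (\<alpha> x) b))) = mean n (\<lambda>a. mean n (\<lambda>b. mean n (f a b)))"
  proof (rule x)
    fix u v assume "p ^ n dvd u - v"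
    then have "f u = f v" using per by (auto simp: periodic3_def fun_eq_iff)
    then show "mean n (\<lambda>b. mean n (f u b)) = mean n (\<lambda>b. mean n (f v b))" by simp
  qed
  show ?thesis by (simp add: mean3_def mean2_def 1 2 3)
qed

lemma mean3_level:
  "periodic3 n f \<Longrightarrow> n \<le> A \<Longrightarrow> n \<le> B \<Longrightarrow> n \<le> C \<Longrightarrow> mean3 A B C f = mean3 n n n f"
  using mean3_substitute[of n f A "\<lambda>x. x" B "\<lambda>_ y. y" C "\<lambda>_ _ z. z"] mean_level by blast

lemma mean_translate:
  "(\<And>x y. p ^ n dvd x - y \<Longrightarrow> g x = g y) \<Longrightarrow> mean n (\<lambda>x. g (x + v)) = mean n g"
  using mean_affine[of n g 1 v] by simp

lemma mean_reflect:
  "(\<And>x y. p ^ n dvd x - y \<Longrightarrow> g x = g y) \<Longrightarrow> mean n (\<lambda>x. g (v - x)) = mean n g"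
  using mean_affine[of n g "- 1" v] by simp

lemma mean3_coords:
  assumes "periodic3 n f"
  shows "mean3 n n n f = mean3 n n n (\<lambda>e r1 r0. f (2 * e) (- r1) (e ^ 2 - r0))"
proof (rule mean3_substitute[symmetric, OF assms, where \<alpha> = "\<lambda>e. 2 * e"])
  show "mean n (\<lambda>x. g (2 * x)) = mean n g" if "\<And>x y. p ^ n dvd x - y \<Longrightarrow> g x = g y" for g
    using mean_affine[of n g 2 0] that by simp
  show "mean n (\<lambda>y. g (- y)) = mean n g" if "\<And>x y. p ^ n dvd x - y \<Longrightarrow> g x = g y" for g
    using mean_reflect[of n g 0] that by simp
qed (rule mean_reflect)

lemma mean_card: "mean N (\<lambda>x. of_bool (P x)) = card {x \<in> {0..<p ^ N}. P x} / p ^ N"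
  by (simp add: mean_def sum.If_cases of_bool_def Int_def)

lemma mean2_card:
  "mean2 A B (\<lambda>x y. of_bool (P x y)) =
    card {(x, y). x \<in> {0..<p ^ A} \<and> y \<in> {0..<p ^ B} \<and> P x y} / (p ^ A * p ^ B)"
proof -
  have "(\<Sum>x\<in>{0..<p ^ A}. \<Sum>y\<in>{0..<p ^ B}. of_bool (P x y) :: real) =
    (\<Sum>z\<in>{0..<p ^ A} \<times> {0..<p ^ B}. if P (fst z) (snd z) then 1 else 0)"
    by (simp add: sum.cartesian_product of_bool_def case_prod_unfold)
  also have "\<dots> = card {z \<in> {0..<p ^ A} \<times> {0..<p ^ B}. P (fst z) (snd z)}"
    by (simp add: sum.If_cases Int_def)
  also have "{z \<in> {0..<p ^ A} \<times> {0..<p ^ B}. P (fst z) (snd z)} =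
    {(x, y). x \<in> {0..<p ^ A} \<and> y \<in> {0..<p ^ B} \<and> P x y}" by auto
  finally show ?thesis
    by (simp add: mean2_def mean_def flip: sum_divide_distrib)
qed

lemma eq_mod_dvd: "x \<in> {0..<p} \<Longrightarrow> y \<in> {0..<p} \<Longrightarrow> p dvd x - y \<longleftrightarrow> x = y"
  using mod_eq_dvd_iff[of x p y] by simp

lemma pdvd_residue: "x \<in> {0..<p} \<Longrightarrow> p dvd x \<longleftrightarrow> x = 0"
  using eq_mod_dvd[of x 0] by simp

subsection \<open>Counting squares\<close>

lemma card_squares: "2 * card ((\<lambda>x. x ^ 2 mod p) ` {1..<p}) = nat (p - 1)"
proof -
  have "card {y \<in> {1..<p}. y ^ 2 mod p = x ^ 2 mod p} = 2" if x: "x \<in> {1..<p}" for x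
  proof -
    have "{y \<in> {1..<p}. y ^ 2 mod p = x ^ 2 mod p} = {x, p - x}"
    proof (intro equalityI subsetI)
      fix y assume y: "y \<in> {y \<in> {1..<p}. y ^ 2 mod p = x ^ 2 mod p}"
      then have "p dvd y ^ 2 - x ^ 2" by (simp add: mod_eq_dvd_iff)
      then have "p dvd (y - x) * (y + x)" by (simp add: ring_expand)
      then consider "p dvd y - x" | "p dvd y + x" by auto
      then show "y \<in> {x, p - x}"
      proof cases
        case 1 then show ?thesis using eq_mod_dvd[of y x] x y by simp
      next
        case 2
        then have "p dvd y - (p - x)" by (simp add: algebra_simps dvd_diff_right_iff)
        then show ?thesis using eq_mod_dvd[of y "p - x"] x y by simp
      qed
    next
      fix y assume "y \<in> {x, p - x}"
      moreover have "(p - x) ^ 2 mod p = x ^ 2 mod p"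
      proof -
        have "(p - x) ^ 2 - x ^ 2 = p * (p - 2 * x)" by (simp add: ring_expand)
        then show ?thesis by (simp add: mod_eq_dvd_iff)
      qed
      ultimately show "y \<in> {y \<in> {1..<p}. y ^ 2 mod p = x ^ 2 mod p}" using x by auto
    qed
    moreover have "x \<noteq> p - x" using odd_p by presburger
    ultimately show ?thesis by simp
  qed
  then show ?thesis using card_two_to_one[of "{1..<p}" "\<lambda>x. x ^ 2 mod p"] by simp
qed

lemma mean_nonsq: "1 \<le> N \<Longrightarrow> mean N (\<lambda>z. of_bool (nonsq z)) = (p - 1) / (2 * p)"
proof -
  assume N: "1 \<le> N"
  let ?S = "(\<lambda>x. x ^ 2 mod p) ` {1..<p}"
  have "{z \<in> {0..<p}. nonsq z} = {1..<p} - ?S"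
  proof (intro equalityI subsetI)
    fix z assume z: "z \<in> {z \<in> {0..<p}. nonsq z}"
    then have "z \<noteq> 0" using nonsq_unit[of z] by auto
    moreover have "z \<notin> ?S"
    proof
      assume "z \<in> ?S"
      then obtain x where "z = x ^ 2 mod p" by auto
      then have "p dvd x ^ 2 - z" by (simp add: mod_eq_dvd_iff[symmetric])
      then show False using z by (simp add: nonsq_def)
    qed
    ultimately show "z \<in> {1..<p} - ?S" using z by auto
  next
    fix z assume z: "z \<in> {1..<p} - ?S"
    have "\<not> p dvd x ^ 2 - z" for x
    proof
      assume d: "p dvd x ^ 2 - z"
      have "\<not> p dvd z" using pdvd_residue[of z] z by auto
      then have "\<not> p dvd x" using d dvd_cong[OF d] by simp
      then have 1: "x mod p \<in> {1..<p}"
        by (metis atLeastLessThan_iff dvd_eq_mod_eq_0 int_one_le_iff_zero_less le_neq_trans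
            p_pos(1) pos_mod_bound pos_mod_sign)
      have "(x mod p) ^ 2 mod p = x ^ 2 mod p" by (simp add: power_mod)
      also have "\<dots> = z" using d z by (simp flip: mod_eq_dvd_iff)
      finally show False using 1 z by auto
    qed
    then show "z \<in> {z \<in> {0..<p}. nonsq z}" using z by (simp add: nonsq_def)
  qed
  moreover have "?S \<subseteq> {1..<p}"
  proof
    fix z assume "z \<in> ?S"
    then obtain x where x: "x \<in> {1..<p}" "z = x ^ 2 mod p" by auto
    then have "\<not> p dvd x ^ 2" using pdvd_residue[of x] by auto
    then have "z \<noteq> 0" using x by (simp add: dvd_eq_mod_eq_0)
    moreover have "0 \<le> z" "z < p" using x by auto
    ultimately show "z \<in> {1..<p}" by simp
  qed
  ultimately have "card {z \<in> {0..<p}. nonsq z} = nat (p - 1) - card ?S"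
    by (simp add: card_Diff_subset)
  then have "2 * real (card {z \<in> {0..<p}. nonsq z}) = real_of_int (p - 1)"
    using card_squares p_gt2 by simp
  then have "mean 1 (\<lambda>z. of_bool (nonsq z)) = (p - 1) / (2 * p)"
    by (simp add: mean_card field_simps)
  moreover have "mean N (\<lambda>z. of_bool (nonsq z) :: real) = mean 1 (\<lambda>z. of_bool (nonsq z))"
    by (rule mean_level[OF _ N]) (use nonsq_cong in auto)
  ultimately show ?thesis by simp
qed

lemma mean_nonsq_affine:
  assumes "1 \<le> N" "\<not> p dvd u"
  shows "mean N (\<lambda>z. of_bool (nonsq (u * z + v))) = (p - 1) / (2 * p)"
proof -
  have "mean N (\<lambda>z. of_bool (nonsq (u * z + v)) :: real) = mean N (\<lambda>z. of_bool (nonsq z))"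
  proof (rule mean_affine[OF _ assms(2)])
    fix x y assume "p ^ N dvd x - y"
    then have "p dvd x - y" using power_dvd_mono[of 1 N] assms(1) by simp
    then show "(of_bool (nonsq x) :: real) = of_bool (nonsq y)" using nonsq_cong by simp
  qed
  then show ?thesis using mean_nonsq assms by simp
qed

text \<open>Modulo \<open>p\<close> the map \<open>(x, y) \<mapsto> (4xy, y\<^sup>2 - 4ex\<^sup>2)\<close> is squaring in the field with \<open>p\<^sup>2\<close> elements.\<close>

lemma card_quadratic_squares:
  assumes e: "nonsq (- e)"
  defines "f \<equiv> \<lambda>(x, y). (4 * x * y mod p, (y ^ 2 - 4 * e * x ^ 2) mod p)"
  shows "2 * card (f ` ({0..<p} \<times> {0..<p} - {(0, 0)})) = nat p ^ 2 - 1"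
proof -
  let ?S = "{0..<p} \<times> {0..<p} - {(0, 0)}"
  define neg where "neg x = (if x = 0 then 0 else p - x)" for x :: int
  have neg: "neg x \<in> {0..<p}" "p dvd x + neg x" if "x \<in> {0..<p}" for x
    using that by (auto simp: neg_def)
  have f_eq: "f (x, y) = f (x', y') \<longleftrightarrow>
     p dvd x * y - x' * y' \<and> p dvd (y ^ 2 - 4 * e * x ^ 2) - (y' ^ 2 - 4 * e * x' ^ 2)" for x y x' y'
  proof -
    have "4 * x * y - 4 * x' * y' = 4 * (x * y - x' * y')" by (simp add: ring_expand)
    then have "p dvd 4 * x * y - 4 * x' * y' \<longleftrightarrow> p dvd x * y - x' * y'" by (metis not_pdvd_2(2) pdvd_mult)
    then show ?thesis by (simp add: f_def mod_eq_dvd_iff)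
  qed
  have "card {z \<in> ?S. f z = f w} = 2" if w: "w \<in> ?S" for w
  proof -
    obtain x y where xy: "w = (x, y)" "x \<in> {0..<p}" "y \<in> {0..<p}" "x \<noteq> 0 \<or> y \<noteq> 0"
      using w by (cases w) auto
    have "{z \<in> ?S. f z = f w} = {(x, y), (neg x, neg y)}"
    proof (intro equalityI subsetI)
      fix z assume "z \<in> {z \<in> ?S. f z = f w}"
      then obtain x' y' where z: "z = (x', y')" "x' \<in> {0..<p}" "y' \<in> {0..<p}"
        and "f (x, y) = f (x', y')" unfolding xy(1) by (cases z) auto
      then have 1: "p dvd x * y - x' * y'" "p dvd (y ^ 2 - 4 * e * x ^ 2) - (y' ^ 2 - 4 * e * x' ^ 2)"
        using f_eq by auto
      \<comment> \<open>The norm identity N(z - w) N(z + w) = N(z^2 - w^2) for z = y + 2x sqrt(-e)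
        and w = y' + 2x' sqrt(-e): equal squares give z = w or z = -w without constructing the
        field.\<close>
      have "((y - y') ^ 2 + 4 * e * (x - x') ^ 2) * ((y + y') ^ 2 + 4 * e * (x + x') ^ 2) =
        ((y ^ 2 - 4 * e * x ^ 2) - (y' ^ 2 - 4 * e * x' ^ 2)) ^ 2 + 16 * e * (x * y - x' * y') ^ 2"
        by (simp add: ring_expand)
      moreover have "p dvd \<dots>" using 1 by (intro dvd_add) simp_all
      ultimately consider "p dvd (y - y') ^ 2 + 4 * e * (x - x') ^ 2" | "p dvd (y + y') ^ 2 + 4 * e * (x + x') ^ 2"
        by (metis pdvd_mult)
      then show "z \<in> {(x, y), (neg x, neg y)}"
      proof cases
        case 1
        then have "p dvd x - x' \<and> p dvd y - y'" using anisotropic e by blast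
        then show ?thesis using eq_mod_dvd xy z by auto
      next
        case 2
        then have a: "p dvd x + x' \<and> p dvd y + y'" using anisotropic e by blast
        then have "p dvd (x + x') - (x + neg x)" "p dvd (y + y') - (y + neg y)"
          using neg xy by (meson dvd_diff)+
        then have "p dvd x' - neg x" "p dvd y' - neg y" by simp_all
        then show ?thesis using eq_mod_dvd neg xy z by auto
      qed
    next
      fix z assume "z \<in> {(x, y), (neg x, neg y)}"
      then consider "z = (x, y)" | "z = (neg x, neg y)" by auto
      then show "z \<in> {z \<in> ?S. f z = f w}"
      proof cases
        case 1 then show ?thesis using w xy by simp
      next
        case 2
        have "neg x * neg y - x * y = neg x * (y + neg y) - y * (x + neg x)"
          by (simp add: ring_expand)
        then have "p dvd neg x * neg y - x * y"
          using neg(2)[OF xy(2)] neg(2)[OF xy(3)] by (metis dvd_diff dvd_mult)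
        moreover have "(neg y ^ 2 - 4 * e * neg x ^ 2) - (y ^ 2 - 4 * e * x ^ 2) =
          (neg y - y) * (y + neg y) - 4 * e * (neg x - x) * (x + neg x)" by (simp add: ring_expand)
        then have "p dvd (neg y ^ 2 - 4 * e * neg x ^ 2) - (y ^ 2 - 4 * e * x ^ 2)"
          using neg(2)[OF xy(2)] neg(2)[OF xy(3)] by (metis dvd_diff dvd_mult)
        ultimately have "f (neg x, neg y) = f (x, y)" using f_eq by blast
        moreover have "neg x \<noteq> 0 \<or> neg y \<noteq> 0" using xy by (auto simp: neg_def)
        ultimately show ?thesis using 2 neg(1)[OF xy(2)] neg(1)[OF xy(3)] xy(1) by auto
      qed
    qed
    moreover have "(x, y) \<noteq> (neg x, neg y)"
    proof
      assume "(x, y) = (neg x, neg y)"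
      then have "p dvd 2 * x" "p dvd 2 * y" using neg(2)[OF xy(2)] neg(2)[OF xy(3)] by auto
      then show False using xy pdvd_residue by auto
    qed
    ultimately show ?thesis by simp
  qed
  then have "card ?S = 2 * card (f ` ?S)" by (intro card_two_to_one) auto
  moreover have "card ?S = nat p ^ 2 - 1"
    by (subst card_Diff_subset) (auto simp: power2_eq_square)
  ultimately show ?thesis by simp
qed

text \<open>Half of the p^2 - 1 nonzero elements of the residue field are not squares. The condition
  depends on residues modulo \<open>p\<close> only, so the count takes place at level 1.\<close>

lemma mean_qsol_unit:
  assumes e: "nonsq (- e)" and AB: "1 \<le> A" "1 \<le> B"
  shows "mean2 A B (\<lambda>r1 r0. of_bool (\<not> (p dvd r1 \<and> p dvd r0) \<and> \<not> qsol 1 0 e r1 r0)) = (p ^ 2 - 1) / (2 * p ^ 2)"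
proof -
  let ?S = "{0..<p} \<times> {0..<p} - {(0, 0)}"
  define f where "f = (\<lambda>(x, y). (4 * x * y mod p, (y ^ 2 - 4 * e * x ^ 2) mod p))"
  let ?P = "\<lambda>r1 r0. \<not> (p dvd r1 \<and> p dvd r0) \<and> \<not> qsol 1 0 e r1 r0"
  have q: "qsol 1 0 e r1 r0 \<longleftrightarrow> (\<exists>x y. p dvd r1 - 4 * x * y \<and> p dvd r0 - (y ^ 2 - 4 * e * x ^ 2))" for r1 r0
    by (simp add: qsol_def)
  have P_cong: "?P r1 r0 \<longleftrightarrow> ?P r1' r0'" if d: "p dvd r1 - r1'" "p dvd r0 - r0'" for r1 r0 r1' r0'
  proof -
    have "p dvd r1 - z \<longleftrightarrow> p dvd r1' - z" "p dvd r0 - z \<longleftrightarrow> p dvd r0' - z" for z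
      using d by (intro dvd_cong; simp)+
    then show ?thesis unfolding q by (metis diff_zero)
  qed
  have set_eq: "{(r1, r0). r1 \<in> {0..<p} \<and> r0 \<in> {0..<p} \<and> ?P r1 r0} = ?S - f ` ?S" (is "?L = ?R")
  proof (intro equalityI subsetI)
    fix z assume "z \<in> ?L"
    then obtain r1 r0 where z: "z = (r1, r0)" "r1 \<in> {0..<p}" "r0 \<in> {0..<p}" "?P r1 r0" by auto
    have "z \<notin> f ` ?S"
    proof
      assume "z \<in> f ` ?S"
      then obtain x y where "r1 = 4 * x * y mod p" "r0 = (y ^ 2 - 4 * e * x ^ 2) mod p"
        using z by (auto simp: f_def)
      then have "p dvd r1 - 4 * x * y" "p dvd r0 - (y ^ 2 - 4 * e * x ^ 2)"
        by (simp_all add: mod_eq_dvd_iff[symmetric])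
      then show False using z(4) q by blast
    qed
    then show "z \<in> ?R" using z by auto
  next
    fix z assume z0: "z \<in> ?R"
    then obtain r1 r0 where z: "z = (r1, r0)" "r1 \<in> {0..<p}" "r0 \<in> {0..<p}" "\<not> (r1 = 0 \<and> r0 = 0)" by auto
    have nz: "\<not> (p dvd r1 \<and> p dvd r0)" using z pdvd_residue by auto
    moreover have "\<not> qsol 1 0 e r1 r0"
    proof
      assume "qsol 1 0 e r1 r0"
      then obtain x y where xy: "p dvd r1 - 4 * x * y" "p dvd r0 - (y ^ 2 - 4 * e * x ^ 2)"
        using q by blast
      have "4 * x * y mod p = r1 mod p" "(y ^ 2 - 4 * e * x ^ 2) mod p = r0 mod p"
        using xy by (metis mod_eq_dvd_iff)+
      moreover have "(y ^ 2 - 4 * e * x ^ 2) mod p = ((y mod p) ^ 2 - 4 * e * (x mod p) ^ 2) mod p"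
        by (metis mod_diff_cong mod_mult_right_eq power_mod)
      moreover have "4 * (x mod p) * (y mod p) mod p = 4 * x * y mod p"
        by (intro mod_mult_cong) (simp_all add: mod_mult_right_eq)
      ultimately have fz: "f (x mod p, y mod p) = z" using z by (simp add: f_def)
      have "\<not> (p dvd x \<and> p dvd y)"
      proof
        assume "p dvd x \<and> p dvd y"
        then have "p dvd 4 * x * y" "p dvd y ^ 2 - 4 * e * x ^ 2" by (simp_all add: dvd_diff)
        then show False using xy nz by (metis dvd_cong)
      qed
      then have "(x mod p, y mod p) \<in> ?S" by (auto simp: dvd_eq_mod_eq_0)
      then show False using fz z0 by blast
    qed
    ultimately show "z \<in> ?L" using z by auto
  qed
  have fS: "f ` ?S \<subseteq> ?S"
  proof
    fix z assume "z \<in> f ` ?S"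
    then obtain w where "w \<in> ?S" "z = f w" by blast
    then obtain x y where xy: "x \<in> {0..<p}" "y \<in> {0..<p}" "x \<noteq> 0 \<or> y \<noteq> 0" "z = f (x, y)"
      by (cases w) auto
    have "z \<noteq> (0, 0)"
    proof
      assume "z = (0, 0)"
      then have "p dvd 4 * x * y" "p dvd y ^ 2 - 4 * e * x ^ 2" using xy by (auto simp: f_def)
      then have 1: "p dvd x \<or> p dvd y" "p dvd y ^ 2 \<longleftrightarrow> p dvd 4 * e * x ^ 2"
        using dvd_cong[of p "y ^ 2" "4 * e * x ^ 2"] by simp_all
      have "\<not> p dvd e" using nonsq_unit[OF e] by simp
      then have "p dvd x \<and> p dvd y" using 1 by auto
      then show False using xy pdvd_residue by auto
    qed
    then show "z \<in> ?S" using xy by (auto simp: f_def)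
  qed
  have "card (?S - f ` ?S) = card ?S - card (f ` ?S)"
    by (rule card_Diff_subset[OF _ fS]) auto
  moreover have "card ?S = nat p ^ 2 - 1"
    by (subst card_Diff_subset) (auto simp: power2_eq_square)
  moreover have "2 * card (f ` ?S) = nat p ^ 2 - 1"
    using card_quadratic_squares[OF e] by (simp add: f_def)
  ultimately have "2 * card (?S - f ` ?S) = nat p ^ 2 - 1" by linarith
  then have "2 * real (card (?S - f ` ?S)) = real (nat p ^ 2 - 1)" 
    by (simp only: flip: of_nat_numeral[where 'a = real] of_nat_mult)
  also have "\<dots> = real_of_int p ^ 2 - 1"
  proof -
    have "1 \<le> nat p ^ 2" using p_gt2 by (intro one_le_power) simp
    moreover have "real (nat p) = real_of_int p" using p_gt2 by simp
    ultimately show ?thesis by (simp add: of_nat_diff)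
  qed
  finally have c: "2 * real (card (?S - f ` ?S)) = real_of_int p ^ 2 - 1" .
  have "mean B (\<lambda>r0. of_bool (?P r1 r0) :: real) = mean 1 (\<lambda>r0. of_bool (?P r1 r0))" for r1
  proof (rule mean_level[OF _ AB(2)])
    fix x y assume "p ^ 1 dvd x - y"
    then have "?P r1 x \<longleftrightarrow> ?P r1 y" by (intro P_cong) simp_all
    then show "(of_bool (?P r1 x) :: real) = of_bool (?P r1 y)" by (simp only:)
  qed
  moreover have "mean A (\<lambda>r1. mean 1 (\<lambda>r0. of_bool (?P r1 r0) :: real)) = mean 1 (\<lambda>r1. mean 1 (\<lambda>r0. of_bool (?P r1 r0)))"
  proof (rule mean_level[OF _ AB(1)])
    fix x y assume "p ^ 1 dvd x - y"
    then have "?P x r0 \<longleftrightarrow> ?P y r0" for r0 by (intro P_cong) simp_all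
    then show "mean 1 (\<lambda>r0. of_bool (?P x r0) :: real) = mean 1 (\<lambda>r0. of_bool (?P y r0))"
      by (simp only:)
  qed
  ultimately have "mean2 A B (\<lambda>r1 r0. of_bool (?P r1 r0)) = mean2 1 1 (\<lambda>r1 r0. of_bool (?P r1 r0))"
    by (simp add: mean2_def)
  also have "\<dots> = card (?S - f ` ?S) / (p * p)"
    using mean2_card[of 1 1 ?P] unfolding power_one_right set_eq by simp
  finally show ?thesis using c by (simp add: power2_eq_square field_simps)
qed

section \<open>Densities of non-squares in quadratic extensions\<close>

lemma mean2_of_bool_bounds:
  "0 \<le> mean2 A B (\<lambda>x y. of_bool (P x y))" "mean2 A B (\<lambda>x y. of_bool (P x y)) \<le> 1"
  using mean2_mono[of "\<lambda>_ _. 0" "\<lambda>x y. of_bool (P x y)" A B]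
    mean2_mono[of "\<lambda>x y. of_bool (P x y)" "\<lambda>_ _. 1" A B] by simp_all

text \<open>The density of non-squares in the integers of the unramified quadratic extension,
  obtained by solving \<open>gam_fixpoint\<close>.\<close>

definition gam :: real where "gam = (p ^ 2 + 2) / (2 * (p ^ 2 + 1))"

lemma gam_bounds: "0 \<le> gam" "gam \<le> 1"
proof -
  have "0 \<le> real_of_int p ^ 2" by simp
  then have "0 < 2 * (real_of_int p ^ 2 + 1)" "real_of_int p ^ 2 + 2 \<le> 2 * (real_of_int p ^ 2 + 1)"
    by (simp_all add: add_nonneg_pos)
  then show "0 \<le> gam" "gam \<le> 1" unfolding gam_def by simp_all
qed

text \<open>Sorted by valuation: non-square units, elements of valuation 1 (never squares), and the
  multiples of \<open>p ^ 2\<close>, a scaled copy of the whole.\<close>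

lemma gam_fixpoint:
  "gam = (p ^ 2 - 1) / (2 * p ^ 2) + (1 / p ^ 2 - 1 / p ^ 4) + gam / p ^ 4"
proof -
  have *: "(q + 2) / (2 * (q + 1)) = (q - 1) / (2 * q) + (1 / q - 1 / q ^ 2) + (q + 2) / (2 * (q + 1)) / q ^ 2"
    if "q > 0" for q :: real
  proof -
    have "q + 1 \<noteq> 0" "q \<noteq> 0" using that by auto
    then show ?thesis by (simp add: divide_simps) (simp add: ring_expand)
  qed
  have "real_of_int p ^ 4 = (real_of_int p ^ 2) ^ 2" "0 < real_of_int p ^ 2" by simp_all
  with *[of "real_of_int p ^ 2"] show ?thesis unfolding gam_def
    by (simp only: of_int_add of_int_mult of_int_power of_int_diff of_int_1 of_int_numeral)
qed

lemma mean_qsol_step: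
  assumes e: "nonsq (- e)" and AB: "Suc (Suc n) \<le> A" "Suc (Suc n) \<le> B"
  shows "mean2 A B (\<lambda>r1 r0. of_bool (p dvd r1 \<and> p dvd r0 \<and> \<not> qsol (Suc (Suc n)) (l ^ 2) e r1 r0)) =
     1 / p ^ 2 - 1 / p ^ 4 +
     mean2 (A - 2) (B - 2) (\<lambda>r1 r0. of_bool (\<not> qsol n ((p * l) ^ 2) e r1 r0)) / p ^ 4"
proof -
  have "(of_bool (p dvd r1 \<and> p dvd r0 \<and> \<not> qsol (Suc (Suc n)) (l ^ 2) e r1 r0) :: real) =
    (if p ^ 1 dvd r1 \<and> p ^ 1 dvd r0 then 1 else 0) - (if p ^ 2 dvd r1 \<and> p ^ 2 dvd r0 then 1 else 0) +
    (if p ^ 2 dvd r1 \<and> p ^ 2 dvd r0 then of_bool (\<not> qsol (Suc (Suc n)) (l ^ 2) e r1 r0) else 0)" for r1 r0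
  proof (cases "p ^ 2 dvd r1 \<and> p ^ 2 dvd r0")
    case True
    then have "p dvd r1" "p dvd r0" using power_dvd_mono[of 1 2] by auto
    then show ?thesis using True by simp
  next
    case False
    then have "p dvd r1 \<and> p dvd r0 \<Longrightarrow> \<not> qsol (Suc (Suc n)) (l ^ 2) e r1 r0"
      using qsol_dvd_p[OF e] by blast
    then show ?thesis using False by auto
  qed
  then show ?thesis
    using AB by (simp only: mean2_add mean2_diff mean2_dvd mean2_const qsol_scale[OF e]) (simp add: eval_nat_numeral)
qed

text \<open>A step uses two digits and divides the error by p^4, hence the induction by twos. The
  factor \<open>p ^ 2\<close> makes the bound at least 1, so trivial, at levels 0 and 1.\<close>

lemma mean_qsol:
  assumes e: "nonsq (- e)" and "p dvd l" "n \<le> A" "n \<le> B"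
  shows "\<bar>mean2 A B (\<lambda>r1 r0. of_bool (\<not> qsol n (l ^ 2) e r1 r0)) - gam\<bar> \<le> p ^ 2 * (1 / p ^ 2) ^ n"
  using assms(2-)
proof (induction n arbitrary: l A B rule: induct_nat_012)
  case 0
  have "(1::real) \<le> real_of_int p ^ 2" using real_p_gt2 by (intro one_le_power) simp
  then have "\<bar>0 - gam\<bar> \<le> real_of_int p ^ 2" using gam_bounds by simp
  then show ?case by (simp add: qsol_def)
next
  case 1
  have "\<bar>mean2 A B (\<lambda>r1 r0. of_bool (\<not> qsol (Suc 0) (l\<^sup>2) e r1 r0)) - gam\<bar> \<le> 1"
    using mean2_of_bool_bounds[of A B "\<lambda>r1 r0. \<not> qsol (Suc 0) (l\<^sup>2) e r1 r0"] gam_bounds by linarith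
  then show ?case using real_p_gt2 by simp
next
  case (ge2 n)
  let ?g = "mean2 (A - 2) (B - 2) (\<lambda>r1 r0. of_bool (\<not> qsol n ((p * l) ^ 2) e r1 r0))"
  have "(of_bool (\<not> qsol (Suc (Suc n)) (l ^ 2) e r1 r0) :: real) =
    of_bool (\<not> (p dvd r1 \<and> p dvd r0) \<and> \<not> qsol 1 0 e r1 r0) +
    of_bool (p dvd r1 \<and> p dvd r0 \<and> \<not> qsol (Suc (Suc n)) (l ^ 2) e r1 r0)" for r1 r0
    using qsol_unit[OF e ge2.prems(1), of r1 r0 "Suc n"] by auto
  then have "mean2 A B (\<lambda>r1 r0. of_bool (\<not> qsol (Suc (Suc n)) (l ^ 2) e r1 r0)) =
     (p ^ 2 - 1) / (2 * p ^ 2) + (1 / p ^ 2 - 1 / p ^ 4 + ?g / p ^ 4)"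
    using mean_qsol_unit[OF e, of A B] mean_qsol_step[OF e ge2.prems(2,3), of l] ge2.prems
    by (simp only: mean2_add)
  then have "mean2 A B (\<lambda>r1 r0. of_bool (\<not> qsol (Suc (Suc n)) (l ^ 2) e r1 r0)) - gam = (?g - gam) / p ^ 4"
    using gam_fixpoint by (simp add: diff_divide_distrib)
  moreover have "\<bar>?g - gam\<bar> \<le> p ^ 2 * (1 / p ^ 2) ^ n"
    using ge2.prems by (intro ge2.IH(1)) auto
  then have "\<bar>?g - gam\<bar> / p ^ 4 \<le> (p ^ 2 * (1 / p ^ 2) ^ n) / p ^ 4"
    by (intro divide_right_mono) auto
  moreover have "(p ^ 2 * (1 / p ^ 2) ^ n) / p ^ 4 = real_of_int p ^ 2 * (1 / p ^ 2) ^ Suc (Suc n)"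
    by (simp add: field_simps eval_nat_numeral)
  ultimately show ?case by (simp add: abs_divide)
qed

text \<open>The formula of \<open>gam\<close> for a residue field with \<open>p\<close> instead of
  p^2 elements, as in a ramified quadratic extension.\<close>

definition eta :: real where "eta = (p + 2) / (2 * (p + 1))"

lemma mean_hsol_unit:
  assumes "\<not> p dvd u" "1 \<le> B"
  shows "mean2 A B (\<lambda>r1 r0. of_bool (\<not> p dvd r0 \<and> \<not> hsol (Suc n) u v k l r1 r0)) = (p - 1) / (2 * p)"
proof -
  have "\<not> p dvd r0 \<and> \<not> hsol (Suc n) u v k l r1 r0 \<longleftrightarrow> nonsq (u * r0 + 0)" for r1 r0
    using hsol_unit[OF assms(1), of r0 n] nonsq_unit[of "u * r0"] by auto
  then show ?thesis using mean_nonsq_affine[OF assms(2,1), of 0] by (simp only: mean2_def mean_const)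
qed

text \<open>A step uses one digit and has weight exactly p^-2. At level 0 everything is solvable,
  which causes the deficit (1/p^2)^n. The coefficients are general because scaling permutes
  them.\<close>

lemma mean_hsol:
  assumes "\<not> p dvd u" "\<not> p dvd v" "n \<le> A" "n \<le> B"
  shows "mean2 A B (\<lambda>r1 r0. of_bool (\<not> hsol n u v k l r1 r0)) = eta * (1 - (1 / p ^ 2) ^ n)"
  using assms
proof (induction n arbitrary: u v k l A B)
  case (Suc n)
  \<comment> \<open>Sorted by valuation: r0 a unit; \<open>p\<close> dividing r0 but not r1, never
    solvable by \<open>hsol_dvd\<close>; \<open>p\<close> dividing both, a scaled copy.\<close>
  have "(of_bool (\<not> hsol (Suc n) u v k l r1 r0) :: real) =
    of_bool (\<not> p dvd r0 \<and> \<not> hsol (Suc n) u v k l r1 r0) +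
    ((if p dvd r0 then 1 else 0) - (if p dvd r1 \<and> p dvd r0 then 1 else 0) +
    (if p dvd r1 \<and> p dvd r0 then of_bool (\<not> hsol (Suc n) u v k l r1 r0) else 0))" for r1 r0
    using hsol_dvd[OF Suc.prems(1), of r0 n v k l r1] by (auto simp: of_bool_def)
  from mean2_cong[OF this]
  have "mean2 A B (\<lambda>r1 r0. of_bool (\<not> hsol (Suc n) u v k l r1 r0)) =
    mean2 A B (\<lambda>r1 r0. of_bool (\<not> p dvd r0 \<and> \<not> hsol (Suc n) u v k l r1 r0)) +
    (mean2 A B (\<lambda>r1 r0. if p dvd r0 then 1 else 0) - mean2 A B (\<lambda>r1 r0. if p dvd r1 \<and> p dvd r0 then 1 else 0) +
     mean2 A B (\<lambda>r1 r0. if p dvd r1 \<and> p dvd r0 then of_bool (\<not> hsol (Suc n) u v k l r1 r0) else 0))"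
    unfolding mean2_add mean2_diff .
  moreover have "mean2 A B (\<lambda>r1 r0. if p dvd r0 then 1 else 0) = 1 / p"
    using mean2_dvd[of 0 A 1 B "\<lambda>_ _. 1"] Suc.prems by simp
  moreover have "mean2 A B (\<lambda>r1 r0. if p dvd r1 \<and> p dvd r0 then 1 else 0) = 1 / p ^ 2"
    using mean2_dvd[of 1 A 1 B "\<lambda>_ _. 1"] Suc.prems by (simp add: power2_eq_square)
  moreover have "mean2 A B (\<lambda>r1 r0. if p dvd r1 \<and> p dvd r0 then of_bool (\<not> hsol (Suc n) u v k l r1 r0) else 0) =
      mean2 (A - 1) (B - 1) (\<lambda>r1 r0. of_bool (\<not> hsol n v u l (p ^ 2 * k) r1 r0)) / p ^ 2"
    using mean2_dvd[of 1 A 1 B "\<lambda>r1 r0. of_bool (\<not> hsol (Suc n) u v k l r1 r0)"] Suc.prems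
    by (simp add: power2_eq_square hsol_scale)
  moreover have "mean2 A B (\<lambda>r1 r0. of_bool (\<not> p dvd r0 \<and> \<not> hsol (Suc n) u v k l r1 r0)) = (p - 1) / (2 * p)"
    using Suc.prems by (intro mean_hsol_unit) auto
  ultimately have "mean2 A B (\<lambda>r1 r0. of_bool (\<not> hsol (Suc n) u v k l r1 r0)) =
    (p - 1) / (2 * p) + (1 / p - 1 / p ^ 2 +
      mean2 (A - 1) (B - 1) (\<lambda>r1 r0. of_bool (\<not> hsol n v u l (p ^ 2 * k) r1 r0)) / p ^ 2)"
    by (simp only:)
  also have "mean2 (A - 1) (B - 1) (\<lambda>r1 r0. of_bool (\<not> hsol n v u l (p ^ 2 * k) r1 r0)) = eta * (1 - (1 / p ^ 2) ^ n)"
    using Suc.prems by (intro Suc.IH) auto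
  also have "(p - 1) / (2 * p) + (1 / p - 1 / p ^ 2 + eta * (1 - (1 / p ^ 2) ^ n) / p ^ 2) =
      eta * (1 - (1 / p ^ 2) ^ Suc n)"
  proof -
    have "(p - 1) / (2 * p) + (1 / p - 1 / p ^ 2) = eta * (1 - 1 / p ^ 2)"
      using real_p_gt2 unfolding eta_def
      by (simp add: divide_simps) (simp add: algebra_simps power2_eq_square)
    then have "(p - 1) / (2 * p) + (1 / p - 1 / p ^ 2 + eta * (1 - (1 / p ^ 2) ^ n) / p ^ 2) =
      eta * (1 - 1 / p ^ 2) + eta * (1 - (1 / p ^ 2) ^ n) / p ^ 2" by simp
    also have "\<dots> = eta * (1 - (1 / p ^ 2) ^ Suc n)"
      by (simp add: right_diff_distrib diff_divide_distrib)
    finally show ?thesis .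
  qed
  finally show ?case .
qed simp

subsection \<open>Densities of the residue classes of quartics\<close>

text \<open>With a = 2e the conditions read b = 0, c = e^2 and -e a non-square modulo
  \<open>p\<close>, since -2a is 4 times -e: the quartic is the square of the irreducible X^2 +
  e.\<close>

definition square_class :: "int \<Rightarrow> int \<Rightarrow> int \<Rightarrow> bool" where
  "square_class a b c \<longleftrightarrow> p dvd b \<and> p dvd a ^ 2 - 4 * c \<and> nonsq (- 2 * a)"

text \<open>The Newton polygon lies on or above the line from (0, 2) to (4, 0), and the point of a
  or that of c is on this line.\<close>

definition half_slope_class :: "int \<Rightarrow> int \<Rightarrow> int \<Rightarrow> bool" where
  "half_slope_class a b c \<longleftrightarrow> p dvd a \<and> p ^ 2 dvd b \<and> p ^ 2 dvd c \<and> \<not> (p ^ 2 dvd a \<and> p ^ 3 dvd c)"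

lemma red_periodic: "periodic3 n (\<lambda>a b c. of_bool (\<not> red n a b c))"
  unfolding periodic3_def using red_cong by auto

lemma dvd_cong_level:
  "m \<le> n \<Longrightarrow> p ^ n dvd x - y \<Longrightarrow> p ^ m dvd x \<longleftrightarrow> p ^ m dvd y"
  using dvd_cong power_dvd_mono by blast

lemma square_class_coords:
  "square_class (2 * e) (- r1) (e ^ 2 - r0) \<longleftrightarrow> p dvd r1 \<and> p dvd r0 \<and> nonsq (- e)"
proof -
  have "(2 * e) ^ 2 - 4 * (e ^ 2 - r0) = 4 * r0" by (simp add: ring_expand)
  moreover have "nonsq (- 2 * (2 * e)) \<longleftrightarrow> nonsq (- e)"
    using nonsq_mult_square[of 2 "- e"] by simp
  ultimately show ?thesis unfolding square_class_def by simp
qed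

lemma half_slope_class_coords:
  "half_slope_class (2 * e) (- r1) (e ^ 2 - r0) \<longleftrightarrow>
     p dvd e \<and> p ^ 2 dvd r1 \<and> p ^ 2 dvd r0 \<and> \<not> (p ^ 2 dvd e \<and> p ^ 3 dvd r0)"
proof -
  have 2: "p ^ n dvd 2 * e \<longleftrightarrow> p ^ n dvd e" for n by (rule dvd_unit_cancel) simp
  have 3: "p ^ 2 dvd e ^ 2 - r0 \<longleftrightarrow> p ^ 2 dvd r0" if "p dvd e"
  proof -
    have "p ^ 2 dvd (e ^ 2 - r0) - (- r0)" using dvd_power_same[OF that, of 2] by simp
    from dvd_cong[OF this] show ?thesis by simp
  qed
  have 4: "p ^ 3 dvd e ^ 2 - r0 \<longleftrightarrow> p ^ 3 dvd r0" if "p ^ 2 dvd e"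
  proof -
    have "p ^ 4 dvd e ^ 2" using dvd_power_same[OF that, of 2] by (simp flip: power_mult)
    then have "p ^ 3 dvd (e ^ 2 - r0) - (- r0)" using power_dvd_mono[of 3 4] by simp
    from dvd_cong[OF this] show ?thesis by simp
  qed
  show ?thesis using 2[of 1] 2[of 2] 3 4 unfolding half_slope_class_def by auto
qed

lemma square_class_cong:
  assumes "p dvd a - a'" "p dvd b - b'" "p dvd c - c'"
  shows "square_class a b c \<longleftrightarrow> square_class a' b' c'"
proof -
  have "(a ^ 2 - 4 * c) - (a' ^ 2 - 4 * c') = (a - a') * (a + a') - 4 * (c - c')"
    by (simp add: ring_expand)
  then have "p dvd (a ^ 2 - 4 * c) - (a' ^ 2 - 4 * c')" using assms by (metis dvd_diff dvd_mult dvd_mult2)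
  moreover have "- 2 * a - (- 2 * a') = (- 2) * (a - a')" by simp
  then have "p dvd - 2 * a - (- 2 * a')" using assms by (metis dvd_mult)
  ultimately show ?thesis
    unfolding square_class_def using dvd_cong[OF assms(2)] dvd_cong nonsq_cong by blast
qed

lemma square_class_periodic:
  assumes "1 \<le> n"
  shows "periodic3 n (\<lambda>a b c. of_bool (square_class a b c \<and> \<not> red n a b c))"
  unfolding periodic3_def
proof (intro allI impI)
  fix a a' b b' c c'
  assume *: "p ^ n dvd a - a'" "p ^ n dvd b - b'" "p ^ n dvd c - c'"
  then have "p dvd a - a'" "p dvd b - b'" "p dvd c - c'" using power_dvd_mono[OF assms] by auto
  from square_class_cong[OF this] red_cong[OF *]
  show "(of_bool (square_class a b c \<and> \<not> red n a b c) :: real) = of_bool (square_class a' b' c' \<and> \<not> red n a' b' c')"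
    by simp
qed

lemma half_slope_class_periodic:
  assumes "3 \<le> n"
  shows "periodic3 n (\<lambda>a b c. of_bool (half_slope_class a b c \<and> \<not> red n a b c))"
  unfolding periodic3_def
proof (intro allI impI)
  fix a a' b b' c c'
  assume *: "p ^ n dvd a - a'" "p ^ n dvd b - b'" "p ^ n dvd c - c'"
  have "p dvd a \<longleftrightarrow> p dvd a'" using dvd_cong_level[OF _ *(1), of 1] assms by simp
  moreover have "p ^ 2 dvd a \<longleftrightarrow> p ^ 2 dvd a'" "p ^ 2 dvd b \<longleftrightarrow> p ^ 2 dvd b'" "p ^ 2 dvd c \<longleftrightarrow> p ^ 2 dvd c'"
    "p ^ 3 dvd c \<longleftrightarrow> p ^ 3 dvd c'"
    using assms * by (intro dvd_cong_level[of _ n]; simp)+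
  ultimately have "half_slope_class a b c \<longleftrightarrow> half_slope_class a' b' c'"
    unfolding half_slope_class_def by blast
  then show "(of_bool (half_slope_class a b c \<and> \<not> red n a b c) :: real) = of_bool (half_slope_class a' b' c' \<and> \<not> red n a' b' c')"
    using red_cong[OF *] by simp
qed

lemma mean_abs_le: "(\<And>x. \<bar>f x\<bar> \<le> c) \<Longrightarrow> \<bar>mean N f\<bar> \<le> c"
  using mean_mono[of f "\<lambda>_. c" N] mean_mono[of "\<lambda>_. - c" f N] by (simp add: abs_le_iff minus_le_iff)

text \<open>The first factor is the probability that -e is a non-square; the second is the
  right-hand side of \<open>gam_fixpoint\<close> without its unit term, as r must be divisible by
  \<open>p\<close>.\<close>

lemma mean_square_class:
  "\<bar>mean3 (n + 2) (n + 2) (n + 2) (\<lambda>a b c. of_bool (square_class a b c \<and> \<not> red (n + 2) a b c))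
     - (p - 1) / (2 * p) * (1 / p ^ 2 - 1 / p ^ 4 + gam / p ^ 4)\<bar> \<le> (1 / p ^ 2) ^ n"
proof -
  let ?N = "n + 2"
  define \<beta> where "\<beta> e = mean2 ?N ?N (\<lambda>r1 r0. of_bool (p dvd r1 \<and> p dvd r0 \<and> \<not> qsol ?N (1 ^ 2) e r1 r0))" for e
  define \<beta>0 where "\<beta>0 = 1 / p ^ 2 - 1 / p ^ 4 + gam / p ^ 4"
  have eq: "(of_bool (square_class (2 * e) (- r1) (e ^ 2 - r0) \<and> \<not> red ?N (2 * e) (- r1) (e ^ 2 - r0)) :: real) =
     (if nonsq (- e) then of_bool (p dvd r1 \<and> p dvd r0 \<and> \<not> qsol ?N (1 ^ 2) e r1 r0) else 0)" for e r1 r0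
    using no_root_square_case[of e r1 r0 ?N] by (auto simp: square_class_coords)
  have N: "1 \<le> ?N" by simp
  have "mean3 ?N ?N ?N (\<lambda>a b c. of_bool (square_class a b c \<and> \<not> red ?N a b c)) =
     mean ?N (\<lambda>e. of_bool (nonsq (- e)) * \<beta> e)"
    unfolding mean3_coords[OF square_class_periodic[OF N]] eq
    unfolding mean3_def \<beta>_def by (intro mean_cong) auto
  moreover have "mean ?N (\<lambda>e. of_bool (nonsq (- e))) = (p - 1) / (2 * p)"
    using mean_nonsq_affine[of ?N "- 1" 0] by simp
  then have "mean ?N (\<lambda>e. of_bool (nonsq (- e)) * \<beta>0) = (p - 1) / (2 * p) * \<beta>0"
    by (simp only: mean_multc)
  moreover have "\<bar>mean ?N (\<lambda>e. of_bool (nonsq (- e)) * \<beta> e - of_bool (nonsq (- e)) * \<beta>0)\<bar> \<le> (1 / p ^ 2) ^ n"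
  proof (rule mean_abs_le)
    fix e
    show "\<bar>of_bool (nonsq (- e)) * \<beta> e - of_bool (nonsq (- e)) * \<beta>0\<bar> \<le> (1 / p ^ 2) ^ n"
    proof (cases "nonsq (- e)")
      case True
      let ?g = "mean2 n n (\<lambda>r1 r0. of_bool (\<not> qsol n ((p * 1) ^ 2) e r1 r0))"
      have b: "\<beta> e = 1 / p ^ 2 - 1 / p ^ 4 + ?g / p ^ 4"
        using mean_qsol_step[OF True, of n ?N ?N 1] unfolding \<beta>_def by simp
      have "\<bar>?g - gam\<bar> \<le> p ^ 2 * (1 / p ^ 2) ^ n" by (rule mean_qsol[OF True]) simp_all
      also have "\<dots> \<le> p ^ 4 * (1 / p ^ 2) ^ n"
        using real_p_gt2 by (intro mult_right_mono power_increasing) auto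
      finally have "\<bar>?g - gam\<bar> / p ^ 4 \<le> (1 / p ^ 2) ^ n" by (simp add: field_simps)
      moreover have "\<beta> e - \<beta>0 = (?g - gam) / p ^ 4" by (simp add: b \<beta>0_def diff_divide_distrib)
      ultimately show ?thesis using True by (simp add: abs_divide)
    qed simp
  qed
  ultimately show ?thesis by (simp only: mean_diff \<beta>0_def)
qed

text \<open>The weight p^-5 comes from p | e, p^2 | r1, p^2 | r0. After scaling, a unit e admits all
  r and gives \<open>eta\<close>; if p | e, only units r0 stay in the class, and half of them are
  non-squares.\<close>

lemma mean_half_slope_class:
  "mean3 (n + 3) (n + 3) (n + 3) (\<lambda>a b c. of_bool (half_slope_class a b c \<and> \<not> red (n + 3) a b c)) =
    ((1 - 1 / p) * (eta * (1 - (1 / p ^ 2) ^ Suc n)) + (1 / p) * ((p - 1) / (2 * p))) / p ^ 5"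
proof -
  let ?N = "n + 3"
  let ?h = "\<lambda>e r1 r0. hsol (Suc n) 1 (- 4 * e) 0 (- 4) r1 r0"
  let ?f = "\<lambda>e r1 r0. of_bool (\<not> (p ^ 2 dvd e \<and> p ^ 3 dvd r0) \<and> \<not> red ?N (2 * e) (- r1) (e ^ 2 - r0)) :: real"
  have eq: "(of_bool (half_slope_class (2 * e) (- r1) (e ^ 2 - r0) \<and> \<not> red ?N (2 * e) (- r1) (e ^ 2 - r0)) :: real) =
     (if p ^ 1 dvd e \<and> p ^ 2 dvd r1 \<and> p ^ 2 dvd r0 then ?f e r1 r0 else 0)" for e r1 r0
    by (auto simp: half_slope_class_coords)
  have f: "?f (p ^ 1 * e) (p ^ 2 * r1) (p ^ 2 * r0) = of_bool (\<not> (p dvd e \<and> p dvd r0) \<and> \<not> ?h e r1 r0)" for e r1 r0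
  proof -
    have "p ^ 2 dvd p * e \<longleftrightarrow> p dvd e" "p ^ 3 dvd p ^ 2 * r0 \<longleftrightarrow> p dvd r0"
      by (simp_all add: power2_eq_square power3_eq_cube)
    then show ?thesis using red_slope_half[of e r0 n r1] by (auto simp: numeral_3_eq_3)
  qed
  have N: "3 \<le> ?N" by simp
  have "mean3 ?N ?N ?N (\<lambda>a b c. of_bool (half_slope_class a b c \<and> \<not> red ?N a b c)) =
    mean3 (?N - 1) (?N - 2) (?N - 2) (\<lambda>e r1 r0. ?f (p ^ 1 * e) (p ^ 2 * r1) (p ^ 2 * r0)) / p ^ (1 + 2 + 2)"
    unfolding mean3_coords[OF half_slope_class_periodic[OF N]] eq
    by (rule mean3_dvd) auto
  also have "\<dots> = mean3 (n + 2) (Suc n) (Suc n) (\<lambda>e r1 r0. of_bool (\<not> (p dvd e \<and> p dvd r0) \<and> \<not> ?h e r1 r0)) / p ^ 5"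
    unfolding f by (simp add: eval_nat_numeral)
  also have "mean3 (n + 2) (Suc n) (Suc n) (\<lambda>e r1 r0. of_bool (\<not> (p dvd e \<and> p dvd r0) \<and> \<not> ?h e r1 r0)) =
    mean (n + 2) (\<lambda>e. (1 - of_bool (p ^ 1 dvd e)) * (eta * (1 - (1 / p ^ 2) ^ Suc n)) + of_bool (p ^ 1 dvd e) * ((p - 1) / (2 * p)))"
    unfolding mean3_def
  proof (rule mean_cong)
    fix e
    show "mean2 (Suc n) (Suc n) (\<lambda>r1 r0. of_bool (\<not> (p dvd e \<and> p dvd r0) \<and> \<not> ?h e r1 r0)) =
      (1 - of_bool (p ^ 1 dvd e)) * (eta * (1 - (1 / p ^ 2) ^ Suc n)) + of_bool (p ^ 1 dvd e) * ((p - 1) / (2 * p))"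
    proof (cases "p dvd e")
      case True
      then show ?thesis using mean_hsol_unit[of 1 "Suc n" "Suc n" n "- 4 * e" 0 "- 4"] by simp
    next
      case False
      then have "\<not> p dvd - 4 * e" by simp
      then show ?thesis using False mean_hsol[of 1 "- 4 * e" "Suc n" "Suc n" "Suc n" 0 "- 4"] by simp
    qed
  qed
  also have "\<dots> = (1 - 1 / p ^ 1) * (eta * (1 - (1 / p ^ 2) ^ Suc n)) + (1 / p ^ 1) * ((p - 1) / (2 * p))"
    unfolding mean_add mean_multc mean_diff mean_const
    using mean_indicator_dvd[of 1 "n + 2"] by simp
  finally show ?thesis by simp
qed

lemma mean_exact_valuation:
  assumes "i \<le> N" "j \<le> N" "Suc k \<le> N"
  shows "mean3 N N N (\<lambda>a b c. of_bool (p ^ i dvd a \<and> p ^ j dvd b \<and> p ^ k dvd c \<and> \<not> p ^ Suc k dvd c)) =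
    (1 - 1 / p) / p ^ (i + j + k)"
proof -
  have eq: "(of_bool (p ^ i dvd a \<and> p ^ j dvd b \<and> p ^ k dvd c \<and> \<not> p ^ Suc k dvd c) :: real) =
    (if p ^ i dvd a \<and> p ^ j dvd b \<and> p ^ k dvd c then 1 - of_bool (p ^ Suc k dvd c) else 0)" for a b c
    by auto
  have "mean3 N N N (\<lambda>a b c. of_bool (p ^ i dvd a \<and> p ^ j dvd b \<and> p ^ k dvd c \<and> \<not> p ^ Suc k dvd c)) =
    mean3 (N - i) (N - j) (N - k) (\<lambda>a b c. 1 - of_bool (p ^ Suc k dvd p ^ k * c)) / p ^ (i + j + k)"
    unfolding eq using assms by (intro mean3_dvd) auto
  also have "mean3 (N - i) (N - j) (N - k) (\<lambda>a b c. 1 - of_bool (p ^ Suc k dvd p ^ k * c)) = 1 - 1 / p"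
    using mean_indicator_dvd[of 1 "N - k"] assms by (simp add: mean3_def mean2_def mean_diff)
  finally show ?thesis .
qed

section \<open>Monic quartics with a cubic term\<close>

definition full_root :: "nat \<Rightarrow> int \<Rightarrow> int \<Rightarrow> int \<Rightarrow> int \<Rightarrow> bool" where
  "full_root n c3 c2 c1 c0 \<longleftrightarrow> (\<exists>x. p ^ n dvd x ^ 4 + c3 * x ^ 3 + c2 * x ^ 2 + c1 * x + c0)"

definition full_quad :: "nat \<Rightarrow> int \<Rightarrow> int \<Rightarrow> int \<Rightarrow> int \<Rightarrow> bool" where
  "full_quad n c3 c2 c1 c0 \<longleftrightarrow> (\<exists>s t u v. p ^ n dvd s + u - c3 \<and> p ^ n dvd t + v + s * u - c2 \<and>
     p ^ n dvd s * v + t * u - c1 \<and> p ^ n dvd t * v - c0)"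

definition full_red :: "nat \<Rightarrow> int \<Rightarrow> int \<Rightarrow> int \<Rightarrow> int \<Rightarrow> bool" where
  "full_red n c3 c2 c1 c0 \<longleftrightarrow> full_root n c3 c2 c1 c0 \<or> full_quad n c3 c2 c1 c0"

definition mean4 :: "nat \<Rightarrow> (int \<Rightarrow> int \<Rightarrow> int \<Rightarrow> int \<Rightarrow> real) \<Rightarrow> real" where
  "mean4 n f = mean n (\<lambda>c3. mean3 n n n (f c3))"

lemma full_root_mono: "m \<le> n \<Longrightarrow> full_root n c3 c2 c1 c0 \<Longrightarrow> full_root m c3 c2 c1 c0"
  unfolding full_root_def using power_dvd_mono by blast

lemma full_quad_mono: "m \<le> n \<Longrightarrow> full_quad n c3 c2 c1 c0 \<Longrightarrow> full_quad m c3 c2 c1 c0"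
  unfolding full_quad_def using power_dvd_mono by blast

lemma full_root_cong:
  assumes "p ^ n dvd c3 - d3" "p ^ n dvd c2 - d2" "p ^ n dvd c1 - d1" "p ^ n dvd c0 - d0"
  shows "full_root n c3 c2 c1 c0 \<longleftrightarrow> full_root n d3 d2 d1 d0"
proof -
  have "p ^ n dvd x ^ 4 + c3 * x ^ 3 + c2 * x ^ 2 + c1 * x + c0 \<longleftrightarrow>
    p ^ n dvd x ^ 4 + d3 * x ^ 3 + d2 * x ^ 2 + d1 * x + d0" for x
  proof (rule dvd_cong)
    have "x ^ 4 + c3 * x ^ 3 + c2 * x ^ 2 + c1 * x + c0 - (x ^ 4 + d3 * x ^ 3 + d2 * x ^ 2 + d1 * x + d0) =
      (c3 - d3) * x ^ 3 + (c2 - d2) * x ^ 2 + (c1 - d1) * x + (c0 - d0)" by (simp add: ring_expand)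
    then show "p ^ n dvd x ^ 4 + c3 * x ^ 3 + c2 * x ^ 2 + c1 * x + c0 - (x ^ 4 + d3 * x ^ 3 + d2 * x ^ 2 + d1 * x + d0)"
      using assms by (metis dvd_add dvd_mult2)
  qed
  then show ?thesis by (simp add: full_root_def)
qed

lemma full_quad_cong:
  assumes "p ^ n dvd c3 - d3" "p ^ n dvd c2 - d2" "p ^ n dvd c1 - d1" "p ^ n dvd c0 - d0"
  shows "full_quad n c3 c2 c1 c0 \<longleftrightarrow> full_quad n d3 d2 d1 d0"
proof -
  have "p ^ n dvd z - d \<longleftrightarrow> p ^ n dvd z - d'" if "p ^ n dvd d - d'" for z d d'
    using that by (intro dvd_cong) (simp add: dvd_diff_commute)
  from this[OF assms(1)] this[OF assms(2)] this[OF assms(3)] this[OF assms(4)] show ?thesis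
    by (simp add: full_quad_def)
qed

lemma full_red_cong:
  assumes "p ^ n dvd c3 - d3" "p ^ n dvd c2 - d2" "p ^ n dvd c1 - d1" "p ^ n dvd c0 - d0"
  shows "full_red n c3 c2 c1 c0 \<longleftrightarrow> full_red n d3 d2 d1 d0"
  using full_root_cong[OF assms] full_quad_cong[OF assms] by (simp add: full_red_def)

subsection \<open>Removing the cubic term\<close>

text \<open>In terms of x + h the cubic term 4h disappears. Writing it as 4h is no restriction
  because 4 is a unit.\<close>

lemma full_root_depress:
  "full_root n (4 * h) c2 c1 c0 \<longleftrightarrow>
   has_root n (c2 - 6 * h ^ 2) (c1 - 2 * h * c2 + 8 * h ^ 3) (c0 - h * c1 + h ^ 2 * c2 - 3 * h ^ 4)"
proof -
  have "x ^ 4 + (4 * h) * x ^ 3 + c2 * x ^ 2 + c1 * x + c0 =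
    (x + h) ^ 4 + (c2 - 6 * h ^ 2) * (x + h) ^ 2 + (c1 - 2 * h * c2 + 8 * h ^ 3) * (x + h)
      + (c0 - h * c1 + h ^ 2 * c2 - 3 * h ^ 4)" for x
    by (simp add: ring_expand)
  then show ?thesis unfolding full_root_def has_root_def by (metis diff_add_cancel)
qed

lemma full_quad_depress:
  "full_quad n (4 * h) c2 c1 c0 \<longleftrightarrow>
   has_quad n (c2 - 6 * h ^ 2) (c1 - 2 * h * c2 + 8 * h ^ 3) (c0 - h * c1 + h ^ 2 * c2 - 3 * h ^ 4)"
  (is "_ \<longleftrightarrow> has_quad n ?a ?b ?c")
proof
  assume "full_quad n (4 * h) c2 c1 c0"
  then obtain s t u v where 1: "p ^ n dvd s + u - 4 * h" "p ^ n dvd t + v + s * u - c2"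
    "p ^ n dvd s * v + t * u - c1" "p ^ n dvd t * v - c0" unfolding full_quad_def by blast
  \<comment> \<open>\<open>u\<close> equals 4h - s only modulo \<open>p ^ n\<close>; with
    \<open>w\<close> the linear coefficients add up exactly, so the remaining relations become
    integer identities.\<close>
  define w where "w = 4 * h - s"
  have "t + v + s * w - c2 = (t + v + s * u - c2) - s * (s + u - 4 * h)"
    "s * v + t * w - c1 = (s * v + t * u - c1) - t * (s + u - 4 * h)"
    by (simp_all add: w_def ring_expand)
  then have 2: "p ^ n dvd t + v + s * w - c2" "p ^ n dvd s * v + t * w - c1"
    using 1 by (metis dvd_diff dvd_mult)+
  define S T U where "S = s - 2 * h" and "T = h ^ 2 - s * h + t" and "U = h ^ 2 - w * h + v"
  have "T + U - S ^ 2 - ?a = t + v + s * w - c2"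
    "S * (U - T) - ?b = (s * v + t * w - c1) - 2 * h * (t + v + s * w - c2)"
    "T * U - ?c = (t * v - c0) - h * (s * v + t * w - c1) + h ^ 2 * (t + v + s * w - c2)"
    by (simp_all add: S_def T_def U_def w_def ring_expand)
  then have "p ^ n dvd T + U - S ^ 2 - ?a" "p ^ n dvd S * (U - T) - ?b" "p ^ n dvd T * U - ?c"
    using 1 2 by (metis dvd_add dvd_diff dvd_mult)+
  then show "has_quad n ?a ?b ?c" unfolding has_quad_def by blast
next
  assume "has_quad n ?a ?b ?c"
  then obtain S T U where 1: "p ^ n dvd T + U - S ^ 2 - ?a" "p ^ n dvd S * (U - T) - ?b" "p ^ n dvd T * U - ?c"
    unfolding has_quad_def by blast
  define s w t v where "s = S + 2 * h" and "w = 2 * h - S" and "t = T + h ^ 2 + S * h" and "v = U + h ^ 2 - S * h"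
  have "s + w - 4 * h = 0"
    "t + v + s * w - c2 = T + U - S ^ 2 - ?a"
    "s * v + t * w - c1 = (S * (U - T) - ?b) + 2 * h * (T + U - S ^ 2 - ?a)"
    "t * v - c0 = (T * U - ?c) + h * (S * (U - T) - ?b) + h ^ 2 * (T + U - S ^ 2 - ?a)"
    by (simp_all add: s_def w_def t_def v_def ring_expand)
  then have "p ^ n dvd s + w - 4 * h" "p ^ n dvd t + v + s * w - c2" "p ^ n dvd s * v + t * w - c1" "p ^ n dvd t * v - c0"
    using 1 by (metis dvd_0_right dvd_add dvd_mult)+
  then show "full_quad n (4 * h) c2 c1 c0" unfolding full_quad_def by blast
qed

lemma full_red_depress:
  "full_red n (4 * h) c2 c1 c0 \<longleftrightarrow>
   red n (c2 - 6 * h ^ 2) (c1 - 2 * h * c2 + 8 * h ^ 3) (c0 - h * c1 + h ^ 2 * c2 - 3 * h ^ 4)"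
  by (simp add: full_red_def red_def full_root_depress full_quad_depress)

lemma mean3_shift:
  "periodic3 n f \<Longrightarrow> mean3 n n n (\<lambda>x y z. f (x + \<alpha>) (y + \<beta> x) (z + \<gamma> x y)) = mean3 n n n f"
  using mean3_substitute[of n f n "\<lambda>x. x + \<alpha>" n "\<lambda>x y. y + \<beta> x" n "\<lambda>x y z. z + \<gamma> x y"] mean_translate
  by blast

text \<open>For fixed h, depressing the quartic is a triangular translation of (c2, c1, c0), so the
  inner average does not depend on h.\<close>

lemma mean4_full_red:
  "mean4 n (\<lambda>c3 c2 c1 c0. of_bool (\<not> full_red n c3 c2 c1 c0)) = mean3 n n n (\<lambda>a b c. of_bool (\<not> red n a b c))"
proof -
  let ?g = "\<lambda>c3. mean3 n n n (\<lambda>c2 c1 c0. of_bool (\<not> full_red n c3 c2 c1 c0))"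
  let ?f = "\<lambda>a b c. of_bool (\<not> red n a b c)"
  have "mean n ?g = mean n (\<lambda>h. ?g (4 * h + 0))"
  proof (rule mean_affine[symmetric])
    fix x y assume "p ^ n dvd x - y"
    then have "full_red n x = full_red n y" using full_red_cong by (intro ext) simp
    then show "?g x = ?g y" by simp
  qed simp
  also have "(\<lambda>h. ?g (4 * h + 0)) = (\<lambda>h. mean3 n n n ?f)"
  proof
    fix h
    have "?g (4 * h + 0) = mean3 n n n (\<lambda>c2 c1 c0. ?f (c2 + - 6 * h ^ 2) (c1 + (8 * h ^ 3 - 2 * h * c2))
      (c0 + (h ^ 2 * c2 - h * c1 - 3 * h ^ 4)))"
    proof -
      have e: "c2 + - 6 * h ^ 2 = c2 - 6 * h ^ 2" "c1 + (8 * h ^ 3 - 2 * h * c2) = c1 - 2 * h * c2 + 8 * h ^ 3"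
        "c0 + (h ^ 2 * c2 - h * c1 - 3 * h ^ 4) = c0 - h * c1 + h ^ 2 * c2 - 3 * h ^ 4" for c2 c1 c0 by simp_all
      show ?thesis unfolding e by (simp only: full_red_depress add_0_right)
    qed
    also have "\<dots> = mean3 n n n ?f"
      by (rule mean3_shift[OF red_periodic, of n "- 6 * h ^ 2" "\<lambda>c2. 8 * h ^ 3 - 2 * h * c2"
            "\<lambda>c2 c1. h ^ 2 * c2 - h * c1 - 3 * h ^ 4"])
    finally show "?g (4 * h + 0) = mean3 n n n ?f" .
  qed
  finally show ?thesis by (simp add: mean4_def)
qed

subsection \<open>Irreducible quartics over the residue field\<close>

abbreviation quartic :: "int \<Rightarrow> int \<Rightarrow> int \<Rightarrow> int \<Rightarrow> int \<Rightarrow> int" where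
  "quartic c3 c2 c1 c0 x \<equiv> x ^ 4 + c3 * x ^ 3 + c2 * x ^ 2 + c1 * x + c0"

lemma mean_linear: "mean 1 (\<lambda>c. of_bool (p dvd c + v)) = 1 / p"
proof -
  have "(of_bool (p dvd x) :: real) = of_bool (p dvd y)" if "p ^ 1 dvd x - y" for x y
    using dvd_cong[of p x y] that by simp
  then have "mean 1 (\<lambda>c. of_bool (p dvd 1 * c + v) :: real) = mean 1 (\<lambda>c. of_bool (p dvd c))"
    by (rule mean_affine) simp_all
  then show ?thesis using mean_indicator_dvd[of 1 1] by simp
qed

lemma mean_linear_conj: "mean 1 (\<lambda>c. of_bool (P \<and> p dvd c + v)) = of_bool P / p"
  using mean_linear by (cases P) simp_all

text \<open>Each congruence is solved uniquely by its own variable once the outer ones are fixed, so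
  it costs a factor \<open>p\<close> whatever the offsets are.\<close>

lemma mean4_linear:
  "mean4 1 (\<lambda>c3 c2 c1 c0. of_bool (p dvd c0 + w0 c3 c2 c1)) = 1 / p"
  "mean4 1 (\<lambda>c3 c2 c1 c0. of_bool (p dvd c1 + w1 c3 c2 \<and> p dvd c0 + w0 c3 c2 c1)) = 1 / p / p"
  "mean4 1 (\<lambda>c3 c2 c1 c0. of_bool ((p dvd c2 + w2 c3 \<and> p dvd c1 + w1 c3 c2) \<and> p dvd c0 + w0 c3 c2 c1)) = 1 / p / p / p"
  "mean4 1 (\<lambda>c3 c2 c1 c0. of_bool (((p dvd c3 + w3 \<and> p dvd c2 + w2 c3) \<and> p dvd c1 + w1 c3 c2) \<and> p dvd c0 + w0 c3 c2 c1))
    = 1 / p / p / p / p"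
  unfolding mean4_def mean3_def mean2_def mean_linear_conj mean_linear mean_divc mean_const by simp_all

text \<open>Newton interpolation: each divided difference contains exactly one new coefficient, with
  factor 1, which makes vanishing conditions triangular in the sense of
  \<open>mean4_linear\<close>.\<close>

lemma newton_form:
  "quartic c3 c2 c1 c0 x =
    (c0 + (c1 * x1 + c2 * x1 ^ 2 + c3 * x1 ^ 3 + x1 ^ 4))
    + (x - x1) * (c1 + (c2 * (x1 + x2) + c3 * (x1 ^ 2 + x1 * x2 + x2 ^ 2) + (x1 ^ 3 + x1 ^ 2 * x2 + x1 * x2 ^ 2 + x2 ^ 3)))
    + (x - x1) * (x - x2) * (c2 + (c3 * (x1 + x2 + x3) + (x1 ^ 2 + x2 ^ 2 + x3 ^ 2 + x1 * x2 + x1 * x3 + x2 * x3)))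
    + (x - x1) * (x - x2) * (x - x3) * (c3 + (x1 + x2 + x3 + x4))
    + (x - x1) * (x - x2) * (x - x3) * (x - x4)"
  by (simp add: ring_expand)

text \<open>Up to four distinct roots are independent conditions; a fifth is impossible for a monic
  quartic over a field.\<close>

lemma mean_vanishing:
  assumes S: "S \<subseteq> {0..<p}"
  shows "mean4 1 (\<lambda>c3 c2 c1 c0. of_bool (\<forall>x\<in>S. p dvd quartic c3 c2 c1 c0 x)) =
    (if card S \<le> 4 then 1 / p ^ card S else 0)"
proof -
  have "finite S" using S finite_subset by blast
  then obtain xs where xs: "set xs = S" "distinct xs" using finite_distinct_list by blast
  \<comment> \<open>The value 0 merely pads missing nodes when \<open>S\<close> has fewer than four
    elements; the Newton form holds for arbitrary nodes.\<close>
  define x where "x = (\<lambda>i. if i < length xs then xs ! i else 0)"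
  define D1 where "D1 = (\<lambda>c3 c2 c1 c0. c0 + (c1 * x 0 + c2 * x 0 ^ 2 + c3 * x 0 ^ 3 + x 0 ^ 4))"
  define D2 where "D2 = (\<lambda>c3 c2 c1. c1 + (c2 * (x 0 + x 1) + c3 * (x 0 ^ 2 + x 0 * x 1 + x 1 ^ 2)
      + (x 0 ^ 3 + x 0 ^ 2 * x 1 + x 0 * x 1 ^ 2 + x 1 ^ 3)))"
  define D3 where "D3 = (\<lambda>c3 c2. c2 + (c3 * (x 0 + x 1 + x 2)
      + (x 0 ^ 2 + x 1 ^ 2 + x 2 ^ 2 + x 0 * x 1 + x 0 * x 2 + x 1 * x 2)))"
  define D4 where "D4 = (\<lambda>c3. c3 + (x 0 + x 1 + x 2 + x 3))"
  have newton: "quartic c3 c2 c1 c0 z = D1 c3 c2 c1 c0 + (z - x 0) * D2 c3 c2 c1 + (z - x 0) * (z - x 1) * D3 c3 c2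
      + (z - x 0) * (z - x 1) * (z - x 2) * D4 c3 + (z - x 0) * (z - x 1) * (z - x 2) * (z - x 3)" for c3 c2 c1 c0 z
    unfolding D1_def D2_def D3_def D4_def by (rule newton_form)
  let ?q = "\<lambda>c3 c2 c1 c0 i. p dvd quartic c3 c2 c1 c0 (x i)"
  have all: "(\<forall>z\<in>S. p dvd quartic c3 c2 c1 c0 z) \<longleftrightarrow> (\<forall>i<length xs. ?q c3 c2 c1 c0 i)" for c3 c2 c1 c0
    unfolding xs(1)[symmetric] all_set_conv_all_nth x_def by auto
  have len: "card S = length xs" using xs distinct_card by force
  have nd: "\<not> p dvd x i - x j" if "i < length xs" "j < i" for i j
  proof -
    have "x i \<in> {0..<p}" "x j \<in> {0..<p}" "x i \<noteq> x j"
      using that S xs nth_mem[of i xs] nth_mem[of j xs] by (auto simp: x_def nth_eq_iff_index_eq)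
    then show ?thesis using eq_mod_dvd by blast
  qed
  have q0: "?q c3 c2 c1 c0 0 \<longleftrightarrow> p dvd D1 c3 c2 c1 c0" for c3 c2 c1 c0
    by (subst newton) simp
  have q1: "?q c3 c2 c1 c0 1 \<longleftrightarrow> p dvd D2 c3 c2 c1" if "p dvd D1 c3 c2 c1 c0" "1 < length xs" for c3 c2 c1 c0
    by (subst newton) (use that nd[of 1 0] in \<open>simp add: dvd_add_right_iff\<close>)
  have q2: "?q c3 c2 c1 c0 2 \<longleftrightarrow> p dvd D3 c3 c2"
    if "p dvd D1 c3 c2 c1 c0" "p dvd D2 c3 c2 c1" "2 < length xs" for c3 c2 c1 c0
    by (subst newton) (use that nd[of 2 0] nd[of 2 1] in \<open>simp add: dvd_add_right_iff\<close>)
  have q3: "?q c3 c2 c1 c0 3 \<longleftrightarrow> p dvd D4 c3"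
    if "p dvd D1 c3 c2 c1 c0" "p dvd D2 c3 c2 c1" "p dvd D3 c3 c2" "3 < length xs" for c3 c2 c1 c0
    by (subst newton) (use that nd[of 3 0] nd[of 3 1] nd[of 3 2] in \<open>simp add: dvd_add_right_iff\<close>)
  have q4: "\<not> ?q c3 c2 c1 c0 4"
    if "p dvd D1 c3 c2 c1 c0" "p dvd D2 c3 c2 c1" "p dvd D3 c3 c2" "p dvd D4 c3" "4 < length xs" for c3 c2 c1 c0
    by (subst newton) (use that nd[of 4 0] nd[of 4 1] nd[of 4 2] nd[of 4 3] in \<open>simp add: dvd_add_right_iff\<close>)
  consider "length xs = 0" | "length xs = 1" | "length xs = 2" | "length xs = 3" | "length xs = 4" | "length xs > 4"
    by linarith
  then show ?thesis
  proof cases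
    case 1
    then show ?thesis by (simp add: all len mean4_def)
  next
    case 2
    have "(\<forall>i<length xs. ?q c3 c2 c1 c0 i) \<longleftrightarrow> p dvd D1 c3 c2 c1 c0" for c3 c2 c1 c0
      using 2 q0 by simp
    then show ?thesis unfolding all len 2 by (simp only: D1_def mean4_linear) simp
  next
    case 3
    have "(\<forall>i<length xs. ?q c3 c2 c1 c0 i) \<longleftrightarrow> p dvd D2 c3 c2 c1 \<and> p dvd D1 c3 c2 c1 c0" for c3 c2 c1 c0
    proof -
      have "(\<forall>i<length xs. ?q c3 c2 c1 c0 i) \<longleftrightarrow> ?q c3 c2 c1 c0 0 \<and> ?q c3 c2 c1 c0 1"
        unfolding 3 by (simp only: eval_nat_numeral All_less_Suc BitM.simps One_nat_def) auto
      then show ?thesis using 3 q0 q1 by auto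
    qed
    then show ?thesis unfolding all len 3 by (simp only: D1_def D2_def mean4_linear) (simp add: power2_eq_square)
  next
    case 4
    have "(\<forall>i<length xs. ?q c3 c2 c1 c0 i) \<longleftrightarrow> (p dvd D3 c3 c2 \<and> p dvd D2 c3 c2 c1) \<and> p dvd D1 c3 c2 c1 c0" for c3 c2 c1 c0
    proof -
      have "(\<forall>i<length xs. ?q c3 c2 c1 c0 i) \<longleftrightarrow> ?q c3 c2 c1 c0 0 \<and> ?q c3 c2 c1 c0 1 \<and> ?q c3 c2 c1 c0 2"
        unfolding 4 by (simp only: eval_nat_numeral All_less_Suc BitM.simps One_nat_def) auto
      then show ?thesis using 4 q0 q1 q2 by auto
    qed
    then show ?thesis unfolding all len 4 by (simp only: D1_def D2_def D3_def mean4_linear) (simp add: power3_eq_cube)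
  next
    case 5
    have "(\<forall>i<length xs. ?q c3 c2 c1 c0 i) \<longleftrightarrow>
      ((p dvd D4 c3 \<and> p dvd D3 c3 c2) \<and> p dvd D2 c3 c2 c1) \<and> p dvd D1 c3 c2 c1 c0" for c3 c2 c1 c0
    proof -
      have "(\<forall>i<length xs. ?q c3 c2 c1 c0 i) \<longleftrightarrow>
        ?q c3 c2 c1 c0 0 \<and> ?q c3 c2 c1 c0 1 \<and> ?q c3 c2 c1 c0 2 \<and> ?q c3 c2 c1 c0 3"
        unfolding 5 by (simp only: eval_nat_numeral All_less_Suc BitM.simps One_nat_def) auto
      then show ?thesis using 5 q0 q1 q2 q3 by auto
    qed
    then show ?thesis unfolding all len 5
      by (simp only: D1_def D2_def D3_def D4_def mean4_linear) (simp add: power4_eq_xxxx)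
  next
    case 6
    have "(\<forall>i<length xs. ?q c3 c2 c1 c0 i) \<longleftrightarrow> False" for c3 c2 c1 c0
    proof (intro iffI)
      assume a: "\<forall>i<length xs. ?q c3 c2 c1 c0 i"
      have "?q c3 c2 c1 c0 0" "?q c3 c2 c1 c0 1" "?q c3 c2 c1 c0 2" "?q c3 c2 c1 c0 3" "?q c3 c2 c1 c0 4"
        by (rule a[rule_format], use 6 in linarith)+
      then show False using q0 q1 q2 q3 q4 6 by auto
    qed simp
    then show ?thesis using 6 unfolding all len by (simp only:) (simp add: mean4_def)
  qed
qed

lemma mean4_cmult: "mean4 n (\<lambda>x y z w. c * f x y z w) = c * mean4 n f"
  by (simp add: mean4_def mean3_def mean2_def mean_cmult)

lemma mean4_sum: "mean4 n (\<lambda>x y z w. \<Sum>i\<in>I. f i x y z w) = (\<Sum>i\<in>I. mean4 n (f i))"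
  by (simp add: mean4_def mean3_def mean2_def mean_sum)

text \<open>Inclusion-exclusion over sets of roots: size k contributes (-1)^k (p choose k)/p^k for k
  up to 4, larger sets nothing.\<close>

lemma mean_no_root:
  "mean4 1 (\<lambda>c3 c2 c1 c0. of_bool (\<not> full_root 1 c3 c2 c1 c0)) =
     1 - 1 + (p - 1) / (2 * p) - (p - 1) * (p - 2) / (6 * p ^ 2) + (p - 1) * (p - 2) * (p - 3) / (24 * p ^ 3)"
proof -
  let ?A = "{0..<p}"
  have "(of_bool (\<not> full_root 1 c3 c2 c1 c0) :: real) =
    (\<Sum>S\<in>Pow ?A. (- 1) ^ card S * of_bool (\<forall>x\<in>S. p dvd quartic c3 c2 c1 c0 x))" for c3 c2 c1 c0
  proof -
    let ?P = "\<lambda>x. of_bool (p dvd quartic c3 c2 c1 c0 x) :: real"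
    have fin: "finite S" if "S \<in> Pow ?A" for S using that finite_subset by blast
    have "full_root 1 c3 c2 c1 c0 \<longleftrightarrow> (\<exists>x\<in>?A. p dvd quartic c3 c2 c1 c0 x)"
    proof
      assume "full_root 1 c3 c2 c1 c0"
      then obtain x where x: "p dvd quartic c3 c2 c1 c0 x" by (auto simp: full_root_def)
      have "quartic c3 c2 c1 c0 (x mod p) mod p = quartic c3 c2 c1 c0 x mod p"
        by (intro mod_add_cong mod_mult_cong refl) (simp_all add: power_mod)
      then have "p dvd quartic c3 c2 c1 c0 (x mod p)" using x by (metis dvd_eq_mod_eq_0)
      then show "\<exists>x\<in>?A. p dvd quartic c3 c2 c1 c0 x" by (intro bexI[of _ "x mod p"]) auto
    qed (auto simp: full_root_def)
    then have "(of_bool (\<not> full_root 1 c3 c2 c1 c0) :: real) = (\<Prod>x\<in>?A. 1 - ?P x)"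
      by (cases "\<exists>x\<in>?A. p dvd quartic c3 c2 c1 c0 x") (auto intro!: prod_zero[symmetric] prod.neutral[symmetric])
    also have "\<dots> = (\<Sum>S\<in>Pow ?A. (- 1) ^ card S * (\<Prod>x\<in>S. ?P x))"
      by (simp add: prod_diff_conv_sum)
    also have "\<dots> = (\<Sum>S\<in>Pow ?A. (- 1) ^ card S * of_bool (\<forall>x\<in>S. p dvd quartic c3 c2 c1 c0 x))"
    proof (intro sum.cong refl arg_cong2[of _ _ _ _ "(*)"])
      fix S assume "S \<in> Pow ?A"
      then show "(\<Prod>x\<in>S. ?P x) = of_bool (\<forall>x\<in>S. p dvd quartic c3 c2 c1 c0 x)"
        using fin by (auto intro!: prod_zero prod.neutral)
    qed
    finally show ?thesis .
  qed
  then have "mean4 1 (\<lambda>c3 c2 c1 c0. of_bool (\<not> full_root 1 c3 c2 c1 c0)) =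
    (\<Sum>S\<in>Pow ?A. (- 1) ^ card S * mean4 1 (\<lambda>c3 c2 c1 c0. of_bool (\<forall>x\<in>S. p dvd quartic c3 c2 c1 c0 x)))"
    by (simp only: mean4_sum mean4_cmult)
  also have "\<dots> = (\<Sum>S\<in>Pow ?A. (- 1) ^ card S * (if card S \<le> 4 then 1 / p ^ card S else 0))"
    by (intro sum.cong refl) (simp only: mean_vanishing Pow_iff)
  also have "\<dots> = (\<Sum>k\<le>nat p. of_nat (nat p choose k) * ((- 1) ^ k * (if k \<le> 4 then 1 / p ^ k else 0)))"
    using sum_Pow_card[of ?A "\<lambda>k. (- 1) ^ k * (if k \<le> 4 then 1 / p ^ k else 0)"] by simp
  \<comment> \<open>Summing up to 4 is right for p = 3 as well, since the binomial coefficient then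
    vanishes at 4.\<close>
  also have "\<dots> = (\<Sum>k\<le>4. of_nat (nat p choose k) * ((- 1) ^ k * (1 / p ^ k)))"
    by (intro sum.mono_neutral_cong) (auto simp: binomial_eq_0)
  also have "\<dots> = (\<Sum>k\<le>4. (real_of_int p gchoose k) * ((- 1) ^ k * (1 / real_of_int p ^ k)))"
    using p_gt2 by (simp add: binomial_gbinomial)
  also have "\<dots> = 1 - 1 + (real_of_int p - 1) / (2 * p) - (real_of_int p - 1) * (real_of_int p - 2) / (6 * real_of_int p ^ 2)
      + (real_of_int p - 1) * (real_of_int p - 2) * (real_of_int p - 3) / (24 * real_of_int p ^ 3)"
    by (simp add: eval_nat_numeral gbinomial_prod_rev fact_numeral)
  finally show ?thesis by simp
qed

definition rootless_quadratics :: "(int \<times> int) set" where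
  "rootless_quadratics = {(s, t). s \<in> {0..<p} \<and> t \<in> {0..<p} \<and> (\<forall>x. \<not> p dvd x ^ 2 + s * x + t)}"

lemma finite_rootless_quadratics: "finite rootless_quadratics"
  by (rule finite_subset[of _ "{0..<p} \<times> {0..<p}"]) (auto simp: rootless_quadratics_def)

lemma rootless_quadratic_iff: "(\<forall>x. \<not> p dvd x ^ 2 + s * x + t) \<longleftrightarrow> nonsq (- 4 * t + s ^ 2)"
proof
  assume R: "\<forall>x. \<not> p dvd x ^ 2 + s * x + t"
  show "nonsq (- 4 * t + s ^ 2)" unfolding nonsq_def
  proof (intro allI notI)
    fix y assume y: "p dvd y ^ 2 - (- 4 * t + s ^ 2)"
    obtain x where "p ^ 1 dvd (y - s) - 2 * x" using half_mod .
    then have x: "p dvd (y - s) - 2 * x" by simp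
    have "4 * (x ^ 2 + s * x + t) = (y ^ 2 - (- 4 * t + s ^ 2)) - ((y - s) - 2 * x) * (y + s + 2 * x)"
      by (simp add: ring_expand)
    then have "p dvd 4 * (x ^ 2 + s * x + t)" using x y by (metis dvd_diff dvd_mult2)
    then have "p dvd x ^ 2 + s * x + t" unfolding pdvd_mult by simp
    then show False using R by blast
  qed
next
  assume N: "nonsq (- 4 * t + s ^ 2)"
  show "\<forall>x. \<not> p dvd x ^ 2 + s * x + t"
  proof (intro allI notI)
    fix x assume "p dvd x ^ 2 + s * x + t"
    then have "p dvd 4 * (x ^ 2 + s * x + t)" by (rule dvd_mult)
    moreover have "(2 * x + s) ^ 2 - (- 4 * t + s ^ 2) = 4 * (x ^ 2 + s * x + t)"
      by (simp add: ring_expand)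
    ultimately show False using N by (metis nonsq_def)
  qed
qed

lemma card_rootless_quadratics: "2 * real (card rootless_quadratics) = real_of_int p * (real_of_int p - 1)"
proof -
  have "mean2 1 1 (\<lambda>s t. of_bool (nonsq (- 4 * t + s ^ 2))) = (p - 1) / (2 * p)"
    using mean_nonsq_affine[of 1 "- 4"] by (simp add: mean2_def)
  moreover have "rootless_quadratics = {(s, t). s \<in> {0..<p ^ 1} \<and> t \<in> {0..<p ^ 1} \<and> nonsq (- 4 * t + s ^ 2)}"
    unfolding rootless_quadratics_def rootless_quadratic_iff by simp
  ultimately have "real (card rootless_quadratics) / (real_of_int p * real_of_int p) = (p - 1) / (2 * p)"
    by (simp add: mean2_card)
  then show ?thesis by (simp add: field_simps)
qed

text \<open>The form is the norm of A alpha + B, where alpha is a root of the irreducible polynomial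
  x^2 + sx + t.\<close>

lemma norm_zero_rootless:
  assumes R: "\<forall>x. \<not> p dvd x ^ 2 + s * x + t" and N: "p dvd A ^ 2 * t - A * B * s + B ^ 2"
  shows "p dvd A \<and> p dvd B"
proof -
  have "p dvd A"
  proof (rule ccontr)
    assume A: "\<not> p dvd A"
    obtain v where "p ^ 1 dvd A * v - 1" using inverse_mod_prime_power[OF A] .
    then have v: "p dvd A * v - 1" by simp
    let ?x = "- B * v"
    have "A ^ 2 * (?x ^ 2 + s * ?x + t) =
      (A ^ 2 * t - A * B * s + B ^ 2) + (A * v - 1) * (B ^ 2 * (A * v + 1) - A * B * s)"
      by (simp add: ring_expand)
    then have "p dvd A ^ 2 * (?x ^ 2 + s * ?x + t)" using N v by (metis dvd_add dvd_mult2)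
    then have "p dvd ?x ^ 2 + s * ?x + t" unfolding pdvd_mult using A by simp
    then show False using R by blast
  qed
  moreover from this have "p dvd A ^ 2 * t - A * B * s" by (simp add: dvd_diff)
  then have "p dvd B ^ 2" using N by (metis dvd_add_right_iff)
  ultimately show ?thesis by simp
qed

text \<open>Unique factorization by norms: at a root alpha of X^2 + s'X + t' the other two
  quadratics take the values A1 alpha + B1 and A2 alpha + B2. Their product vanishes, so by
  multiplicativity one of the norms does.\<close>

lemma quadratic_factors_unique:
  assumes R: "\<forall>x. \<not> p dvd x ^ 2 + s' * x + t'"
    and E: "p dvd (s + u) - (s' + u')" "p dvd (t + v + s * u) - (t' + v' + s' * u')"
      "p dvd (s * v + t * u) - (s' * v' + t' * u')" "p dvd t * v - t' * v'"
  shows "(p dvd s - s' \<and> p dvd t - t') \<or> (p dvd u - s' \<and> p dvd v - t')"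
proof -
  define A1 B1 A2 B2 where "A1 = s - s'" and "B1 = t - t'" and "A2 = u - s'" and "B2 = v - t'"
  let ?E3 = "(s + u) - (s' + u')" and ?E2 = "(t + v + s * u) - (t' + v' + s' * u')"
    and ?E1 = "(s * v + t * u) - (s' * v' + t' * u')" and ?E0 = "t * v - t' * v'"
  have "A1 * B2 + A2 * B1 - A1 * A2 * s' = ?E1 - s' * ?E2 + (s' ^ 2 - t') * ?E3"
    "B1 * B2 - A1 * A2 * t' = ?E0 - t' * ?E2 + s' * t' * ?E3"
    unfolding A1_def B1_def A2_def B2_def by (simp_all add: ring_expand)
  then have d: "p dvd A1 * B2 + A2 * B1 - A1 * A2 * s'" "p dvd B1 * B2 - A1 * A2 * t'"
    using E by (metis dvd_add dvd_diff dvd_mult)+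
  let ?r1 = "A1 * B2 + A2 * B1 - A1 * A2 * s'" and ?r0 = "B1 * B2 - A1 * A2 * t'"
  have "(A1 ^ 2 * t' - A1 * B1 * s' + B1 ^ 2) * (A2 ^ 2 * t' - A2 * B2 * s' + B2 ^ 2) =
    ?r1 ^ 2 * t' - ?r1 * ?r0 * s' + ?r0 ^ 2" by (simp add: ring_expand)
  moreover have "p dvd ?r1 ^ 2 * t' - ?r1 * ?r0 * s' + ?r0 ^ 2"
    using d by (intro dvd_add dvd_diff) (simp_all del: pdvd_mult add: dvd_mult dvd_mult2 power2_eq_square)
  ultimately have "p dvd A1 ^ 2 * t' - A1 * B1 * s' + B1 ^ 2 \<or> p dvd A2 ^ 2 * t' - A2 * B2 * s' + B2 ^ 2"
    by (metis pdvd_mult)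
  then show ?thesis using norm_zero_rootless[OF R] unfolding A1_def B1_def A2_def B2_def by blast
qed

definition quad_prod :: "(int \<times> int) \<times> (int \<times> int) \<Rightarrow> int \<times> int \<times> int \<times> int" where
  "quad_prod = (\<lambda>((s, t), (u, v)).
     ((s + u) mod p, (t + v + s * u) mod p, (s * v + t * u) mod p, (t * v) mod p))"

lemma quad_prod_commute: "quad_prod (g, h) = quad_prod (h, g)"
  by (cases g; cases h) (simp add: quad_prod_def algebra_simps)

lemma quad_prod_eq_iff:
  assumes "g \<in> rootless_quadratics" "h \<in> rootless_quadratics" "g' \<in> rootless_quadratics" "h' \<in> rootless_quadratics"
  shows "quad_prod (g, h) = quad_prod (g', h') \<longleftrightarrow> (g = g' \<and> h = h') \<or> (g = h' \<and> h = g')"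
proof
  obtain s t u v s' t' u' v' where st: "g = (s, t)" "h = (u, v)" "g' = (s', t')" "h' = (u', v')"
    by (metis surj_pair)
  have range: "s \<in> {0..<p}" "t \<in> {0..<p}" "u \<in> {0..<p}" "v \<in> {0..<p}"
    "s' \<in> {0..<p}" "t' \<in> {0..<p}" "u' \<in> {0..<p}" "v' \<in> {0..<p}"
    and R: "\<forall>x. \<not> p dvd x ^ 2 + s' * x + t'"
    using assms by (auto simp: st rootless_quadratics_def)
  assume "quad_prod (g, h) = quad_prod (g', h')"
  then have E: "p dvd (s + u) - (s' + u')" "p dvd (t + v + s * u) - (t' + v' + s' * u')"
      "p dvd (s * v + t * u) - (s' * v' + t' * u')" "p dvd t * v - t' * v'"
    by (simp_all add: st quad_prod_def mod_eq_dvd_iff)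
  from quadratic_factors_unique[OF R E]
  show "(g = g' \<and> h = h') \<or> (g = h' \<and> h = g')"
  proof
    assume "p dvd s - s' \<and> p dvd t - t'"
    then have 1: "s = s'" "t = t'" using eq_mod_dvd range by auto
    then have "u = u'" using E(1) eq_mod_dvd range by auto
    moreover from this have "v = v'" using 1 E(2) eq_mod_dvd range by auto
    ultimately show ?thesis using 1 st by simp
  next
    assume "p dvd u - s' \<and> p dvd v - t'"
    then have 1: "u = s'" "v = t'" using eq_mod_dvd range by auto
    then have "s = u'" using E(1) eq_mod_dvd range by auto
    moreover from this have "t = v'" using 1 E(2) eq_mod_dvd range by (auto simp: algebra_simps)
    ultimately show ?thesis using 1 st by simp
  qed
qed (auto simp: quad_prod_commute)

text \<open>Counts unordered pairs with repetition: squares come from one ordered pair, all other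
  products from exactly two.\<close>

lemma card_quad_prod:
  "2 * card (quad_prod ` (rootless_quadratics \<times> rootless_quadratics)) =
    card rootless_quadratics * card rootless_quadratics + card rootless_quadratics"
proof -
  let ?R = rootless_quadratics
  define D where "D = (\<lambda>g. (g, g)) ` ?R"
  define N where "N = ?R \<times> ?R - D"
  have fin: "finite ?R" by (rule finite_rootless_quadratics)
  have cD: "card D = card ?R" unfolding D_def by (intro card_image inj_onI) auto
  have DO: "?R \<times> ?R = D \<union> N" "D \<subseteq> ?R \<times> ?R" unfolding D_def N_def by auto
  have cO: "card N = card ?R * card ?R - card ?R"
    using cD fin DO(2) unfolding N_def by (subst card_Diff_subset) (auto simp: D_def card_cartesian_product)
  have "card {y \<in> N. quad_prod y = quad_prod x} = 2" if x: "x \<in> N" for x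
  proof -
    obtain g h where g: "x = (g, h)" by (cases x)
    then have gh: "x = (g, h)" "g \<in> ?R" "h \<in> ?R" "g \<noteq> h" using x by (auto simp: N_def D_def)
    have "{y \<in> N. quad_prod y = quad_prod x} = {(g, h), (h, g)}"
    proof (intro equalityI subsetI)
      fix y assume y: "y \<in> {y \<in> N. quad_prod y = quad_prod x}"
      obtain g' h' where g': "y = (g', h')" by (cases y)
      then have "g' \<in> ?R" "h' \<in> ?R" "quad_prod (g', h') = quad_prod (g, h)"
        using y g by (auto simp: N_def)
      then show "y \<in> {(g, h), (h, g)}" using quad_prod_eq_iff gh g' by blast
    next
      fix y assume "y \<in> {(g, h), (h, g)}"
      then show "y \<in> {y \<in> N. quad_prod y = quad_prod x}"
        using gh quad_prod_commute[of g h] by (auto simp: N_def D_def)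
    qed
    then show ?thesis using gh by simp
  qed
  then have "card N = 2 * card (quad_prod ` N)"
    using fin by (intro card_two_to_one) (auto simp: N_def)
  moreover have "card (quad_prod ` D) = card D"
    using quad_prod_eq_iff by (intro card_image inj_onI) (auto simp: D_def)
  moreover have "quad_prod ` D \<inter> quad_prod ` N = {}"
    using quad_prod_eq_iff by (fastforce simp: D_def N_def)
  then have "card (quad_prod ` (?R \<times> ?R)) = card (quad_prod ` D) + card (quad_prod ` N)"
    unfolding DO(1) image_Un using fin by (intro card_Un_disjoint) (auto simp: D_def N_def)
  moreover have "card ?R \<le> card ?R * card ?R" by (cases "card ?R") auto
  ultimately show ?thesis using cD cO by linarith
qed

lemma mean4_card:
  "mean4 n (\<lambda>x y z w. of_bool (P x y z w)) =
    card {(x, y, z, w). x \<in> {0..<p ^ n} \<and> y \<in> {0..<p ^ n} \<and> z \<in> {0..<p ^ n} \<and> w \<in> {0..<p ^ n} \<and> P x y z w}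
      / real_of_int (p ^ n) ^ 4"
proof -
  let ?A = "{0..<p ^ n}"
  have "(\<Sum>x\<in>?A. \<Sum>y\<in>?A. \<Sum>z\<in>?A. \<Sum>w\<in>?A. of_bool (P x y z w) :: real) =
    (\<Sum>q\<in>?A \<times> ?A \<times> ?A \<times> ?A. if P (fst q) (fst (snd q)) (fst (snd (snd q))) (snd (snd (snd q))) then 1 else 0)"
    by (simp add: sum.cartesian_product of_bool_def case_prod_unfold)
  also have "\<dots> = card {q \<in> ?A \<times> ?A \<times> ?A \<times> ?A. P (fst q) (fst (snd q)) (fst (snd (snd q))) (snd (snd (snd q)))}"
    by (simp add: sum.If_cases Int_def)
  also have "{q \<in> ?A \<times> ?A \<times> ?A \<times> ?A. P (fst q) (fst (snd q)) (fst (snd (snd q))) (snd (snd (snd q)))} =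
    {(x, y, z, w). x \<in> ?A \<and> y \<in> ?A \<and> z \<in> ?A \<and> w \<in> ?A \<and> P x y z w}" by auto
  finally show ?thesis
    by (simp add: mean4_def mean3_def mean2_def mean_def power4_eq_xxxx flip: sum_divide_distrib)
qed

lemma full_quad_rootless:
  "{(c3, c2, c1, c0). c3 \<in> {0..<p ^ 1} \<and> c2 \<in> {0..<p ^ 1} \<and> c1 \<in> {0..<p ^ 1} \<and> c0 \<in> {0..<p ^ 1} \<and>
      \<not> full_root 1 c3 c2 c1 c0 \<and> full_quad 1 c3 c2 c1 c0} =
   quad_prod ` (rootless_quadratics \<times> rootless_quadratics)" (is "?L = ?R")
proof (intro equalityI subsetI)
  fix q assume "q \<in> ?L"
  then obtain c3 c2 c1 c0 where q: "q = (c3, c2, c1, c0)" "c3 \<in> {0..<p}" "c2 \<in> {0..<p}" "c1 \<in> {0..<p}" "c0 \<in> {0..<p}"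
    and nr: "\<not> full_root 1 c3 c2 c1 c0" and "full_quad 1 c3 c2 c1 c0" by auto
  then obtain s t u v where 1: "p dvd s + u - c3" "p dvd t + v + s * u - c2" "p dvd s * v + t * u - c1" "p dvd t * v - c0"
    unfolding full_quad_def by auto
  have fac: "p dvd quartic c3 c2 c1 c0 x" if "p dvd (x ^ 2 + s * x + t) * (x ^ 2 + u * x + v)" for x
  proof -
    have "quartic c3 c2 c1 c0 x = (x ^ 2 + s * x + t) * (x ^ 2 + u * x + v) - (s + u - c3) * x ^ 3
      - (t + v + s * u - c2) * x ^ 2 - (s * v + t * u - c1) * x - (t * v - c0)" by (simp add: ring_expand)
    then show ?thesis using 1 that by (metis dvd_diff dvd_mult2)
  qed
  have nr': "\<not> p dvd quartic c3 c2 c1 c0 x" for x using nr by (auto simp: full_root_def)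
  have mod: "p dvd x ^ 2 + (a mod p) * x + b mod p \<longleftrightarrow> p dvd x ^ 2 + a * x + b" for x a b
  proof (rule dvd_cong)
    have "x ^ 2 + (a mod p) * x + b mod p - (x ^ 2 + a * x + b) = (a mod p - a) * x + (b mod p - b)"
      by (simp add: ring_expand)
    moreover have "p dvd a mod p - a" "p dvd b mod p - b" by (simp_all add: mod_eq_dvd_iff[symmetric])
    ultimately show "p dvd x ^ 2 + (a mod p) * x + b mod p - (x ^ 2 + a * x + b)"
      by (metis dvd_add dvd_mult2)
  qed
  have "(s mod p, t mod p) \<in> rootless_quadratics" "(u mod p, v mod p) \<in> rootless_quadratics"
    unfolding rootless_quadratics_def using fac nr' by (auto simp: mod)
  moreover have "quad_prod ((s mod p, t mod p), (u mod p, v mod p)) = q"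
  proof -
    have "c3 = (s + u) mod p" "c2 = (t + v + s * u) mod p" "c1 = (s * v + t * u) mod p" "c0 = (t * v) mod p"
      using 1 q by (simp_all flip: mod_eq_dvd_iff)
    moreover have "(s mod p + u mod p) mod p = (s + u) mod p"
      "(t mod p + v mod p + (s mod p) * (u mod p)) mod p = (t + v + s * u) mod p"
      "((s mod p) * (v mod p) + (t mod p) * (u mod p)) mod p = (s * v + t * u) mod p"
      "(t mod p) * (v mod p) mod p = (t * v) mod p"
      by (intro mod_add_cong mod_mult_cong; simp)+
    ultimately show ?thesis by (simp add: quad_prod_def q)
  qed
  ultimately show "q \<in> ?R" by (metis SigmaI imageI)
next
  fix q assume "q \<in> ?R"
  then obtain s t u v where st: "(s, t) \<in> rootless_quadratics" "(u, v) \<in> rootless_quadratics"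
    and q: "q = quad_prod ((s, t), (u, v))" by auto
  let ?c3 = "(s + u) mod p" and ?c2 = "(t + v + s * u) mod p" and ?c1 = "(s * v + t * u) mod p" and ?c0 = "(t * v) mod p"
  have d: "p dvd s + u - ?c3" "p dvd t + v + s * u - ?c2" "p dvd s * v + t * u - ?c1" "p dvd t * v - ?c0"
    by (simp_all add: mod_eq_dvd_iff[symmetric])
  have "\<not> p dvd quartic ?c3 ?c2 ?c1 ?c0 x" for x
  proof -
    have "(x ^ 2 + s * x + t) * (x ^ 2 + u * x + v) - quartic ?c3 ?c2 ?c1 ?c0 x = (s + u - ?c3) * x ^ 3
      + (t + v + s * u - ?c2) * x ^ 2 + (s * v + t * u - ?c1) * x + (t * v - ?c0)" by (simp add: ring_expand)
    then have "p dvd (x ^ 2 + s * x + t) * (x ^ 2 + u * x + v) - quartic ?c3 ?c2 ?c1 ?c0 x"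
      using d by (metis dvd_add dvd_mult2)
    moreover have "\<not> p dvd (x ^ 2 + s * x + t) * (x ^ 2 + u * x + v)"
      using st by (simp add: rootless_quadratics_def)
    ultimately show ?thesis using dvd_cong by blast
  qed
  then have "\<not> full_root 1 ?c3 ?c2 ?c1 ?c0" by (simp add: full_root_def)
  moreover have "full_quad 1 ?c3 ?c2 ?c1 ?c0" unfolding full_quad_def power_one_right using d by blast
  ultimately show "q \<in> ?L" by (simp add: q quad_prod_def)
qed

text \<open>This is the classical count (p^4 - p^2)/4 over p^4, obtained as the rootless quartics
  minus the products of two irreducible quadratics.\<close>

lemma mean_irreducible_mod_p:
  "mean3 1 1 1 (\<lambda>a b c. of_bool (\<not> red 1 a b c)) = (p ^ 2 - 1) / (4 * p ^ 2)"
proof -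
  let ?K = "real (card rootless_quadratics)" and ?p = "real_of_int p"
  have K: "?K = ?p * (?p - 1) / 2" using card_rootless_quadratics by simp
  have "real (2 * card (quad_prod ` (rootless_quadratics \<times> rootless_quadratics))) =
    real (card rootless_quadratics * card rootless_quadratics + card rootless_quadratics)"
    unfolding card_quad_prod ..
  then have Y: "real (card (quad_prod ` (rootless_quadratics \<times> rootless_quadratics))) = (?K * ?K + ?K) / 2"
    by simp
  have "(of_bool (\<not> full_red 1 c3 c2 c1 c0) :: real) = of_bool (\<not> full_root 1 c3 c2 c1 c0) +
    (- 1) * of_bool (\<not> full_root 1 c3 c2 c1 c0 \<and> full_quad 1 c3 c2 c1 c0)" for c3 c2 c1 c0
    by (simp add: full_red_def)
  then have "mean3 1 1 1 (\<lambda>a b c. of_bool (\<not> red 1 a b c)) =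
    mean4 1 (\<lambda>c3 c2 c1 c0. of_bool (\<not> full_root 1 c3 c2 c1 c0) +
      (- 1) * of_bool (\<not> full_root 1 c3 c2 c1 c0 \<and> full_quad 1 c3 c2 c1 c0))"
    by (simp only: mean4_full_red[symmetric])
  also have "\<dots> = mean4 1 (\<lambda>c3 c2 c1 c0. of_bool (\<not> full_root 1 c3 c2 c1 c0)) +
      (- 1) * mean4 1 (\<lambda>c3 c2 c1 c0. of_bool (\<not> full_root 1 c3 c2 c1 c0 \<and> full_quad 1 c3 c2 c1 c0))"
    by (simp only: mean4_def mean3_def mean2_def mean_add mean_cmult)
  also have "mean4 1 (\<lambda>c3 c2 c1 c0. of_bool (\<not> full_root 1 c3 c2 c1 c0 \<and> full_quad 1 c3 c2 c1 c0)) =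
    (?K * ?K + ?K) / 2 / ?p ^ 4"
    unfolding mean4_card full_quad_rootless Y by simp
  also have "mean4 1 (\<lambda>c3 c2 c1 c0. of_bool (\<not> full_root 1 c3 c2 c1 c0)) =
    1 - 1 + (?p - 1) / (2 * ?p) - (?p - 1) * (?p - 2) / (6 * ?p ^ 2) + (?p - 1) * (?p - 2) * (?p - 3) / (24 * ?p ^ 3)"
    using mean_no_root by simp
  finally have m: "mean3 1 1 1 (\<lambda>a b c. of_bool (\<not> red 1 a b c)) =
    1 - 1 + (?p - 1) / (2 * ?p) - (?p - 1) * (?p - 2) / (6 * ?p ^ 2) + (?p - 1) * (?p - 2) * (?p - 3) / (24 * ?p ^ 3)
      + (- 1) * ((?K * ?K + ?K) / 2 / ?p ^ 4)" .
  have "1 - 1 + (q - 1) / (2 * q) - (q - 1) * (q - 2) / (6 * q ^ 2) + (q - 1) * (q - 2) * (q - 3) / (24 * q ^ 3)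
     + (- 1) * ((q * (q - 1) / 2 * (q * (q - 1) / 2) + q * (q - 1) / 2) / 2 / q ^ 4) = (q ^ 2 - 1) / (4 * q ^ 2)"
    if "q \<noteq> 0" for q :: real
  proof -
    define i where "i = 1 / q"
    have "(q - 1) / (2 * q) = (1 - i) / 2" "(q - 1) * (q - 2) / (6 * q ^ 2) = (1 - i) * (1 - 2 * i) / 6"
      "(q - 1) * (q - 2) * (q - 3) / (24 * q ^ 3) = (1 - i) * (1 - 2 * i) * (1 - 3 * i) / 24"
      "(q * (q - 1) / 2 * (q * (q - 1) / 2) + q * (q - 1) / 2) / 2 / q ^ 4 = (1 - i) ^ 2 / 8 + i ^ 2 * (1 - i) / 4"
      "(q ^ 2 - 1) / (4 * q ^ 2) = (1 - i ^ 2) / 4"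
      using that unfolding i_def by (simp_all add: divide_simps) (simp_all add: ring_expand)
    then show ?thesis by (simp only:) (simp add: field_simps power2_eq_square)
  qed
  from this[of ?p] show ?thesis unfolding m K by simp
qed

subsection \<open>The self-similar decomposition\<close>

lemma red_lift:
  assumes r: "red 1 a b c" and n0: "\<not> (p dvd a \<and> p dvd b \<and> p dvd c)" and nB: "\<not> square_class a b c"
  shows "red n a b c"
proof -
  \<comment> \<open>Precision \<open>Suc n\<close> serves level \<open>n\<close> and level 1 at
    once, also for n = 0.\<close>
  obtain e where e: "p ^ Suc n dvd a - 2 * e" using half_mod .
  define r0 where "r0 = e ^ 2 - c"
  have e1: "p dvd a - 2 * e" "p ^ n dvd a - 2 * e"
    using e power_dvd_mono[of 1 "Suc n"] power_dvd_mono[of n "Suc n"] by simp_all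
  have c: "c = e ^ 2 - r0" by (simp add: r0_def)
  have "red n (2 * e) (- (- b)) (e ^ 2 - r0)"
  proof (rule red_lift_coords)
    show "red 1 (2 * e) (- (- b)) (e ^ 2 - r0)"
      using r red_cong[of 1 a "2 * e" b b c c] e1(1) by (simp add: c)
    show "\<not> (p dvd e \<and> p dvd - b \<and> p dvd r0)"
    proof
      assume a: "p dvd e \<and> p dvd - b \<and> p dvd r0"
      then have "p dvd c" "p dvd b" unfolding c by (simp_all add: dvd_diff)
      moreover have "p dvd 2 * e" using a by simp
      then have "p dvd a" using e1(1) dvd_cong by blast
      ultimately show False using n0 by blast
    qed
    show "\<not> (p dvd - b \<and> p dvd r0 \<and> nonsq (- e))"
      using nB square_class_coords[of e "- b" r0] square_class_cong[of a "2 * e" b b c c] e1(1) by (simp add: c)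
  qed
  then show ?thesis using red_cong[of n a "2 * e" b b c c] e1(2) by (simp add: c)
qed

lemma square_class_red: "square_class a b c \<Longrightarrow> red 1 a b c \<and> \<not> p dvd a"
proof -
  assume S: "square_class a b c"
  obtain e where "p ^ 1 dvd a - 2 * e" using half_mod .
  then have e: "p dvd a - 2 * e" by simp
  have "4 * (e * e - c) = (a ^ 2 - 4 * c) - (a - 2 * e) * (a + 2 * e)" by (simp add: ring_expand)
  then have "p dvd 4 * (e * e - c)" using S e unfolding square_class_def by (metis dvd_diff dvd_mult2)
  then have "p dvd e * e - c" unfolding pdvd_mult by simp
  moreover have "p dvd e + e - 0 ^ 2 - a" using e by (simp add: dvd_diff_commute)
  moreover have "p dvd 0 * (e - e) - b" using S by (simp add: square_class_def)
  ultimately have "has_quad 1 a b c" unfolding has_quad_def power_one_right by blast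
  moreover have "\<not> p dvd - 2 * a" using S nonsq_unit unfolding square_class_def by blast
  ultimately show ?thesis by (simp add: red_def)
qed

lemma red_1_if_dvd: "p dvd c \<Longrightarrow> red 1 a b c"
  unfolding red_def has_root_def by (intro disjI1 exI[of _ 0]) simp

text \<open>In order: irreducible modulo \<open>p\<close>, square of an irreducible quadratic,
  Eisenstein, slope 1/2, slope 3/4, scaled copy. All other quartics are reducible at every level, by
  Hensel lifting or by an edge of horizontal length 1.\<close>

lemma not_red_decomposition:
  assumes n: "4 \<le> n"
  shows "(of_bool (\<not> red n a b c) :: real) = of_bool (\<not> red 1 a b c)
    + of_bool (square_class a b c \<and> \<not> red n a b c)
    + of_bool (p ^ 1 dvd a \<and> p ^ 1 dvd b \<and> p ^ 1 dvd c \<and> \<not> p ^ Suc 1 dvd c)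
    + of_bool (half_slope_class a b c \<and> \<not> red n a b c)
    + of_bool (p ^ 2 dvd a \<and> p ^ 3 dvd b \<and> p ^ 3 dvd c \<and> \<not> p ^ Suc 3 dvd c)
    + (if p ^ 2 dvd a \<and> p ^ 3 dvd b \<and> p ^ 4 dvd c then of_bool (\<not> red n a b c) else 0)"
proof -
  have e: "Suc 1 = 2" "Suc 3 = 4" by simp_all
  have m: "p ^ 2 dvd z \<Longrightarrow> p dvd z" "p ^ 3 dvd z \<Longrightarrow> p ^ 2 dvd z" "p ^ 4 dvd z \<Longrightarrow> p ^ 3 dvd z" for z
    using power_dvd_mono[of 1 2 z] power_dvd_mono[of 2 3 z] power_dvd_mono[of 3 4 z] by simp_all
  have r1: "red n a b c \<Longrightarrow> red 1 a b c" using n by (intro red_mono[of 1 n]) auto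
  show ?thesis
  proof (cases "p dvd a \<and> p dvd b \<and> p dvd c")
    case False
    then have no: "\<not> half_slope_class a b c" "\<not> (p ^ 2 dvd a \<and> p ^ 3 dvd b \<and> p ^ 3 dvd c)"
      "\<not> (p ^ 2 dvd a \<and> p ^ 3 dvd b \<and> p ^ 4 dvd c)"
      unfolding half_slope_class_def using m by blast+
    have "of_bool (\<not> red n a b c) = (of_bool (\<not> red 1 a b c) + of_bool (square_class a b c \<and> \<not> red n a b c) :: real)"
      using red_lift[of a b c n] False square_class_red[of a b c] r1 by auto
    then show ?thesis using no False unfolding e power_one_right by auto
  next
    case True
    then have 1: "red 1 a b c" "\<not> square_class a b c" using red_1_if_dvd square_class_red by blast+
    consider "\<not> p ^ 2 dvd c" | "p ^ 2 dvd c" "\<not> p ^ 2 dvd b"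
      | "p ^ 2 dvd c" "p ^ 2 dvd b" "\<not> (p ^ 2 dvd a \<and> p ^ 3 dvd c)"
      | "p ^ 2 dvd a" "p ^ 2 dvd b" "p ^ 3 dvd c" "\<not> p ^ 3 dvd b"
      | "p ^ 2 dvd a" "p ^ 3 dvd b" "p ^ 3 dvd c" "\<not> p ^ 4 dvd c"
      | "p ^ 2 dvd a" "p ^ 3 dvd b" "p ^ 4 dvd c"
      using m by blast
    then show ?thesis
    proof cases
      case c1: 1
      have "\<not> red n a b c" using not_red_eisenstein True c1 n by simp
      moreover have "\<not> p ^ 3 dvd c" "\<not> p ^ 4 dvd c" "\<not> half_slope_class a b c"
        using c1 m unfolding half_slope_class_def by blast+
      ultimately show ?thesis using 1 True c1 unfolding e power_one_right by simp
    next
      case 2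
      have "red n a b c" using red_linear_slope_1 True 2 by blast
      moreover have "\<not> p ^ 3 dvd b" using 2 m by blast
      ultimately show ?thesis using 1 2 unfolding e power_one_right by simp
    next
      case 3
      have "half_slope_class a b c" using 3 True unfolding half_slope_class_def by blast
      moreover have "\<not> (p ^ 2 dvd a \<and> p ^ 3 dvd b \<and> p ^ 4 dvd c)" "\<not> (p ^ 2 dvd a \<and> p ^ 3 dvd b \<and> p ^ 3 dvd c)"
        using 3 m by blast+
      ultimately show ?thesis using 1 3 unfolding e power_one_right by auto
    next
      case 4
      have "red n a b c" using red_linear_slope_2 4 by blast
      then show ?thesis using 1 4 m(2)[of c] unfolding e power_one_right by simp
    next
      case 5
      have "\<not> red n a b c" using not_red_slope_3 5 n by blast
      then show ?thesis using 1 5 m(2)[of c] unfolding e power_one_right half_slope_class_def by simp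
    next
      case 6
      then show ?thesis using 1 m(2)[of c] m(3)[of c] unfolding e power_one_right half_slope_class_def by simp
    qed
  qed
qed

section \<open>The recursion for the density and its solution\<close>

definition irr_density :: "nat \<Rightarrow> real" where
  "irr_density n = mean3 n n n (\<lambda>a b c. of_bool (\<not> red n a b c))"

lemma irr_density_level:
  "n \<le> A \<Longrightarrow> n \<le> B \<Longrightarrow> n \<le> C \<Longrightarrow> mean3 A B C (\<lambda>a b c. of_bool (\<not> red n a b c)) = irr_density n"
  unfolding irr_density_def by (rule mean3_level[OF red_periodic])

text \<open>\<open>D\<close> is the density within the scaled part. The 4 in \<open>N\<close> pays
  for \<open>red_unscale\<close>; averaging at level \<open>N + 4\<close> leaves at least
  \<open>N\<close> digits after division by p^2, p^3 and p^4.\<close>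

lemma irr_density_recursion:
  fixes n defines "N \<equiv> n + 4"
  shows "\<exists>D. irr_density N = (p ^ 2 - 1) / (4 * p ^ 2)
      + mean3 N N N (\<lambda>a b c. of_bool (square_class a b c \<and> \<not> red N a b c))
      + (1 - 1 / p) / p ^ 3
      + mean3 N N N (\<lambda>a b c. of_bool (half_slope_class a b c \<and> \<not> red N a b c))
      + (1 - 1 / p) / p ^ 8 + D / p ^ 9
    \<and> irr_density n \<le> D \<and> D \<le> irr_density N"
proof -
  let ?M = "N + 4"
  define D where "D = mean3 (?M - 2) (?M - 3) (?M - 4) (\<lambda>a b c. of_bool (\<not> red N (p ^ 2 * a) (p ^ 3 * b) (p ^ 4 * c)))"
  have N: "4 \<le> N" "1 \<le> N" "3 \<le> N" by (simp_all add: N_def)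
  have "irr_density N = mean3 ?M ?M ?M (\<lambda>a b c. of_bool (\<not> red N a b c))"
    by (rule irr_density_level[symmetric]) simp_all
  also have "\<dots> = mean3 ?M ?M ?M (\<lambda>a b c. of_bool (\<not> red 1 a b c)
    + of_bool (square_class a b c \<and> \<not> red N a b c)
    + of_bool (p ^ 1 dvd a \<and> p ^ 1 dvd b \<and> p ^ 1 dvd c \<and> \<not> p ^ Suc 1 dvd c)
    + of_bool (half_slope_class a b c \<and> \<not> red N a b c)
    + of_bool (p ^ 2 dvd a \<and> p ^ 3 dvd b \<and> p ^ 3 dvd c \<and> \<not> p ^ Suc 3 dvd c)
    + (if p ^ 2 dvd a \<and> p ^ 3 dvd b \<and> p ^ 4 dvd c then of_bool (\<not> red N a b c) else 0))"
    using not_red_decomposition[OF N(1)] by (intro arg_cong[of _ _ "mean3 ?M ?M ?M"] ext)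
  also have "\<dots> = mean3 1 1 1 (\<lambda>a b c. of_bool (\<not> red 1 a b c))
    + mean3 N N N (\<lambda>a b c. of_bool (square_class a b c \<and> \<not> red N a b c))
    + (1 - 1 / p) / p ^ (1 + 1 + 1)
    + mean3 N N N (\<lambda>a b c. of_bool (half_slope_class a b c \<and> \<not> red N a b c))
    + (1 - 1 / p) / p ^ (2 + 3 + 3) + D / p ^ (2 + 3 + 4)"
  proof -
    have "mean3 ?M ?M ?M (\<lambda>a b c. of_bool (\<not> red 1 a b c)) = mean3 1 1 1 (\<lambda>a b c. of_bool (\<not> red 1 a b c))"
      by (rule mean3_level[OF red_periodic]) simp_all
    moreover have "mean3 ?M ?M ?M (\<lambda>a b c. of_bool (square_class a b c \<and> \<not> red N a b c)) =
        mean3 N N N (\<lambda>a b c. of_bool (square_class a b c \<and> \<not> red N a b c))"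
      by (rule mean3_level[OF square_class_periodic[OF N(2)]]) simp_all
    moreover have "mean3 ?M ?M ?M (\<lambda>a b c. of_bool (half_slope_class a b c \<and> \<not> red N a b c)) =
        mean3 N N N (\<lambda>a b c. of_bool (half_slope_class a b c \<and> \<not> red N a b c))"
      by (rule mean3_level[OF half_slope_class_periodic[OF N(3)]]) simp_all
    moreover have "mean3 ?M ?M ?M (\<lambda>a b c. of_bool (p ^ 1 dvd a \<and> p ^ 1 dvd b \<and> p ^ 1 dvd c \<and> \<not> p ^ Suc 1 dvd c)) =
        (1 - 1 / p) / p ^ (1 + 1 + 1)"
      by (rule mean_exact_valuation) simp_all
    moreover have "mean3 ?M ?M ?M (\<lambda>a b c. of_bool (p ^ 2 dvd a \<and> p ^ 3 dvd b \<and> p ^ 3 dvd c \<and> \<not> p ^ Suc 3 dvd c)) =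
        (1 - 1 / p) / p ^ (2 + 3 + 3)"
      by (rule mean_exact_valuation) simp_all
    moreover have "mean3 ?M ?M ?M (\<lambda>a b c. if p ^ 2 dvd a \<and> p ^ 3 dvd b \<and> p ^ 4 dvd c then of_bool (\<not> red N a b c) else 0) =
        D / p ^ (2 + 3 + 4)"
      unfolding D_def by (rule mean3_dvd) simp_all
    ultimately show ?thesis by (simp only: mean3_add)
  qed
  finally have eq: "irr_density N = \<dots>" .
  have "irr_density n = mean3 (?M - 2) (?M - 3) (?M - 4) (\<lambda>a b c. of_bool (\<not> red n a b c))"
    by (rule irr_density_level[symmetric]) (simp_all add: N_def)
  also have "\<dots> \<le> D" unfolding D_def
    using red_unscale by (intro mean3_mono) (auto simp: N_def)
  finally have 1: "irr_density n \<le> D" .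
  have "D \<le> mean3 (?M - 2) (?M - 3) (?M - 4) (\<lambda>a b c. of_bool (\<not> red N a b c))"
    unfolding D_def using red_scale by (intro mean3_mono) auto
  also have "\<dots> = irr_density N"
    by (rule irr_density_level) simp_all
  finally have 2: "D \<le> irr_density N" .
  show ?thesis
    using eq 1 2 unfolding mean_irreducible_mod_p by (intro exI[of _ D]) (simp add: eval_nat_numeral)
qed

text \<open>Limits of all contributions but the scaled copy: irreducible modulo \<open>p\<close>,
  square class, Eisenstein, slope 1/2, slope 3/4.\<close>

definition self_similar_rest :: real where
  "self_similar_rest = (p ^ 2 - 1) / (4 * p ^ 2) + (p - 1) / (2 * p) * (1 / p ^ 2 - 1 / p ^ 4 + gam / p ^ 4)
    + (1 - 1 / p) / p ^ 3 + ((1 - 1 / p) * eta + (1 / p) * ((p - 1) / (2 * p))) / p ^ 5 + (1 - 1 / p) / p ^ 8"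

text \<open>Both bounds of the sandwich tend to \<open>I\<close>, hence so does \<open>D\<close>;
  solving the recursion for \<open>D\<close> gives its limit a second time.\<close>

lemma irr_density_limit:
  assumes lim: "irr_density \<longlonglongrightarrow> I"
  shows "p ^ 9 * (I - self_similar_rest) = I"
proof -
  have "1 < real_of_int p ^ 2" using real_p_gt2 by (intro one_less_power) auto
  then have geo: "(\<lambda>n. (1 / p ^ 2) ^ n) \<longlonglongrightarrow> (0::real)" by (intro LIMSEQ_realpow_zero) auto
  define SQ where "SQ n = mean3 n n n (\<lambda>a b c. of_bool (square_class a b c \<and> \<not> red n a b c))" for n
  define HS where "HS n = mean3 n n n (\<lambda>a b c. of_bool (half_slope_class a b c \<and> \<not> red n a b c))" for n
  have "(\<lambda>n. SQ (n + 2) - (p - 1) / (2 * p) * (1 / p ^ 2 - 1 / p ^ 4 + gam / p ^ 4)) \<longlonglongrightarrow> 0"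
    by (rule Lim_null_comparison[OF _ geo], rule always_eventually)
      (simp only: SQ_def real_norm_def mean_square_class, simp)
  then have "(\<lambda>n. SQ (n + 2)) \<longlonglongrightarrow> (p - 1) / (2 * p) * (1 / p ^ 2 - 1 / p ^ 4 + gam / p ^ 4)"
    by (simp only: LIM_zero_iff)
  then have "SQ \<longlonglongrightarrow> (p - 1) / (2 * p) * (1 / p ^ 2 - 1 / p ^ 4 + gam / p ^ 4)" by (rule LIMSEQ_offset)
  then have SQ: "(\<lambda>n. SQ (n + 4)) \<longlonglongrightarrow> (p - 1) / (2 * p) * (1 / p ^ 2 - 1 / p ^ 4 + gam / p ^ 4)"
    by (rule LIMSEQ_ignore_initial_segment)
  have "(\<lambda>n. HS (n + 3)) \<longlonglongrightarrow> ((1 - 1 / p) * (eta * (1 - 0)) + (1 / p) * ((p - 1) / (2 * p))) / p ^ 5"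
    unfolding HS_def mean_half_slope_class
    by (intro tendsto_divide tendsto_add tendsto_mult tendsto_const tendsto_diff LIMSEQ_Suc[OF geo]) auto
  then have "HS \<longlonglongrightarrow> ((1 - 1 / p) * (eta * (1 - 0)) + (1 / p) * ((p - 1) / (2 * p))) / p ^ 5"
    by (rule LIMSEQ_offset)
  then have HS: "(\<lambda>n. HS (n + 4)) \<longlonglongrightarrow> ((1 - 1 / p) * (eta * (1 - 0)) + (1 / p) * ((p - 1) / (2 * p))) / p ^ 5"
    by (rule LIMSEQ_ignore_initial_segment)
  have lim4: "(\<lambda>n. irr_density (n + 4)) \<longlonglongrightarrow> I" using lim by (rule LIMSEQ_ignore_initial_segment)
  have "\<exists>D. \<forall>n. irr_density (n + 4) = (p ^ 2 - 1) / (4 * p ^ 2) + SQ (n + 4) + (1 - 1 / p) / p ^ 3 + HS (n + 4)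
      + (1 - 1 / p) / p ^ 8 + D n / p ^ 9 \<and> irr_density n \<le> D n \<and> D n \<le> irr_density (n + 4)"
    unfolding SQ_def HS_def using irr_density_recursion by (intro choice) blast
  then obtain D where D: "\<And>n. irr_density (n + 4) = (p ^ 2 - 1) / (4 * p ^ 2) + SQ (n + 4) + (1 - 1 / p) / p ^ 3
      + HS (n + 4) + (1 - 1 / p) / p ^ 8 + D n / p ^ 9"
    and Db: "\<And>n. irr_density n \<le> D n" "\<And>n. D n \<le> irr_density (n + 4)" by blast
  have "D = (\<lambda>n. p ^ 9 * (irr_density (n + 4) - ((p ^ 2 - 1) / (4 * p ^ 2) + SQ (n + 4) + (1 - 1 / p) / p ^ 3
      + HS (n + 4) + (1 - 1 / p) / p ^ 8)))"
    using D by (intro ext) simp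
  moreover have "\<dots> \<longlonglongrightarrow> p ^ 9 * (I - ((p ^ 2 - 1) / (4 * p ^ 2) + (p - 1) / (2 * p) * (1 / p ^ 2 - 1 / p ^ 4 + gam / p ^ 4)
      + (1 - 1 / p) / p ^ 3 + ((1 - 1 / p) * (eta * (1 - 0)) + (1 / p) * ((p - 1) / (2 * p))) / p ^ 5 + (1 - 1 / p) / p ^ 8))"
    by (intro tendsto_mult tendsto_diff tendsto_add tendsto_const SQ HS lim4)
  ultimately have Dlim: "D \<longlonglongrightarrow> p ^ 9 * (I - self_similar_rest)" by (simp add: self_similar_rest_def)
  have "D \<longlonglongrightarrow> I"
    by (rule tendsto_sandwich[OF _ _ lim lim4]) (simp_all add: Db)
  then show ?thesis using Dlim LIMSEQ_unique by blast
qed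

lemma irr_density_value:
  assumes lim: "irr_density \<longlonglongrightarrow> I"
  defines "q \<equiv> real_of_int p"
  shows "I = (q^12 + q^11 + 2*q^10 + 4*q^9 - 2*q^8 + q^7 + 3*q^6 - 6*q^5 + 6*q^4 - 4*q^3 - 2*q^2 - 4)
           / (4 * (q + 1) * (q^2 + 1) * (q^9 - 1))"
proof -
  have q: "q > 2" using real_p_gt2 by (simp add: q_def)
  have q9: "q ^ 9 > 1" using q by (intro one_less_power) auto
  have nz: "q \<noteq> 0" "q + 1 \<noteq> 0" "q ^ 2 + 1 \<noteq> 0" using q by (auto simp: add_nonneg_eq_0_iff)
  let ?P = "q^12 + q^11 + 2*q^10 + 4*q^9 - 2*q^8 + q^7 + 3*q^6 - 6*q^5 + 6*q^4 - 4*q^3 - 2*q^2 - 4"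
  let ?d = "4 * (q + 1) * (q ^ 2 + 1)"
  have g: "gam = (q ^ 2 + 2) / (2 * (q ^ 2 + 1))" by (simp add: gam_def q_def)
  have h: "eta = (q + 2) / (2 * (q + 1))" by (simp add: eta_def q_def)
  have t: "q ^ 9 * ((q ^ 2 - 1) / (4 * q ^ 2)) = q ^ 7 * (q ^ 2 - 1) / 4"
    "q ^ 9 * ((q - 1) / (2 * q) * (1 / q ^ 2 - 1 / q ^ 4 + gam / q ^ 4)) = q ^ 4 * (q - 1) / 2 * (q ^ 2 - 1 + gam)"
    "q ^ 9 * ((1 - 1 / q) / q ^ 3) = q ^ 5 * (q - 1)"
    "q ^ 9 * (((1 - 1 / q) * eta + (1 / q) * ((q - 1) / (2 * q))) / q ^ 5) = q ^ 3 * (q - 1) * eta + q ^ 2 * (q - 1) / 2"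
    "q ^ 9 * ((1 - 1 / q) / q ^ 8) = q - 1"
    using nz(1) by (simp_all add: field_simps eval_nat_numeral)
  have rest: "self_similar_rest = (q ^ 2 - 1) / (4 * q ^ 2) + (q - 1) / (2 * q) * (1 / q ^ 2 - 1 / q ^ 4 + gam / q ^ 4)
    + (1 - 1 / q) / q ^ 3 + ((1 - 1 / q) * eta + (1 / q) * ((q - 1) / (2 * q))) / q ^ 5 + (1 - 1 / q) / q ^ 8"
    by (simp add: self_similar_rest_def q_def)
  have "q ^ 9 * self_similar_rest = q ^ 7 * (q ^ 2 - 1) / 4 + q ^ 4 * (q - 1) / 2 * (q ^ 2 - 1 + gam)
      + q ^ 5 * (q - 1) + (q ^ 3 * (q - 1) * eta + q ^ 2 * (q - 1) / 2) + (q - 1)"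
    unfolding rest distrib_left[of "q ^ 9"] t ..
  \<comment> \<open>\<open>gam\<close> and \<open>eta\<close> stay opaque until they meet the common
    denominator, so the final comparison is between polynomials in q.\<close>
  moreover have "d * (A + B * (C + g) + D + (E * h + F) + G) = d * A + B * (d * C + d * g) + d * D + (E * (d * h) + d * F) + d * G"
    for d A B C D E F G g h :: real by (simp add: algebra_simps)
  moreover have "?d * gam = 2 * (q + 1) * (q ^ 2 + 2)" "?d * eta = 2 * (q ^ 2 + 1) * (q + 2)"
    using nz unfolding g h by (simp_all add: divide_simps) (simp_all add: algebra_simps)
  ultimately have "?d * (q ^ 9 * self_similar_rest) = ?d * (q ^ 7 * (q ^ 2 - 1) / 4)
      + q ^ 4 * (q - 1) / 2 * (?d * (q ^ 2 - 1) + 2 * (q + 1) * (q ^ 2 + 2))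
      + ?d * (q ^ 5 * (q - 1)) + (q ^ 3 * (q - 1) * (2 * (q ^ 2 + 1) * (q + 2)) + ?d * (q ^ 2 * (q - 1) / 2)) + ?d * (q - 1)"
    by (simp only:)
  also have "\<dots> = ?P" by (simp add: algebra_simps add_divide_distrib diff_divide_distrib eval_nat_numeral)
  finally have "?d * (q ^ 9 * self_similar_rest) = ?P" .
  moreover have "q ^ 9 * self_similar_rest = (q ^ 9 - 1) * I"
    using irr_density_limit[OF lim] by (simp add: q_def algebra_simps)
  ultimately have "?d * (q ^ 9 - 1) * I = ?P" by (simp only: mult.assoc)
  moreover have "?d * (q ^ 9 - 1) \<noteq> 0" using nz q9 by simp
  ultimately show ?thesis by (simp add: field_simps)
qed

end

subsection \<open>The ring of p-adic integers\<close>

locale odd_padic =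
  fixes p :: nat
  assumes prime_nat: "Factorial_Ring.prime p" and odd_nat: "odd p"
begin

sublocale odd_prime "int p"
  using prime_nat odd_nat by unfold_locales auto

abbreviation Zp :: "(nat \<Rightarrow> int) ring" where "Zp \<equiv> padic_ring p"

lemma carrier_Zp: "a \<in> carrier Zp \<longleftrightarrow> (\<forall>n. 0 \<le> a n \<and> a n < int p ^ n \<and> a (Suc n) mod int p ^ n = a n)"
  by (simp add: padic_ring_def)

lemma Zp_simps [simp]:
  "a \<otimes>\<^bsub>Zp\<^esub> b = (\<lambda>n. (a n * b n) mod int p ^ n)"
  "a \<oplus>\<^bsub>Zp\<^esub> b = (\<lambda>n. (a n + b n) mod int p ^ n)"
  "\<one>\<^bsub>Zp\<^esub> = (\<lambda>n. 1 mod int p ^ n)"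
  "\<zero>\<^bsub>Zp\<^esub> = (\<lambda>n. 0)"
  by (simp_all add: padic_ring_def)

lemma mod_pow_Suc: "(x mod int p ^ Suc n) mod int p ^ n = x mod int p ^ n"
  by (simp add: mod_mod_cancel)

lemma carrier_ZpI:
  assumes "\<And>n. x (Suc n) mod int p ^ n = x n mod int p ^ n"
  shows "(\<lambda>n. x n mod int p ^ n) \<in> carrier Zp"
  unfolding carrier_Zp mod_pow_Suc
  using assms pos_mod_sign[OF p_pos(3)] pos_mod_bound[OF p_pos(3)] by simp

lemma Zp_mod: "a \<in> carrier Zp \<Longrightarrow> a n mod int p ^ n = a n"
  by (simp add: carrier_Zp)

lemma Zp_Suc: "a \<in> carrier Zp \<Longrightarrow> a (Suc n) mod int p ^ n = a n mod int p ^ n"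
  by (simp add: carrier_Zp)

lemma Zp_le: "a \<in> carrier Zp \<Longrightarrow> n \<le> m \<Longrightarrow> a m mod int p ^ n = a n"
proof -
  assume a: "a \<in> carrier Zp" and "n \<le> m"
  from this(2) show ?thesis
  proof (induction rule: dec_induct)
    case base
    then show ?case using Zp_mod a by simp
  next
    case (step m)
    have "a (Suc m) mod int p ^ n = (a (Suc m) mod int p ^ m) mod int p ^ n"
      using step.hyps by (simp add: mod_mod_cancel le_imp_power_dvd)
    then show ?case using step Zp_Suc[OF a, of m] Zp_mod[OF a, of m] by simp
  qed
qed

lemma Zp_closed:
  assumes "a \<in> carrier Zp" "b \<in> carrier Zp"
  shows "(\<lambda>n. (a n + b n) mod int p ^ n) \<in> carrier Zp" "(\<lambda>n. (a n * b n) mod int p ^ n) \<in> carrier Zp"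
    "(\<lambda>n. (- a n) mod int p ^ n) \<in> carrier Zp"
  using Zp_Suc assms
  by (auto intro!: carrier_ZpI mod_add_cong mod_mult_cong mod_minus_cong simp del: power_Suc)

lemma Zp_one_zero: "(\<lambda>n. 1 mod int p ^ n) \<in> carrier Zp" "(\<lambda>n. 0) \<in> carrier Zp"
  using carrier_ZpI[of "\<lambda>_. 1"] carrier_ZpI[of "\<lambda>_. 0"] by simp_all

lemma cring_Zp: "cring Zp"
proof (intro cringI abelian_groupI comm_monoidI)
  fix x assume x: "x \<in> carrier Zp"
  show "\<exists>y\<in>carrier Zp. y \<oplus>\<^bsub>Zp\<^esub> x = \<zero>\<^bsub>Zp\<^esub>"
    using Zp_closed(3)[OF x x] by (intro bexI[of _ "\<lambda>n. (- x n) mod int p ^ n"]) (auto simp: mod_simps)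
qed (auto simp: Zp_closed Zp_one_zero mod_simps Zp_mod fun_eq_iff algebra_simps)

text \<open>Nonzero entries at levels m and n mean valuations below m and n, so the product is still
  nonzero at level m + n.\<close>

lemma domain_Zp: "domain Zp"
proof (intro domain.intro cring_Zp domain_axioms.intro)
  show "\<one>\<^bsub>Zp\<^esub> \<noteq> \<zero>\<^bsub>Zp\<^esub>"
    using prime_gt_1_nat[OF prime_nat] by (auto simp: fun_eq_iff intro!: exI[of _ 1])
  fix a b assume ab: "a \<otimes>\<^bsub>Zp\<^esub> b = \<zero>\<^bsub>Zp\<^esub>" and a: "a \<in> carrier Zp" and b: "b \<in> carrier Zp"
  show "a = \<zero>\<^bsub>Zp\<^esub> \<or> b = \<zero>\<^bsub>Zp\<^esub>"
  proof (rule ccontr)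
    assume "\<not> ?thesis"
    then obtain m n where mn: "a m \<noteq> 0" "b n \<noteq> 0" by (auto simp: fun_eq_iff)
    let ?N = "m + n"
    have "\<not> int p ^ m dvd a ?N" "\<not> int p ^ n dvd b ?N"
      using mn Zp_le[OF a, of m ?N] Zp_le[OF b, of n ?N] by (auto simp: dvd_eq_mod_eq_0)
    moreover have "(a ?N * b ?N) mod int p ^ ?N = 0" using fun_cong[OF ab, of ?N] by simp
    then have "int p ^ (m + n) dvd a ?N * b ?N" by (simp add: dvd_eq_mod_eq_0)
    then obtain k l where "k + l = m + n" "int p ^ k dvd a ?N" "int p ^ l dvd b ?N"
      using prime_elem_power_dvd_prod prime_p by blast
    moreover have "m \<le> k \<or> n \<le> l" using calculation(3) by linarith
    ultimately show False by (meson power_le_dvd)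
  qed
qed

sublocale Zp: domain Zp
  by (rule domain_Zp)

section \<open>Factorizations over the p-adic integers and modulo all prime powers\<close>

lemma finsum_Zp:
  assumes "finite A" "\<And>i. i \<in> A \<Longrightarrow> f i \<in> carrier Zp"
  shows "finsum Zp f A = (\<lambda>n. (\<Sum>i\<in>A. f i n) mod int p ^ n)"
  using assms
proof (induction A rule: finite_induct)
  case (insert x A)
  then have "f \<in> A \<rightarrow> carrier Zp" "f x \<in> carrier Zp" by auto
  then show ?case using insert by (simp add: fun_eq_iff mod_add_right_eq)
qed simp

lemma coeff_poly_mult_Zp:
  assumes "set g \<subseteq> carrier Zp" "set h \<subseteq> carrier Zp"
  shows "Zp.coeff (Zp.poly_mult g h) k =
    (\<lambda>n. (\<Sum>i\<le>k. Zp.coeff g i n * Zp.coeff h (k - i) n) mod int p ^ n)"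
proof -
  have "Zp.coeff g i \<otimes>\<^bsub>Zp\<^esub> Zp.coeff h (k - i) \<in> carrier Zp" for i
    using assms by (intro Zp.m_closed Zp.coeff_in_carrier)
  then show ?thesis
    unfolding Zp.poly_mult_coeff[OF assms] by (subst finsum_Zp) (simp_all add: mod_sum_eq)
qed

text \<open>The factors need not be monic, but their leading coefficients multiply to 1 modulo
  \<open>p ^ n\<close>. So h3 inverts g1, and the linear factor has the root -g0 h3.\<close>

lemma full_root_of_factors:
  assumes "int p ^ n dvd g1 * h3 - 1" "int p ^ n dvd g0 * h3 + g1 * h2 - c3"
    "int p ^ n dvd g0 * h2 + g1 * h1 - c2" "int p ^ n dvd g0 * h1 + g1 * h0 - c1" "int p ^ n dvd g0 * h0 - c0"
  shows "full_root n c3 c2 c1 c0"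
proof -
  let ?x = "- g0 * h3"
  have "quartic c3 c2 c1 c0 ?x = (g1 * h3 - 1) * (- g0 * (h3 * ?x ^ 3 + h2 * ?x ^ 2 + h1 * ?x + h0) - ?x ^ 4)
    - (g0 * h3 + g1 * h2 - c3) * ?x ^ 3 - (g0 * h2 + g1 * h1 - c2) * ?x ^ 2
    - (g0 * h1 + g1 * h0 - c1) * ?x - (g0 * h0 - c0)"
    by (simp add: ring_expand)
  then show ?thesis unfolding full_root_def using assms by (metis dvd_diff dvd_mult2)
qed

text \<open>Each factor becomes monic when multiplied by the leading coefficient of the
  other.\<close>

lemma full_quad_of_factors:
  assumes "int p ^ n dvd g2 * h2 - 1" "int p ^ n dvd g1 * h2 + g2 * h1 - c3"
    "int p ^ n dvd g0 * h2 + g1 * h1 + g2 * h0 - c2" "int p ^ n dvd g0 * h1 + g1 * h0 - c1" "int p ^ n dvd g0 * h0 - c0"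
  shows "full_quad n c3 c2 c1 c0"
proof -
  define s t u v where "s = g1 * h2" and "t = g0 * h2" and "u = h1 * g2" and "v = h0 * g2"
  have "s + u - c3 = g1 * h2 + g2 * h1 - c3"
    "t + v + s * u - c2 = (g0 * h2 + g1 * h1 + g2 * h0 - c2) + (g2 * h2 - 1) * (g1 * h1)"
    "s * v + t * u - c1 = (g0 * h1 + g1 * h0 - c1) + (g2 * h2 - 1) * (g0 * h1 + g1 * h0)"
    "t * v - c0 = (g0 * h0 - c0) + (g2 * h2 - 1) * (g0 * h0)"
    by (simp_all add: s_def t_def u_def v_def ring_expand)
  then have "int p ^ n dvd s + u - c3" "int p ^ n dvd t + v + s * u - c2"
    "int p ^ n dvd s * v + t * u - c1" "int p ^ n dvd t * v - c0"
    using assms by (metis dvd_add dvd_mult2)+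
  then show ?thesis unfolding full_quad_def by blast
qed

lemma coeff_quartic_list:
  "Zp.coeff [c4, c3, c2, c1, c0] = (\<lambda>k. if k = 4 then c4 else if k = 3 then c3 else if k = 2 then c2 else
     if k = 1 then c1 else if k = 0 then c0 else (\<lambda>n. 0))"
  by (auto simp: fun_eq_iff numeral_eq_Suc)

abbreviation monic_list :: "(nat \<Rightarrow> int) \<Rightarrow> (nat \<Rightarrow> int) \<Rightarrow> (nat \<Rightarrow> int) \<Rightarrow> (nat \<Rightarrow> int) \<Rightarrow> (nat \<Rightarrow> int) list" where
  "monic_list c3 c2 c1 c0 \<equiv> [\<one>\<^bsub>Zp\<^esub>, c3, c2, c1, c0]"

abbreviation Zp_poly :: "(nat \<Rightarrow> int) list \<Rightarrow> bool" where
  "Zp_poly \<equiv> polynomial\<^bsub>Zp\<^esub> (carrier Zp)"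

lemma full_red_if_product:
  assumes g: "Zp_poly g" and h: "Zp_poly h"
    and deg: "Polynomials.degree g \<ge> 1" "Polynomials.degree h \<ge> 1"
    and f: "monic_list c3 c2 c1 c0 = Zp.poly_mult g h"
  shows "full_red n (c3 n) (c2 n) (c1 n) (c0 n)"
proof -
  have set: "set g \<subseteq> carrier Zp" "set h \<subseteq> carrier Zp" using g h by (simp_all add: polynomial_def) auto
  have "g \<noteq> []" "h \<noteq> []" using deg by auto
  then have d4: "Polynomials.degree g + Polynomials.degree h = 4"
    using Zp.poly_mult_degree_eq[OF Zp.carrier_is_subring g h] unfolding f[symmetric] by simp
  let ?G = "\<lambda>i. Zp.coeff g i n" and ?H = "\<lambda>i. Zp.coeff h i n"
  have E: "int p ^ n dvd (\<Sum>i\<le>k. ?G i * ?H (k - i)) - Zp.coeff (monic_list c3 c2 c1 c0) k n" for k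
    unfolding f coeff_poly_mult_Zp[OF set] by (simp add: mod_eq_dvd_iff[symmetric])
  have Gz: "?G i = 0" if "i > Polynomials.degree g" for i using Zp.coeff_degree[of g i] that by simp
  have Hz: "?H i = 0" if "i > Polynomials.degree h" for i using Zp.coeff_degree[of h i] that by simp
  have "int p ^ n dvd z - 1 mod int p ^ n \<longleftrightarrow> int p ^ n dvd z - 1" for z
    by (simp add: mod_eq_dvd_iff[symmetric])
  then have E4: "int p ^ n dvd (?G 0 * ?H 4 + ?G 1 * ?H 3 + ?G 2 * ?H 2 + ?G 3 * ?H 1 + ?G 4 * ?H 0) - 1"
    using E[of 4] by (simp add: coeff_quartic_list eval_nat_numeral)
  have E3: "int p ^ n dvd (?G 0 * ?H 3 + ?G 1 * ?H 2 + ?G 2 * ?H 1 + ?G 3 * ?H 0) - c3 n"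
    using E[of 3] by (simp add: coeff_quartic_list eval_nat_numeral)
  have E2: "int p ^ n dvd (?G 0 * ?H 2 + ?G 1 * ?H 1 + ?G 2 * ?H 0) - c2 n"
    using E[of 2] by (simp add: coeff_quartic_list eval_nat_numeral)
  have E1: "int p ^ n dvd (?G 0 * ?H 1 + ?G 1 * ?H 0) - c1 n"
    using E[of 1] by (simp add: coeff_quartic_list eval_nat_numeral)
  have E0: "int p ^ n dvd ?G 0 * ?H 0 - c0 n"
    using E[of 0] by (simp add: coeff_quartic_list)
  consider "Polynomials.degree g = 1" "Polynomials.degree h = 3" | "Polynomials.degree g = 2" "Polynomials.degree h = 2"
    | "Polynomials.degree g = 3" "Polynomials.degree h = 1"
    using d4 deg by linarith
  then show ?thesis
  proof cases
    case 1
    then have z: "?G 2 = 0" "?G 3 = 0" "?G 4 = 0" "?H 4 = 0" using Gz Hz by simp_all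
    have "full_root n (c3 n) (c2 n) (c1 n) (c0 n)"
      using E4 E3 E2 E1 E0 full_root_of_factors[of n "?G 1" "?H 3" "?G 0" "?H 2" "c3 n" "?H 1" "c2 n" "?H 0"]
      by (simp add: z)
    then show ?thesis by (simp add: full_red_def)
  next
    case 2
    then have z: "?G 3 = 0" "?G 4 = 0" "?H 3 = 0" "?H 4 = 0" using Gz Hz by simp_all
    have "full_quad n (c3 n) (c2 n) (c1 n) (c0 n)"
      using E4 E3 E2 E1 E0 full_quad_of_factors[of n "?G 2" "?H 2" "?G 1" "?H 1" "c3 n" "?G 0" "?H 0"]
      by (simp add: z)
    then show ?thesis by (simp add: full_red_def)
  next
    case 3
    then have z: "?H 2 = 0" "?H 3 = 0" "?H 4 = 0" "?G 4 = 0" using Gz Hz by simp_all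
    have "full_root n (c3 n) (c2 n) (c1 n) (c0 n)"
      using E4 E3 E2 E1 E0 full_root_of_factors[of n "?H 1" "?G 3" "?H 0" "?G 2" "c3 n" "?G 1" "c2 n" "?G 0"]
      by (simp add: z mult.commute add.commute)
    then show ?thesis by (simp add: full_red_def)
  qed
qed

lemma product_if_coeffs:
  assumes g: "Zp_poly g" and h: "Zp_poly h"
    and ne: "g \<noteq> []" "h \<noteq> []" and deg: "Polynomials.degree g + Polynomials.degree h = 4"
    and c: "c3 \<in> carrier Zp" "c2 \<in> carrier Zp" "c1 \<in> carrier Zp" "c0 \<in> carrier Zp"
    and E: "\<And>k n. k \<le> 4 \<Longrightarrow> (\<Sum>i\<le>k. Zp.coeff g i n * Zp.coeff h (k - i) n) mod int p ^ n =
      Zp.coeff (monic_list c3 c2 c1 c0) k n"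
  shows "monic_list c3 c2 c1 c0 = Zp.poly_mult g h"
proof -
  have set: "set g \<subseteq> carrier Zp" "set h \<subseteq> carrier Zp" using g h by (simp_all add: polynomial_def) auto
  have f: "Zp_poly (monic_list c3 c2 c1 c0)"
    unfolding polynomial_def using c Zp.one_closed Zp.one_not_zero by (simp del: Zp_simps)
  have gh: "Zp_poly (Zp.poly_mult g h)"
    by (rule Zp.poly_mult_is_polynomial[OF Zp.carrier_is_subring set])
  have "Zp.coeff (monic_list c3 c2 c1 c0) k = Zp.coeff (Zp.poly_mult g h) k" for k
  proof (cases "k \<le> 4")
    case True
    then show ?thesis unfolding coeff_poly_mult_Zp[OF set] using E by (simp add: fun_eq_iff)
  next
    case False
    have "Polynomials.degree (Zp.poly_mult g h) = 4"
      using Zp.poly_mult_degree_eq[OF Zp.carrier_is_subring g h] ne deg by simp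
    then have "Zp.coeff (Zp.poly_mult g h) k = \<zero>\<^bsub>Zp\<^esub>" using False by (intro Zp.coeff_degree) simp
    moreover have "Zp.coeff (monic_list c3 c2 c1 c0) k = \<zero>\<^bsub>Zp\<^esub>" using False by (intro Zp.coeff_degree) simp
    ultimately show ?thesis by simp
  qed
  then show ?thesis using Zp.coeff_iff_polynomial_cond[OF f gh] by blast
qed

lemma full_red_mono: "m \<le> n \<Longrightarrow> full_red n c3 c2 c1 c0 \<Longrightarrow> full_red m c3 c2 c1 c0"
  unfolding full_red_def using full_root_mono full_quad_mono by blast

definition monic_coeff :: "nat \<Rightarrow> (nat \<Rightarrow> int) \<Rightarrow> nat \<Rightarrow> int" where
  "monic_coeff a x i = (if i < a then x i else of_bool (i = a))"

text \<open>Both monic factors are packed into one vector: entries below \<open>a\<close> are the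
  lower coefficients of the first, the remaining \<open>4 - a\<close> those of the second. Solutions
  modulo \<open>p ^ n\<close> can then be taken from a finite set of vectors, as the inverse limit
  argument requires.\<close>

definition factors :: "nat \<Rightarrow> nat \<Rightarrow> (nat \<Rightarrow> int) \<Rightarrow> (nat \<Rightarrow> int) \<Rightarrow> bool" where
  "factors a n f x \<longleftrightarrow> (\<forall>k\<le>4. [(\<Sum>i\<le>k. monic_coeff a x i * monic_coeff (4 - a) (\<lambda>j. x (j + a)) (k - i)) = f k] (mod int p ^ n))"

lemma factors_cong:
  assumes "a \<le> 4" "\<And>i. i < 4 \<Longrightarrow> [x i = y i] (mod int p ^ n)" "\<And>k. k \<le> 4 \<Longrightarrow> [f k = f' k] (mod int p ^ n)"
    and "factors a n f x"
  shows "factors a n f' y"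
  unfolding factors_def
proof (intro allI impI)
  fix k :: nat assume "k \<le> 4"
  have 1: "[(\<Sum>i\<le>k. monic_coeff a y i * monic_coeff (4 - a) (\<lambda>j. y (j + a)) (k - i)) =
      (\<Sum>i\<le>k. monic_coeff a x i * monic_coeff (4 - a) (\<lambda>j. x (j + a)) (k - i))] (mod int p ^ n)"
    using assms(1,2) by (intro cong_sum cong_mult) (auto simp: monic_coeff_def cong_sym)
  show "[(\<Sum>i\<le>k. monic_coeff a y i * monic_coeff (4 - a) (\<lambda>j. y (j + a)) (k - i)) = f' k] (mod int p ^ n)"
    using assms(3)[OF \<open>k \<le> 4\<close>] assms(4) \<open>k \<le> 4\<close> cong_trans[OF 1] cong_trans unfolding factors_def by blast
qed

lemma factors_if_full_root:
  assumes "full_root n (c3 n) (c2 n) (c1 n) (c0 n)"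
  shows "\<exists>x. factors 1 n (\<lambda>k. Zp.coeff (monic_list c3 c2 c1 c0) k n) x"
proof -
  obtain z where z: "int p ^ n dvd quartic (c3 n) (c2 n) (c1 n) (c0 n) z" using assms by (auto simp: full_root_def)
  \<comment> \<open>Horner's scheme: X^3 + tX^2 + uX + v is the quotient by X - z.\<close>
  define t u v where "t = c3 n + z" and "u = c2 n + z * t" and "v = c1 n + z * u"
  let ?x = "\<lambda>i. if i = 0 then - z else if i = 1 then v else if i = 2 then u else t"
  have "- z * v - c0 n = - quartic (c3 n) (c2 n) (c1 n) (c0 n) z"
    by (simp add: t_def u_def v_def ring_expand)
  then have "[- z * v = c0 n] (mod int p ^ n)" using z by (metis cong_iff_dvd_diff dvd_minus_iff)
  then have "factors 1 n (\<lambda>k. Zp.coeff (monic_list c3 c2 c1 c0) k n) ?x"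
    by (auto simp: factors_def monic_coeff_def coeff_quartic_list le_Suc_eq eval_nat_numeral t_def u_def v_def cong_def
        simp del: Zp.coeff.simps)
  then show ?thesis by blast
qed

lemma factors_if_full_quad:
  assumes "full_quad n (c3 n) (c2 n) (c1 n) (c0 n)"
  shows "\<exists>x. factors 2 n (\<lambda>k. Zp.coeff (monic_list c3 c2 c1 c0) k n) x"
proof -
  obtain s t u v where "[s + u = c3 n] (mod int p ^ n)" "[t + v + s * u = c2 n] (mod int p ^ n)"
    "[s * v + t * u = c1 n] (mod int p ^ n)" "[t * v = c0 n] (mod int p ^ n)"
    using assms by (auto simp: full_quad_def cong_iff_dvd_diff)
  then have "factors 2 n (\<lambda>k. Zp.coeff (monic_list c3 c2 c1 c0) k n)
      (\<lambda>i. if i = 0 then t else if i = 1 then s else if i = 2 then v else u)"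
    by (auto simp: factors_def monic_coeff_def coeff_quartic_list le_Suc_eq eval_nat_numeral cong_def add_ac
        simp del: Zp.coeff.simps)
  then show ?thesis by blast
qed

text \<open>Compactness: reduced solutions form finite nonempty sets, reduction maps each level to
  the one below, and a point of the inverse limit is a solution over Z_p.\<close>

lemma Zp_factors:
  assumes c: "c3 \<in> carrier Zp" "c2 \<in> carrier Zp" "c1 \<in> carrier Zp" "c0 \<in> carrier Zp" and a: "a \<le> 4"
    and ex: "\<And>n. \<exists>x. factors a n (\<lambda>k. Zp.coeff (monic_list c3 c2 c1 c0) k n) x"
  shows "\<exists>Y. (\<forall>i<4. Y i \<in> carrier Zp) \<and> (\<forall>n. factors a n (\<lambda>k. Zp.coeff (monic_list c3 c2 c1 c0) k n) (\<lambda>i. Y i n))"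
proof -
  let ?F = "\<lambda>n k. Zp.coeff (monic_list c3 c2 c1 c0) k n"
  define T where "T n = {x \<in> {..<4::nat} \<rightarrow>\<^sub>E {0..<int p ^ n}. factors a n (?F n) x}" for n
  define r where "r n x = restrict (\<lambda>i. x i mod int p ^ n) {..<4::nat}" for n and x :: "nat \<Rightarrow> int"
  have r: "r n x \<in> T n" if "factors a n (?F n) x" for n x
  proof -
    have "factors a n (?F n) (r n x)"
      by (rule factors_cong[OF a _ _ that]) (auto simp: r_def cong_def)
    then show ?thesis
      using pos_mod_sign[OF p_pos(3)] pos_mod_bound[OF p_pos(3)] by (simp add: T_def r_def)
  qed
  have "\<exists>y. \<forall>n. y n \<in> T n \<and> r n (y (Suc n)) = y n"
  proof (rule inverse_limit_nonempty)
    show "finite (T n)" for n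
      by (rule finite_subset[of _ "{..<4} \<rightarrow>\<^sub>E {0..<int p ^ n}"]) (auto simp: T_def intro: finite_PiE)
    show "T n \<noteq> {}" for n using ex r by blast
    show "r n x \<in> T n" if "x \<in> T (Suc n)" for n x
    proof (rule r, rule factors_cong[OF a])
      show "factors a n (?F (Suc n)) x"
        using that unfolding T_def factors_def cong_iff_dvd_diff using power_dvd_mono[of n "Suc n"] by auto
      have "Zp.coeff (monic_list c3 c2 c1 c0) k \<in> carrier Zp" for k
        using c Zp.one_closed by (intro Zp.coeff_in_carrier) auto
      then show "[?F (Suc n) k = ?F n k] (mod int p ^ n)" for k
        unfolding cong_def by (rule Zp_Suc)
    qed simp
  qed
  then obtain y where y: "\<And>n. y n \<in> T n" "\<And>n. r n (y (Suc n)) = y n" by blast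
  have "(\<lambda>n. y n i) \<in> carrier Zp" if "i < 4" for i
  proof -
    have "y n \<in> {..<4} \<rightarrow>\<^sub>E {0..<int p ^ n}" for n using y(1)[of n] unfolding T_def by blast
    then have "y n i \<in> {0..<int p ^ n}" for n using that PiE_mem by blast
    moreover have "y (Suc n) i mod int p ^ n = y n i" for n
      using fun_cong[OF y(2)[of n], of i] that by (simp add: r_def)
    ultimately show ?thesis by (simp add: carrier_Zp)
  qed
  then show ?thesis using y(1) by (intro exI[of _ "\<lambda>i n. y n i"]) (simp add: T_def)
qed

lemma coeff_monic_list:
  "Zp.coeff (\<one>\<^bsub>Zp\<^esub> # rev (map Y [0..<a])) i = (if i < a then Y i else if i = a then \<one>\<^bsub>Zp\<^esub> else \<zero>\<^bsub>Zp\<^esub>)"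
proof (cases "i < Suc a")
  case True
  then show ?thesis
    using Zp.coeff_nth[of i "\<one>\<^bsub>Zp\<^esub> # rev (map Y [0..<a])"] by (auto simp: nth_Cons' rev_nth)
next
  case False
  then show ?thesis using Zp.coeff_length[of "\<one>\<^bsub>Zp\<^esub> # rev (map Y [0..<a])" i] by simp
qed

lemma product_if_factors:
  assumes c: "c3 \<in> carrier Zp" "c2 \<in> carrier Zp" "c1 \<in> carrier Zp" "c0 \<in> carrier Zp"
    and a: "1 \<le> a" "a \<le> 3" and Y: "\<And>i. i < 4 \<Longrightarrow> Y i \<in> carrier Zp"
    and fac: "\<And>n. factors a n (\<lambda>k. Zp.coeff (monic_list c3 c2 c1 c0) k n) (\<lambda>i. Y i n)"
  shows "\<exists>g h. Zp_poly g \<and> Zp_poly h \<and>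
    Polynomials.degree g \<ge> 1 \<and> Polynomials.degree h \<ge> 1 \<and> monic_list c3 c2 c1 c0 = Zp.poly_mult g h"
proof -
  define g where "g = \<one>\<^bsub>Zp\<^esub> # rev (map Y [0..<a])"
  define h where "h = \<one>\<^bsub>Zp\<^esub> # rev (map (\<lambda>j. Y (j + a)) [0..<4 - a])"
  have monic: "Zp_poly (\<one>\<^bsub>Zp\<^esub> # xs)" if "set xs \<subseteq> carrier Zp" for xs
    unfolding polynomial_def using that Zp.one_closed Zp.one_not_zero by (simp del: Zp_simps)
  have gh: "Zp_poly g" "Zp_poly h" unfolding g_def h_def using Y a by (intro monic; auto)+
  have deg: "Polynomials.degree g = a" "Polynomials.degree h = 4 - a" by (simp_all add: g_def h_def)
  have "monic_list c3 c2 c1 c0 = Zp.poly_mult g h"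
  proof (rule product_if_coeffs[OF gh _ _ _ c])
    fix k n :: nat assume k: "k \<le> 4"
    let ?S = "\<Sum>i\<le>k. Zp.coeff g i n * Zp.coeff h (k - i) n"
    have 1: "[?S = (\<Sum>i\<le>k. monic_coeff a (\<lambda>i. Y i n) i * monic_coeff (4 - a) (\<lambda>j. Y (j + a) n) (k - i))] (mod int p ^ n)"
      unfolding g_def h_def coeff_monic_list by (intro cong_sum cong_mult) (auto simp: monic_coeff_def cong_def)
    have "[?S = Zp.coeff (monic_list c3 c2 c1 c0) k n] (mod int p ^ n)"
      using fac[of n] k cong_trans[OF 1] unfolding factors_def by blast
    then have "?S mod int p ^ n = Zp.coeff (monic_list c3 c2 c1 c0) k n mod int p ^ n"
      by (simp only: cong_def)
    also have "\<dots> = Zp.coeff (monic_list c3 c2 c1 c0) k n"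
      using c Zp.one_closed by (intro Zp_mod Zp.coeff_in_carrier) auto
    finally show "?S mod int p ^ n = Zp.coeff (monic_list c3 c2 c1 c0) k n" .
  qed (use a deg in \<open>auto simp: g_def h_def\<close>)
  moreover have "Polynomials.degree g \<ge> 1" "Polynomials.degree h \<ge> 1" using a deg by simp_all
  ultimately show ?thesis using gh by blast
qed

lemma irreducible_iff:
  assumes c: "c3 \<in> carrier Zp" "c2 \<in> carrier Zp" "c1 \<in> carrier Zp" "c0 \<in> carrier Zp"
  shows "padic_poly_irreducible p (monic_list c3 c2 c1 c0) \<longleftrightarrow>
    \<not> (\<forall>n. full_red n (c3 n) (c2 n) (c1 n) (c0 n))"
proof -
  let ?f = "monic_list c3 c2 c1 c0"
  let ?fac = "\<exists>g h. Zp_poly g \<and> Zp_poly h \<and>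
    Polynomials.degree g \<ge> 1 \<and> Polynomials.degree h \<ge> 1 \<and> ?f = Zp.poly_mult g h"
  have "padic_poly_irreducible p ?f \<longleftrightarrow> \<not> ?fac"
    unfolding padic_poly_irreducible_def Bex_def univ_poly_mult univ_poly_carrier[symmetric]
    by (intro arg_cong[of _ _ Not] iffI; elim exE conjE; intro exI conjI; assumption)
  moreover have "?fac \<longleftrightarrow> (\<forall>n. full_red n (c3 n) (c2 n) (c1 n) (c0 n))"
  proof
    assume ?fac
    then show "\<forall>n. full_red n (c3 n) (c2 n) (c1 n) (c0 n)" using full_red_if_product by blast
  next
    assume R: "\<forall>n. full_red n (c3 n) (c2 n) (c1 n) (c0 n)"
    have cong: "int p ^ m dvd a n - a m" if "a \<in> carrier Zp" "m \<le> n" for a m n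
      using Zp_le[OF that] Zp_mod[OF that(1), of m] by (simp add: mod_eq_dvd_iff[symmetric])
    have down: "full_root m (c3 n) (c2 n) (c1 n) (c0 n) \<longleftrightarrow> full_root m (c3 m) (c2 m) (c1 m) (c0 m)"
      "full_quad m (c3 n) (c2 n) (c1 n) (c0 n) \<longleftrightarrow> full_quad m (c3 m) (c2 m) (c1 m) (c0 m)" if "m \<le> n" for m n
      using that c cong by (intro full_root_cong full_quad_cong; blast)+
    \<comment> \<open>The kind of factorization may vary with n, but if each kind failed at some
      level, both would fail at the larger of the two levels.\<close>
    have "(\<forall>n. full_root n (c3 n) (c2 n) (c1 n) (c0 n)) \<or> (\<forall>n. full_quad n (c3 n) (c2 n) (c1 n) (c0 n))"
    proof (rule ccontr)
      assume "\<not> ?thesis"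
      then obtain k l where kl: "\<not> full_root k (c3 k) (c2 k) (c1 k) (c0 k)" "\<not> full_quad l (c3 l) (c2 l) (c1 l) (c0 l)"
        by blast
      let ?n = "max k l"
      have "full_root ?n (c3 ?n) (c2 ?n) (c1 ?n) (c0 ?n) \<or> full_quad ?n (c3 ?n) (c2 ?n) (c1 ?n) (c0 ?n)"
        using R by (simp add: full_red_def)
      then show False
        using kl down(1)[of k ?n] down(2)[of l ?n] full_root_mono[of k ?n] full_quad_mono[of l ?n] by auto
    qed
    then show ?fac
    proof
      assume "\<forall>n. full_root n (c3 n) (c2 n) (c1 n) (c0 n)"
      then obtain Y where "\<And>i. i < 4 \<Longrightarrow> Y i \<in> carrier Zp"
        "\<And>n. factors 1 n (\<lambda>k. Zp.coeff (monic_list c3 c2 c1 c0) k n) (\<lambda>i. Y i n)"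
        using Zp_factors[OF c, of 1] factors_if_full_root one_le_numeral by blast
      then show ?fac by (intro product_if_factors[OF c, of 1 Y] order_refl one_le_numeral)
    next
      assume "\<forall>n. full_quad n (c3 n) (c2 n) (c1 n) (c0 n)"
      then obtain Y where Y: "\<And>i. i < 4 \<Longrightarrow> Y i \<in> carrier Zp"
        "\<And>n. factors 2 n (\<lambda>k. Zp.coeff (monic_list c3 c2 c1 c0) k n) (\<lambda>i. Y i n)"
        using Zp_factors[OF c, of 2] factors_if_full_quad by fastforce
      show ?fac by (rule product_if_factors[OF c _ _ Y]) simp_all
    qed
  qed
  ultimately show ?thesis by blast
qed

text \<open>The digit space contains sequences with digits not below \<open>p\<close>, whose lists
  may leave the ring. They form a null set, but the event must be known there too in order to be
  measurable.\<close>

lemma irreducible_if_not_carrier: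
  assumes "\<not> {c3, c2, c1, c0} \<subseteq> carrier Zp"
  shows "padic_poly_irreducible p (monic_list c3 c2 c1 c0)"
  unfolding padic_poly_irreducible_def
proof (intro notI, elim bexE conjE)
  fix g h assume gh: "g \<in> carrier (univ_poly Zp (carrier Zp))" "h \<in> carrier (univ_poly Zp (carrier Zp))"
    and f: "monic_list c3 c2 c1 c0 = g \<otimes>\<^bsub>univ_poly Zp (carrier Zp)\<^esub> h"
  have "set g \<subseteq> carrier Zp" "set h \<subseteq> carrier Zp"
    using gh unfolding univ_poly_carrier[symmetric] by (simp_all add: polynomial_def) auto
  then have "set (monic_list c3 c2 c1 c0) \<subseteq> carrier Zp"
    unfolding f univ_poly_mult by (rule Zp.poly_mult_in_carrier)
  then show False using assms by simp
qed

subsection \<open>Haar measure via digits\<close>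

abbreviation digit_pmf :: "nat pmf" where "digit_pmf \<equiv> pmf_of_set {0..<p}"

lemma p_gt0: "0 < p"
  using prime_gt_0_nat prime_nat by blast

sublocale digits: product_prob_space "\<lambda>_. measure_pmf digit_pmf" "UNIV :: (nat \<times> nat) set"
  by unfold_locales

lemma digit_space_eq: "digit_space p = PiM UNIV (\<lambda>_. measure_pmf digit_pmf)"
  by (simp add: digit_space_def)

lemma space_digit_space [simp]: "space (digit_space p) = UNIV"
  by (simp add: digit_space_def space_PiM)

sublocale digit_prob: prob_space "digit_space p"
  unfolding digit_space_eq by (rule digits.prob_space_axioms)

definition trunc :: "nat \<Rightarrow> nat \<Rightarrow> (nat \<times> nat \<Rightarrow> nat) \<Rightarrow> int" where
  "trunc i n d = padic_of_digits p (\<lambda>k. d (i, k)) n"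

lemma trunc_0 [simp]: "trunc i 0 d = 0"
  by (simp add: trunc_def padic_of_digits_def)

lemma trunc_Suc: "trunc i (Suc n) d = trunc i n d + int (d (i, n)) * int p ^ n"
  by (simp add: trunc_def padic_of_digits_def)

lemma measurable_digit: "(\<lambda>d. d j) \<in> measurable (digit_space p) (count_space UNIV)"
proof -
  have "(\<lambda>d. d j) \<in> measurable (digit_space p) (measure_pmf digit_pmf)"
    unfolding digit_space_eq by (rule measurable_component_singleton) simp
  then show ?thesis by simp
qed

lemma measurable_trunc: "trunc i n \<in> measurable (digit_space p) (count_space UNIV)"
proof (induction n)
  case (Suc n)
  have "(\<lambda>d. z + int (d (i, n)) * int p ^ n) \<in> measurable (digit_space p) (count_space UNIV)" for z
    using measurable_compose[OF measurable_digit, of "\<lambda>x. z + int x * int p ^ n" "count_space UNIV" "(i, n)"] by simp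
  from measurable_compose_countable[OF this Suc]
  show ?case by (simp add: trunc_Suc[abs_def])
qed simp

definition trunc_event :: "nat \<Rightarrow> (int \<Rightarrow> int \<Rightarrow> int \<Rightarrow> int \<Rightarrow> bool) \<Rightarrow> (nat \<times> nat \<Rightarrow> nat) set" where
  "trunc_event n Q = {d. Q (trunc 3 n d) (trunc 2 n d) (trunc 1 n d) (trunc 0 n d)}"

lemma trunc_event_sets: "trunc_event n Q \<in> sets (digit_space p)"
proof -
  let ?M = "digit_space p" and ?C = "count_space UNIV"
  have "(\<lambda>d. Q c3 c2 c1 (trunc 0 n d)) \<in> measurable ?M ?C" for c3 c2 c1
    by (rule measurable_compose[OF measurable_trunc]) simp
  then have "(\<lambda>d. Q c3 c2 (trunc 1 n d) (trunc 0 n d)) \<in> measurable ?M ?C" for c3 c2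
    by (rule measurable_compose_countable[OF _ measurable_trunc])
  then have "(\<lambda>d. Q c3 (trunc 2 n d) (trunc 1 n d) (trunc 0 n d)) \<in> measurable ?M ?C" for c3
    by (rule measurable_compose_countable[OF _ measurable_trunc])
  then have "(\<lambda>d. Q (trunc 3 n d) (trunc 2 n d) (trunc 1 n d) (trunc 0 n d)) \<in> measurable ?M ?C"
    by (rule measurable_compose_countable[OF _ measurable_trunc])
  from predE[OF this] show ?thesis by (simp add: trunc_event_def)
qed

lemma int_digit_sum: "(\<Sum>k<n. (c div int p ^ k mod int p) * int p ^ k) = c mod int p ^ n"
proof (induction n)
  case (Suc n)
  have "c mod int p ^ Suc n = int p ^ n * (c div int p ^ n mod int p) + c mod int p ^ n"
    using zmod_zmult2_eq[of "int p" c "int p ^ n"] p_gt0 by (simp add: mult.commute)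
  then show ?case using Suc by simp
qed simp

definition select :: "int \<times> int \<times> int \<times> int \<Rightarrow> nat \<Rightarrow> int" where
  "select = (\<lambda>(c3, c2, c1, c0) i. if i = 3 then c3 else if i = 2 then c2 else if i = 1 then c1 else c0)"

definition digit_cylinder :: "nat \<Rightarrow> int \<times> int \<times> int \<times> int \<Rightarrow> (nat \<times> nat \<Rightarrow> nat) set" where
  "digit_cylinder n c =
     {d. \<forall>j\<in>{..<4} \<times> {..<n}. d j \<in> {nat (select c (fst j) div int p ^ snd j mod int p)}}"

lemma measure_digit_cylinder: "digit_prob.prob (digit_cylinder n c) = 1 / real p ^ (4 * n)"
proof -
  let ?J = "{..<4} \<times> {..<n} :: (nat \<times> nat) set"
  let ?X = "\<lambda>j. {nat (select c (fst j) div int p ^ snd j mod int p)}"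
  have "emeasure (digit_space p) (digit_cylinder n c) = (\<Prod>j\<in>?J. emeasure (measure_pmf digit_pmf) (?X j))"
    using digits.emeasure_PiM_Collect[of ?J ?X]
    by (simp add: digit_cylinder_def digit_space_eq space_PiM)
  also have "\<dots> = (\<Prod>j\<in>?J. ennreal (1 / p))"
  proof (intro prod.cong refl)
    fix j assume "j \<in> ?J"
    have "nat (select c (fst j) div int p ^ snd j mod int p) < p"
      using pos_mod_bound[of "int p"] pos_mod_sign[of "int p"] p_gt0 by (simp add: nat_less_iff)
    then show "emeasure (measure_pmf digit_pmf) (?X j) = ennreal (1 / p)"
      using p_gt0 by (simp add: emeasure_pmf_single)
  qed
  also have "\<dots> = ennreal ((1 / p) ^ (4 * n))"
    by (simp add: ennreal_power card_cartesian_product)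
  finally show ?thesis by (simp add: measure_def power_one_over)
qed

lemma digit_cylinder_sets: "digit_cylinder n c \<in> sets (digit_space p)"
proof -
  let ?J = "{..<4} \<times> {..<n} :: (nat \<times> nat) set"
  let ?X = "\<lambda>j. {nat (select c (fst j) div int p ^ snd j mod int p)}"
  have "{d \<in> space (digit_space p). \<forall>j\<in>?J. d j \<in> ?X j} \<in> sets (digit_space p)"
  proof (rule sets.sets_Collect_finite_All)
    show "{d \<in> space (digit_space p). d j \<in> ?X j} \<in> sets (digit_space p)" for j
      using measurable_sets[OF measurable_digit, of "?X j" j] by (simp add: vimage_def)
  qed auto
  then show ?thesis by (simp add: digit_cylinder_def)
qed

lemma trunc_digit_cylinder:
  assumes "d \<in> digit_cylinder n c" "i < 4"
  shows "trunc i n d = select c i mod int p ^ n"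
proof -
  have "int (d (i, k)) = select c i div int p ^ k mod int p" if "k < n" for k
    using assms that pos_mod_sign[of "int p"] p_gt0 by (auto simp: digit_cylinder_def)
  then have "trunc i n d = (\<Sum>k<n. (select c i div int p ^ k mod int p) * int p ^ k)"
    by (simp add: trunc_def padic_of_digits_def)
  then show ?thesis by (simp add: int_digit_sum)
qed

text \<open>Because of points with digits not below \<open>p\<close>, the cylinders over the good
  residue vectors need not exhaust the event, which gives an inequality only. Applied to the
  complement as well, it yields the equality \<open>prob_trunc_event\<close>.\<close>

lemma mean4_le_prob:
  "mean4 n (\<lambda>c3 c2 c1 c0. of_bool (Q c3 c2 c1 c0)) \<le> digit_prob.prob (trunc_event n Q)"
proof -
  let ?I = "{0..<int p ^ n}"
  let ?C = "{(c3, c2, c1, c0). c3 \<in> ?I \<and> c2 \<in> ?I \<and> c1 \<in> ?I \<and> c0 \<in> ?I \<and> Q c3 c2 c1 c0}"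
  have fin: "finite ?C" by (rule finite_subset[of _ "?I \<times> ?I \<times> ?I \<times> ?I"]) auto
  have tr: "trunc 3 n d = c3" "trunc 2 n d = c2" "trunc 1 n d = c1" "trunc 0 n d = c0"
    if "(c3, c2, c1, c0) \<in> ?C" "d \<in> digit_cylinder n (c3, c2, c1, c0)" for c3 c2 c1 c0 d
    using that trunc_digit_cylinder[OF that(2)] by (simp_all add: select_def)
  have tr': "(trunc 3 n d, trunc 2 n d, trunc 1 n d, trunc 0 n d) = c" if "c \<in> ?C" "d \<in> digit_cylinder n c" for c d
    using that tr by (cases c) simp
  have "disjoint_family_on (digit_cylinder n) ?C"
    unfolding disjoint_family_on_def
  proof (intro ballI impI)
    fix c c' assume c: "c \<in> ?C" "c' \<in> ?C" "c \<noteq> c'"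
    show "digit_cylinder n c \<inter> digit_cylinder n c' = {}"
      using tr'[OF c(1)] tr'[OF c(2)] c(3) by blast
  qed
  then have "digit_prob.prob (\<Union>c\<in>?C. digit_cylinder n c) = (\<Sum>c\<in>?C. digit_prob.prob (digit_cylinder n c))"
    using fin digit_cylinder_sets by (intro digit_prob.finite_measure_finite_Union) auto
  also have "\<dots> = card ?C / real p ^ (4 * n)"
    by (simp add: measure_digit_cylinder)
  also have "\<dots> = mean4 n (\<lambda>c3 c2 c1 c0. of_bool (Q c3 c2 c1 c0))"
    unfolding mean4_card by (simp add: power_mult mult.commute flip: power_mult)
  finally have "mean4 n (\<lambda>c3 c2 c1 c0. of_bool (Q c3 c2 c1 c0)) = digit_prob.prob (\<Union>c\<in>?C. digit_cylinder n c)" ..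
  also have "\<dots> \<le> digit_prob.prob (trunc_event n Q)"
  proof (intro digit_prob.finite_measure_mono trunc_event_sets UN_least subsetI)
    fix c d assume c: "c \<in> ?C" "d \<in> digit_cylinder n c"
    then show "d \<in> trunc_event n Q" using tr'[OF c] by (auto simp: trunc_event_def)
  qed
  finally show ?thesis .
qed

lemma prob_trunc_event:
  "digit_prob.prob (trunc_event n Q) = mean4 n (\<lambda>c3 c2 c1 c0. of_bool (Q c3 c2 c1 c0))"
proof -
  let ?m = "\<lambda>Q. mean4 n (\<lambda>c3 c2 c1 c0. of_bool (Q c3 c2 c1 c0))"
  let ?nQ = "\<lambda>c3 c2 c1 c0. \<not> Q c3 c2 c1 c0"
  have "?m Q + ?m ?nQ = mean4 n (\<lambda>c3 c2 c1 c0. of_bool (Q c3 c2 c1 c0) + of_bool (?nQ c3 c2 c1 c0))"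
    by (simp only: mean4_def mean3_add mean_add)
  also have "(\<lambda>c3 c2 c1 c0. of_bool (Q c3 c2 c1 c0) + of_bool (?nQ c3 c2 c1 c0)) = (\<lambda>_ _ _ _. 1 :: real)"
    by (auto simp: fun_eq_iff)
  also have "mean4 n (\<lambda>_ _ _ _. 1 :: real) = 1" by (simp add: mean4_def)
  finally have "?m Q + ?m ?nQ = 1" .
  moreover have "trunc_event n ?nQ = space (digit_space p) - trunc_event n Q"
    by (auto simp: trunc_event_def)
  then have "digit_prob.prob (trunc_event n ?nQ) = 1 - digit_prob.prob (trunc_event n Q)"
    using digit_prob.prob_compl[OF trunc_event_sets] by simp
  ultimately show ?thesis using mean4_le_prob[of n Q] mean4_le_prob[of n ?nQ] by linarith
qed

abbreviation coef :: "nat \<Rightarrow> (nat \<times> nat \<Rightarrow> nat) \<Rightarrow> nat \<Rightarrow> int" where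
  "coef i d \<equiv> padic_of_digits p (\<lambda>k. d (i, k))"

lemma coef_trunc: "coef i d = (\<lambda>n. trunc i n d)"
  by (simp add: trunc_def)

lemma trunc_mod: "int p ^ n dvd trunc i (Suc n) d - trunc i n d"
  by (simp add: trunc_Suc)

lemma coef_in_carrier:
  assumes "\<And>k. d (i, k) < p"
  shows "coef i d \<in> carrier Zp"
proof -
  have nn: "0 \<le> trunc i n d" for n by (simp add: trunc_def padic_of_digits_def sum_nonneg)
  have lt: "trunc i n d < int p ^ n" for n
  proof (induction n)
    case (Suc n)
    have "int (d (i, n)) + 1 \<le> int p" using assms[of n] by linarith
    then have "(int (d (i, n)) + 1) * int p ^ n \<le> int p * int p ^ n" by (intro mult_right_mono) auto
    then show ?case using Suc by (simp add: trunc_Suc algebra_simps)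
  qed simp
  have "trunc i (Suc n) d mod int p ^ n = trunc i n d" for n
    using trunc_mod[of n i d] nn lt by (simp flip: mod_eq_dvd_iff)
  then show ?thesis using nn lt by (simp add: carrier_Zp coef_trunc)
qed

lemma AE_coef_in_carrier: "AE d in digit_space p. \<forall>i. coef i d \<in> carrier Zp"
proof -
  have "AE d in digit_space p. d j < p" for j
  proof -
    have "AE x in measure_pmf digit_pmf. x < p"
      using p_gt0 by (simp add: AE_measure_pmf_iff)
    then show ?thesis unfolding digit_space_eq
      by (intro AE_PiM_component) (auto intro: measure_pmf.prob_space_axioms)
  qed
  then have "AE d in digit_space p. \<forall>j. d j < p" by (simp add: AE_all_countable)
  then show ?thesis by (rule AE_mp) (auto intro!: AE_I2 coef_in_carrier)
qed

lemma coef_carrier_sets: "{d. coef i d \<in> carrier Zp} \<in> sets (digit_space p)"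
proof -
  have "{d \<in> space (digit_space p). 0 \<le> trunc i n d \<and> trunc i n d < int p ^ n \<and> trunc i (Suc n) d mod int p ^ n = trunc i n d}
      \<in> sets (digit_space p)" for n
  proof -
    have "(\<lambda>d. 0 \<le> z \<and> z < int p ^ n \<and> trunc i (Suc n) d mod int p ^ n = z) \<in> measurable (digit_space p) (count_space UNIV)" for z
      by (rule measurable_compose[OF measurable_trunc]) simp
    from measurable_compose_countable[OF this measurable_trunc[of i n]]
    show ?thesis by (rule predE)
  qed
  then have "{d \<in> space (digit_space p). \<forall>n. 0 \<le> trunc i n d \<and> trunc i n d < int p ^ n \<and> trunc i (Suc n) d mod int p ^ n = trunc i n d}
      \<in> sets (digit_space p)" by (rule sets.sets_Collect_countable_All)
  then show ?thesis by (simp add: carrier_Zp coef_trunc)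
qed

text \<open>Continuity from above along the decreasing events \<open>N n\<close>. This also provides
  the convergence that the recursion presupposes.\<close>

lemma irr_density_tendsto_measure:
  "irr_density \<longlonglongrightarrow> measure (digit_space p)
     {d \<in> space (digit_space p). padic_poly_irreducible p (monic_quartic_of_digits p d)}"
proof -
  let ?M = "digit_space p"
  define N where "N n = trunc_event n (full_red n)" for n
  \<comment> \<open>With \<open>C\<close> the irreducible set is exactly, and not only almost
    everywhere, the complement of a measurable set; as \<open>C\<close> has full measure, it drops
    out of the value.\<close>
  define C where "C = (\<Inter>i\<in>{0, 1, 2, 3}. {d. coef i d \<in> carrier Zp})"
  have C: "C \<in> sets ?M" unfolding C_def using coef_carrier_sets by (intro sets.finite_INT) auto
  have N: "N n \<in> sets ?M" for n unfolding N_def by (rule trunc_event_sets)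
  have IN: "(\<Inter>n. N n) \<in> sets ?M" using N by (intro sets.countable_INT) auto
  have irr: "padic_poly_irreducible p (monic_quartic_of_digits p d) \<longleftrightarrow> d \<notin> C \<inter> (\<Inter>n. N n)" for d
  proof (cases "d \<in> C")
    case True
    then have "coef 3 d \<in> carrier Zp" "coef 2 d \<in> carrier Zp" "coef 1 d \<in> carrier Zp" "coef 0 d \<in> carrier Zp"
      by (simp_all add: C_def)
    from irreducible_iff[OF this] show ?thesis
      using True unfolding monic_quartic_of_digits_def by (simp add: N_def trunc_event_def trunc_def del: Zp_simps)
  next
    case False
    then have "\<not> {coef 3 d, coef 2 d, coef 1 d, coef 0 d} \<subseteq> carrier Zp" by (auto simp: C_def)
    from irreducible_if_not_carrier[OF this] show ?thesis
      using False unfolding monic_quartic_of_digits_def by simp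
  qed
  have "decseq N"
  proof (rule decseq_SucI)
    fix n
    have "full_red n (trunc 3 n d) (trunc 2 n d) (trunc 1 n d) (trunc 0 n d)"
      if "full_red (Suc n) (trunc 3 (Suc n) d) (trunc 2 (Suc n) d) (trunc 1 (Suc n) d) (trunc 0 (Suc n) d)" for d
      using full_red_mono[OF _ that, of n] full_red_cong[OF trunc_mod trunc_mod trunc_mod trunc_mod] by simp
    then show "N (Suc n) \<subseteq> N n" by (auto simp: N_def trunc_event_def)
  qed
  then have "(\<lambda>n. measure ?M (N n)) \<longlonglongrightarrow> measure ?M (\<Inter>n. N n)"
    using N by (intro digit_prob.finite_Lim_measure_decseq) auto
  moreover have "measure ?M (N n) = 1 - irr_density n" for n
  proof -
    have "trunc_event n (\<lambda>c3 c2 c1 c0. \<not> full_red n c3 c2 c1 c0) = space ?M - N n"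
      by (auto simp: trunc_event_def N_def)
    then have "irr_density n = 1 - measure ?M (N n)"
      using prob_trunc_event[of n "\<lambda>c3 c2 c1 c0. \<not> full_red n c3 c2 c1 c0"] digit_prob.prob_compl[OF N[of n]]
      by (simp add: irr_density_def mean4_full_red)
    then show ?thesis by simp
  qed
  ultimately have "(\<lambda>n. 1 - (1 - irr_density n)) \<longlonglongrightarrow> 1 - measure ?M (\<Inter>n. N n)"
    by (intro tendsto_diff tendsto_const) simp
  moreover have "measure ?M (\<Inter>n. N n) = measure ?M (C \<inter> (\<Inter>n. N n))"
    using AE_coef_in_carrier by (intro measure_eq_AE IN sets.Int C) (auto simp: C_def)
  moreover have "{d \<in> space ?M. padic_poly_irreducible p (monic_quartic_of_digits p d)} = space ?M - (C \<inter> (\<Inter>n. N n))"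
    using irr by auto
  ultimately show ?thesis
    using digit_prob.prob_compl[OF sets.Int[OF C IN]] by simp
qed

end

theorem theorem7:
  fixes p :: nat
  assumes "Factorial_Ring.prime p" and "odd p"
  shows "measure (digit_space p)
           {d \<in> space (digit_space p). padic_poly_irreducible p (monic_quartic_of_digits p d)}
         = (real p^12 + real p^11 + 2*real p^10 + 4*real p^9 - 2*real p^8 + real p^7
            + 3*real p^6 - 6*real p^5 + 6*real p^4 - 4*real p^3 - 2*real p^2 - 4)
           / (4 * (real p + 1) * (real p^2 + 1) * (real p^9 - 1))"
proof -
  interpret odd_padic p using assms by unfold_locales
  show ?thesis using irr_density_value[OF irr_density_tendsto_measure] by simp
qed

end
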